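(* For every integer $d\geq 4$, $$ N_{\mathrm{PL}}(d)\leq 279928\cdot d(d-1)\cdot \left(6 d^3\cdot (22.2)^{\frac{3(d-1)}{2}}\right)^{2d} e^{\frac{\Gamma(2d^2)}{(2\pi)^{2d+2}}} .$$
   Context: Let $\mathrm{PL}(n)$ denote the number of plane partitions of $n$, i.e. $\sum_{n\ge0}\mathrm{PL}(n)x^n=\prod_{k\geq1}(1-x^k)^{-k}$. A plane partition of $n$ is an array $(\pi_{i,j})$ of non-negative integers with non-increasing rows and columns and $\sum_{i,j}\pi_{i,j}=n$. For positive integers $d$ and non-negative integers $n$, the Jensen polynomial of degree $d$ and shift $n$ is $J_{\mathrm{PL}}^{d,n}(x)=\sum_{j=0}^d\binom{d}{j}\mathrm{PL}(n+j)x^j$. A real polynomial is hyperbolic if all its zeros are real. $N_{\mathrm{PL}}(d)$ denotes the minimal integer such that $J_{\mathrm{PL}}^{d,n}(x)$ is hyperbolic for all $n\geq N_{\mathrm{PL}}(d)$ (such an integer exists). *)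

theory Defs
  imports "HOL-Analysis.Analysis" "HOL-Computational_Algebra.Polynomial"
begin

text \<open>Arrays are indexed by pairs of natural numbers starting from 0. Since entries are
  non-negative integers, a finite total is the same as finite support; the finiteness condition is
  needed because \<^const>\<open>sum\<close> over an infinite set is 0.\<close>

definition plane_partition :: "(nat \<Rightarrow> nat \<Rightarrow> nat) \<Rightarrow> nat \<Rightarrow> bool" where
  "plane_partition \<pi> n \<longleftrightarrow>
     (\<forall>i j. \<pi> i (Suc j) \<le> \<pi> i j) \<and>
     (\<forall>i j. \<pi> (Suc i) j \<le> \<pi> i j) \<and>
     finite {(i, j). \<pi> i j \<noteq> 0} \<and>
     (\<Sum>(i, j)\<in>{(i, j). \<pi> i j \<noteq> 0}. \<pi> i j) = n"

definition PL :: "nat \<Rightarrow> nat" where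
  "PL n = card {\<pi>. plane_partition \<pi> n}"

definition jensen_poly :: "(nat \<Rightarrow> real) \<Rightarrow> nat \<Rightarrow> nat \<Rightarrow> real poly" where
  "jensen_poly a d n = (\<Sum>j=0..d. monom (real (d choose j) * a (n + j)) j)"

definition hyperbolic :: "real poly \<Rightarrow> bool" where
  "hyperbolic p \<longleftrightarrow> (\<forall>z::complex. poly (map_poly complex_of_real p) z = 0 \<longrightarrow> z \<in> \<real>)"

definition N_PL :: "nat \<Rightarrow> nat" where
  "N_PL d = (LEAST N. \<forall>n\<ge>N. hyperbolic (jensen_poly (\<lambda>k. real (PL k)) d n))"

text \<open>The set counted by \<^const>\<open>PL\<close> is finite, so \<^const>\<open>card\<close> is its genuine cardinality.\<close>

lemma finite_plane_partitions: "finite {\<pi>. plane_partition \<pi> n}"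
proof -
  let ?B = "{..<n} \<times> {..<n}"
  have bound: "i < n \<and> j < n \<and> \<pi> i j \<le> n" if pp: "plane_partition \<pi> n" and nz: "\<pi> i j \<noteq> 0" for \<pi> i j
  proof -
    let ?S = "{(i, j). \<pi> i j \<noteq> 0}"
    have fin: "finite ?S" and tot: "(\<Sum>(i, j)\<in>?S. \<pi> i j) = n"
      using pp by (auto simp: plane_partition_def)
    have sub: "(\<Sum>(i, j)\<in>T. \<pi> i j) \<le> n" if "T \<subseteq> ?S" for T
      using sum_mono2[OF fin that, of "\<lambda>(i, j). \<pi> i j"] tot by auto
    have crd: "card T \<le> n" if "T \<subseteq> ?S" for T
    proof -
      have "card T = (\<Sum>x\<in>T. 1)" by simp
      also have "\<dots> \<le> (\<Sum>(i, j)\<in>T. \<pi> i j)" using that by (intro sum_mono) auto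
      also have "\<dots> \<le> n" by (rule sub[OF that])
      finally show ?thesis .
    qed
    have row: "\<pi> i j \<le> \<pi> i j'" if "j' \<le> j" for j'
      using pp by (intro lift_Suc_antimono_le[OF _ that]) (auto simp: plane_partition_def)
    have col: "\<pi> i j \<le> \<pi> i' j" if "i' \<le> i" for i'
      using pp by (intro lift_Suc_antimono_le[of "\<lambda>i. \<pi> i j", OF _ that]) (auto simp: plane_partition_def)
    have "Pair i ` {..j} \<subseteq> ?S" using row nz by fastforce
    from crd[OF this] have "j < n" by (simp add: card_image inj_on_def)
    moreover have "(\<lambda>i. (i, j)) ` {..i} \<subseteq> ?S" using col nz by fastforce
    from crd[OF this] have "i < n" by (simp add: card_image inj_on_def)
    moreover have "\<pi> i j \<le> n" using sub[of "{(i, j)}"] nz by simp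
    ultimately show ?thesis by blast
  qed
  have "finite {f. (\<forall>x\<in>?B. f x \<in> {..n}) \<and> (\<forall>x. x \<notin> ?B \<longrightarrow> f x = (0::nat))}"
    using finite_set_of_finite_funs[of ?B "{..n}" "0::nat"]
    by (rule rev_finite_subset) auto
  moreover have "case_prod ` {\<pi>. plane_partition \<pi> n} \<subseteq>
      {f. (\<forall>x\<in>?B. f x \<in> {..n}) \<and> (\<forall>x. x \<notin> ?B \<longrightarrow> f x = (0::nat))}"
  proof clarsimp
    fix \<pi> assume pp: "plane_partition \<pi> n"
    have "\<pi> i j \<le> n" for i j using bound[OF pp, of i j] by (cases "\<pi> i j = 0") auto
    moreover have "\<pi> i j = 0" if "i < n \<longrightarrow> \<not> j < n" for i j using bound[OF pp, of i j] that by blast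
    ultimately show "(\<forall>i\<in>{..<n}. \<forall>j\<in>{..<n}. \<pi> i j \<le> n) \<and> (\<forall>i j. (i < n \<longrightarrow> \<not> j < n) \<longrightarrow> \<pi> i j = 0)"
      by blast
  qed
  ultimately have "finite (case_prod ` {\<pi>. plane_partition \<pi> n})"
    using finite_subset by blast
  moreover have "inj_on case_prod {\<pi>. plane_partition \<pi> n}"
    by (metis curry_case_prod inj_onI)
  ultimately show ?thesis
    by (rule finite_imageD)
qed

end

theory Submission
  imports Defs "HOL-Complex_Analysis.Complex_Analysis" "HOL-Probability.Distributions"
    "HOL-Probability.Characteristic_Functions"
begin

text \<open>Filling the cells of a Young diagram one corner at a time and toggling the diagonal through
  each new corner turns arbitrary fillings into reverse plane partitions, with diagonal sums equal to
  rectangle sums (the toggle form of the RSK correspondence). This yields MacMahon's formula in the form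
  \<open>\<Sum> PL n z^n = exp (\<Sum> \<sigma>\<^sub>2 N / N \<cdot> z^N)\<close>, where \<open>N \<le> \<sigma>\<^sub>2 N / N \<le> 2 N\<close>.

  Choose the radius \<open>q\<close> such that \<open>n\<close> is the exact saddle point. On the circle of radius \<open>q\<close> the
  generating function is then close to a Gaussian near the positive real axis and tiny elsewhere, because
  the exponent is dominated by the Koebe function \<open>\<Sum> N z^N = z / (1 - z)^2\<close>, so no arc
  needs separate number-theoretic treatment. Writing the Jensen polynomial as one integral over this circle,
  an affine change of the reciprocal variable brings it within distance 1 of the Hermite polynomial
  \<open>He\<^sub>d w = E (w - i Z)^d\<close> on \<open>[-d, d]\<close>, as soon as \<open>n\<close> exceeds an explicit threshold far below
  the claimed bound. The Wronskian of consecutive Hermite polynomials is at least 1, hence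
  \<open>\<bar>He\<^sub>d\<bar> \<ge> 1\<close> at the zeros of \<open>He\<^sub>d\<^sub>-\<^sub>1\<close>, with alternating signs. The perturbed
  polynomial has the same signs there and therefore has \<open>d\<close> real zeros.\<close>

section \<open>MacMahon's formula\<close>

text \<open>The Cauchy integrals for \<open>PL (n + j)\<close> with j <= d differ only by the factor
  exp (-i j t). Summed with binomial coefficients they become one integral of exp (psi t) times a
  d-th power; after division by z^d and the real Moebius substitution w = sd (1 + q / z) the base of
  that power is w + sd (exp (-i t) - 1). To first order in t this is w - i sd t, exactly the base in
  the Gaussian integral for the Hermite polynomial, which is why the reciprocal variable is used.
  All sizes are measured in eps = 1 - q. The width 1 / sd of the peak is of order eps^2, the error
  near t = 0 carries a factor eps, and the rest of the circle contributes an amount exponentially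
  small in 1 / eps^2. Since n <= 4 / eps^3, a requirement 1 / eps >= T follows from n >= 4 T^3. The
  constants are generous: a factor exp 325 enters T, so exp 975 enters the bound for n, and it is
  absorbed by the exponential of the Gamma quotient, whose exponent is at least 975 from d = 4
  on.\<close>

definition fillings :: "'a set \<Rightarrow> ('a \<Rightarrow> nat) set" where
  "fillings S = {A. \<forall>u. u \<notin> S \<longrightarrow> A u = 0}"

text \<open>Cells are indexed from 1, so that a function supported on a shape vanishes at index 0.\<close>

definition shape :: "(nat \<times> nat) set \<Rightarrow> bool" where
  "shape S \<longleftrightarrow> (\<forall>x y. (x, y) \<in> S \<longrightarrow> 1 \<le> x \<and> 1 \<le> y \<and> {1..x} \<times> {1..y} \<subseteq> S)"

definition reverse_pps :: "(nat \<times> nat) set \<Rightarrow> (nat \<times> nat \<Rightarrow> nat) set" where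
  "reverse_pps S = {p \<in> fillings S. \<forall>x y.
     ((x, Suc y) \<in> S \<longrightarrow> p (x, y) \<le> p (x, Suc y)) \<and> ((Suc x, y) \<in> S \<longrightarrow> p (x, y) \<le> p (Suc x, y))}"

fun diag_sum :: "(nat \<times> nat \<Rightarrow> nat) \<Rightarrow> nat \<Rightarrow> nat \<Rightarrow> nat" where
  "diag_sum p (Suc x) (Suc y) = p (Suc x, Suc y) + diag_sum p x y"
| "diag_sum p x y = 0"

definition rect_sum :: "(nat \<times> nat \<Rightarrow> nat) \<Rightarrow> nat \<Rightarrow> nat \<Rightarrow> nat" where
  "rect_sum A x y = (\<Sum>u\<in>{1..x} \<times> {1..y}. A u)"

text \<open>\<open>x + j = y + i\<close> expresses "same diagonal" without subtraction. Neighbours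
  with index 0 read the value 0 when \<open>p\<close> is supported on a shape. At the corner there
  are no larger neighbours inside the shape, so the new entry \<open>a\<close> takes the place of
  the difference \<open>min - p\<close>.\<close>

definition toggle :: "nat \<Rightarrow> nat \<Rightarrow> (nat \<times> nat \<Rightarrow> nat) \<times> nat \<Rightarrow> nat \<times> nat \<Rightarrow> nat" where
  "toggle i j = (\<lambda>(p, a) (x, y).
     if x + j = y + i \<and> 1 \<le> x \<and> 1 \<le> y \<and> x \<le> i then
       max (p (x - 1, y)) (p (x, y - 1)) +
         (if x = i then a else min (p (x + 1, y)) (p (x, y + 1)) - p (x, y))
     else p (x, y))"

text \<open>Before the corner this is the same rule old + new = max + min; the corner itself leaves
  the support and is reset to 0. On reverse plane partitions no subtraction in \<open>toggle\<close>
  or \<open>untoggle\<close> truncates: an inner entry is at most the \<open>min\<close>, and the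
  corner entry is at least the \<open>max\<close>.\<close>

definition untoggle :: "nat \<Rightarrow> nat \<Rightarrow> (nat \<times> nat \<Rightarrow> nat) \<Rightarrow> (nat \<times> nat \<Rightarrow> nat) \<times> nat" where
  "untoggle i j p =
     ((\<lambda>(x, y). if x + j = y + i \<and> 1 \<le> x \<and> 1 \<le> y \<and> x \<le> i then
        (if x = i then 0
         else max (p (x - 1, y)) (p (x, y - 1)) + min (p (x + 1, y)) (p (x, y + 1)) - p (x, y))
      else p (x, y)),
      p (i, j) - max (p (i - 1, j)) (p (i, j - 1)))"

lemma toggle_out:
  "\<not> (x + j = y + i \<and> 1 \<le> x \<and> 1 \<le> y \<and> x \<le> i) \<Longrightarrow> toggle i j (p, a) (x, y) = p (x, y)"
  unfolding toggle_def by (simp only: prod.case if_False)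

lemma untoggle_out:
  "\<not> (x + j = y + i \<and> 1 \<le> x \<and> 1 \<le> y \<and> x \<le> i) \<Longrightarrow> fst (untoggle i j p) (x, y) = p (x, y)"
  unfolding untoggle_def by (simp only: prod.case fst_conv if_False)

lemma toggle_off: "x + j \<noteq> y + i \<Longrightarrow> toggle i j (p, a) (x, y) = p (x, y)"
  by (simp add: toggle_def)

lemma untoggle_off: "x + j \<noteq> y + i \<Longrightarrow> fst (untoggle i j p) (x, y) = p (x, y)"
  by (simp add: untoggle_def)

lemma toggle_on:
  "x + j = y + i \<Longrightarrow> 1 \<le> x \<Longrightarrow> 1 \<le> y \<Longrightarrow> x < i \<Longrightarrow> toggle i j (p, a) (x, y) =
     max (p (x - 1, y)) (p (x, y - 1)) + (min (p (x + 1, y)) (p (x, y + 1)) - p (x, y))"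
  by (simp add: toggle_def)

lemma untoggle_on:
  "x + j = y + i \<Longrightarrow> 1 \<le> x \<Longrightarrow> 1 \<le> y \<Longrightarrow> x < i \<Longrightarrow> fst (untoggle i j p) (x, y) =
     max (p (x - 1, y)) (p (x, y - 1)) + min (p (x + 1, y)) (p (x, y + 1)) - p (x, y)"
  by (simp add: untoggle_def)

lemma toggle_corner:
  "1 \<le> i \<Longrightarrow> 1 \<le> j \<Longrightarrow> toggle i j (p, a) (i, j) = max (p (i - 1, j)) (p (i, j - 1)) + a"
  by (simp add: toggle_def)

section \<open>Adding one corner cell to a shape\<close>

locale corner =
  fixes S :: "(nat \<times> nat) set" and i j :: nat
  assumes shape: "shape S" and shape': "shape (insert (i, j) S)" and new: "(i, j) \<notin> S"
begin

abbreviation "S' \<equiv> insert (i, j) S"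

lemma ij: "1 \<le> i" "1 \<le> j"
  using shape' by (auto simp: shape_def)

lemma below: "(x, y) \<in> S" if "1 \<le> x" "x \<le> i" "1 \<le> y" "y \<le> j" "(x, y) \<noteq> (i, j)"
proof -
  have "{1..i} \<times> {1..j} \<subseteq> S'" using shape' unfolding shape_def by blast
  moreover have "(x, y) \<in> {1..i} \<times> {1..j}" using that by auto
  ultimately show ?thesis using that(5) by blast
qed

lemma above: "(x, y) \<notin> S" if "i \<le> x" "j \<le> y"
proof
  assume "(x, y) \<in> S"
  then have "{1..x} \<times> {1..y} \<subseteq> S" using shape unfolding shape_def by blast
  moreover have "(i, j) \<in> {1..x} \<times> {1..y}" using ij that by auto
  ultimately show False using new by blast
qed

text \<open>Monotonicity of \<open>p\<close> gives max <= p <= min at every inner cell of the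
  diagonal, so max + (min - p) again lies between max and min. In each direction there are three
  cases: the larger cell of the pair is toggled, the smaller one is, or neither.\<close>

lemma toggle_in: "toggle i j (p, a) \<in> reverse_pps S'" if p: "p \<in> reverse_pps S"
proof -
  have z: "p u = 0" if "u \<notin> S" for u using p that by (cases u) (simp add: reverse_pps_def fillings_def)
  have r: "(x, Suc y) \<in> S \<Longrightarrow> p (x, y) \<le> p (x, Suc y)" and d: "(Suc x, y) \<in> S \<Longrightarrow> p (x, y) \<le> p (Suc x, y)" for x y
    using p by (auto simp: reverse_pps_def)
  have "toggle i j (p, a) (x, y) = 0" if u: "(x, y) \<notin> S'" for x y
  proof -
    from u have "\<not> (x + j = y + i \<and> 1 \<le> x \<and> 1 \<le> y \<and> x \<le> i)" using below[of x y] by auto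
    then have "toggle i j (p, a) (x, y) = p (x, y)" by (auto simp: toggle_def)
    then show ?thesis using z u by simp
  qed
  then have "toggle i j (p, a) \<in> fillings S'" by (simp add: fillings_def split_paired_all del: insert_iff)
  moreover have "toggle i j (p, a) (x, y) \<le> toggle i j (p, a) (x, Suc y)" if u: "(x, Suc y) \<in> S'" for x y
  proof -
    consider (1) "x + j = Suc y + i" "1 \<le> x" "x \<le> i" | (2) "x + j = y + i" "1 \<le> x" "1 \<le> y" "x \<le> i"
      | (3) "\<not> (x + j = Suc y + i \<and> 1 \<le> x \<and> x \<le> i)" "\<not> (x + j = y + i \<and> 1 \<le> x \<and> 1 \<le> y \<and> x \<le> i)"
      by blast
    then show ?thesis
    proof cases
      case 1
      then show ?thesis by (auto simp: toggle_def)
    next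
      case 2
      \<comment> \<open>The corner has no right neighbour in the shape, so the toggled cell lies
        strictly before the corner and all four of its neighbours are controlled.\<close>
      have "x \<noteq> i" using u 2 above[of x "Suc y"] by auto
      then have x: "x < i" "y < j" using 2 by auto
      have s: "(x, y) \<in> S" "(x, Suc y) \<in> S" "(Suc x, y) \<in> S" using below x 2 by auto
      have "p (x - 1, y) \<le> p (x, y)" using d[of "x - 1" y] s 2 by auto
      moreover have "p (x, y - 1) \<le> p (x, y)" using r[of x "y - 1"] s 2 by auto
      moreover have "p (x, y) \<le> p (x, Suc y)" "p (x, y) \<le> p (Suc x, y)" using r d s by auto
      ultimately show ?thesis using 2 x by (auto simp: toggle_def)
    next
      case 3
      then have "(x, Suc y) \<in> S" using u ij by auto
      then show ?thesis using r 3 by (auto simp: toggle_def)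
    qed
  qed
  moreover have "toggle i j (p, a) (x, y) \<le> toggle i j (p, a) (Suc x, y)" if u: "(Suc x, y) \<in> S'" for x y
  proof -
    consider (1) "Suc x + j = y + i" "1 \<le> y" "Suc x \<le> i" | (2) "x + j = y + i" "1 \<le> x" "1 \<le> y" "x \<le> i"
      | (3) "\<not> (Suc x + j = y + i \<and> 1 \<le> y \<and> Suc x \<le> i)" "\<not> (x + j = y + i \<and> 1 \<le> x \<and> 1 \<le> y \<and> x \<le> i)"
      by blast
    then show ?thesis
    proof cases
      case 1
      then show ?thesis by (auto simp: toggle_def)
    next
      case 2
      have "x \<noteq> i" using u 2 above[of "Suc x" y] by auto
      then have x: "x < i" "y < j" using 2 by auto
      have s: "(x, y) \<in> S" "(x, Suc y) \<in> S" "(Suc x, y) \<in> S" using below x 2 by auto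
      have "p (x - 1, y) \<le> p (x, y)" using d[of "x - 1" y] s 2 by auto
      moreover have "p (x, y - 1) \<le> p (x, y)" using r[of x "y - 1"] s 2 by auto
      moreover have "p (x, y) \<le> p (x, Suc y)" "p (x, y) \<le> p (Suc x, y)" using r d s by auto
      ultimately show ?thesis using 2 x by (auto simp: toggle_def)
    next
      case 3
      then have "(Suc x, y) \<in> S" using u ij by auto
      then show ?thesis using d 3 by (auto simp: toggle_def)
    qed
  qed
  ultimately show ?thesis by (auto simp: reverse_pps_def)
qed

lemma untoggle_in: "untoggle i j p \<in> reverse_pps S \<times> UNIV" if p: "p \<in> reverse_pps S'"
proof -
  define q where "q = fst (untoggle i j p)"
  have q: "q (x, y) = (if x + j = y + i \<and> 1 \<le> x \<and> 1 \<le> y \<and> x \<le> i then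
        (if x = i then 0
         else max (p (x - 1, y)) (p (x, y - 1)) + min (p (x + 1, y)) (p (x, y + 1)) - p (x, y))
      else p (x, y))" for x y by (simp add: q_def untoggle_def)
  have z: "p u = 0" if "u \<notin> S'" for u using p that by (cases u) (simp add: reverse_pps_def fillings_def)
  have r: "(x, Suc y) \<in> S' \<Longrightarrow> p (x, y) \<le> p (x, Suc y)" and d: "(Suc x, y) \<in> S' \<Longrightarrow> p (x, y) \<le> p (Suc x, y)" for x y
    using p by (auto simp: reverse_pps_def)
  have main: "p (x - 1, y) \<le> p (x, y) \<and> p (x, y - 1) \<le> p (x, y) \<and> p (x, y) \<le> p (x, Suc y) \<and> p (x, y) \<le> p (Suc x, y)"
    if "x + j = y + i" "1 \<le> x" "1 \<le> y" "x < i" for x y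
  proof -
    have s: "(x, y) \<in> S'" "(x, Suc y) \<in> S'" "(Suc x, y) \<in> S'" using below that by auto
    have "p (x - 1, y) \<le> p (x, y)" using d[of "x - 1" y] s that by auto
    moreover have "p (x, y - 1) \<le> p (x, y)" using r[of x "y - 1"] s that by auto
    ultimately show ?thesis using r d s by auto
  qed
  have "q \<in> fillings S"
    unfolding fillings_def
  proof (clarify)
    fix x y assume u: "(x, y) \<notin> S"
    show "q (x, y) = 0"
    proof (cases "x + j = y + i \<and> 1 \<le> x \<and> 1 \<le> y \<and> x \<le> i")
      case True
      then have "x = i" using u below[of x y] by auto
      then show ?thesis using True by (simp add: q)
    next
      case False
      then have "(x, y) \<notin> S'" using u ij by auto
      then have "p (x, y) = 0" by (rule z)
      then show ?thesis using False by (simp only: q if_False)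
    qed
  qed
  moreover have "q (x, y) \<le> q (x, Suc y)" if u: "(x, Suc y) \<in> S" for x y
  proof -
    consider (1) "x + j = Suc y + i" "1 \<le> x" "x \<le> i" | (2) "x + j = y + i" "1 \<le> x" "1 \<le> y" "x \<le> i"
      | (3) "\<not> (x + j = Suc y + i \<and> 1 \<le> x \<and> x \<le> i)" "\<not> (x + j = y + i \<and> 1 \<le> x \<and> 1 \<le> y \<and> x \<le> i)"
      by blast
    then show ?thesis
    proof cases
      case 1
      then have "x < i" using u new by (cases "x = i") auto
      then show ?thesis using 1 main[of x "Suc y"] by (auto simp: q)
    next
      case 2
      have "x \<noteq> i" using u 2 above[of x "Suc y"] by auto
      then show ?thesis using 2 main[of x y] by (auto simp: q)
    next
      case 3
      then show ?thesis using u r[of x y] by (auto simp: q)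
    qed
  qed
  moreover have "q (x, y) \<le> q (Suc x, y)" if u: "(Suc x, y) \<in> S" for x y
  proof -
    consider (1) "Suc x + j = y + i" "1 \<le> y" "Suc x \<le> i" | (2) "x + j = y + i" "1 \<le> x" "1 \<le> y" "x \<le> i"
      | (3) "\<not> (Suc x + j = y + i \<and> 1 \<le> y \<and> Suc x \<le> i)" "\<not> (x + j = y + i \<and> 1 \<le> x \<and> 1 \<le> y \<and> x \<le> i)"
      by blast
    then show ?thesis
    proof cases
      case 1
      then have "Suc x < i" using u new by (cases "Suc x = i") auto
      then show ?thesis using 1 main[of "Suc x" y] by (auto simp: q)
    next
      case 2
      have "x \<noteq> i" using u 2 above[of "Suc x" y] by auto
      then show ?thesis using 2 main[of x y] by (auto simp: q)
    next
      case 3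
      then show ?thesis using u d[of x y] by (auto simp: q)
    qed
  qed
  ultimately show ?thesis by (auto simp: reverse_pps_def mem_Times_iff q_def)
qed

text \<open>The four neighbours lie on the two adjacent diagonals, which a toggle leaves unchanged.
  So the inverse computes with the same \<open>max\<close> and \<open>min\<close>, and all cells of
  a diagonal can be toggled at once.\<close>

lemma off_diagonal:
  assumes "x + j = y + i" "1 \<le> x" "1 \<le> y"
  shows "x - 1 + j \<noteq> y + i" "x + j \<noteq> y - 1 + i" "x + 1 + j \<noteq> y + i" "x + j \<noteq> y + 1 + i"
  using assms by auto

lemma untoggle_toggle: "untoggle i j (toggle i j (p, a)) = (p, a)" if p: "p \<in> reverse_pps S"
proof -
  have z: "p (x, y) = 0" if "(x, y) \<notin> S" for x y using p that by (simp add: reverse_pps_def fillings_def)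
  have r: "(x, Suc y) \<in> S \<Longrightarrow> p (x, y) \<le> p (x, Suc y)" and d: "(Suc x, y) \<in> S \<Longrightarrow> p (x, y) \<le> p (Suc x, y)" for x y
    using p by (auto simp: reverse_pps_def)
  have "fst (untoggle i j (toggle i j (p, a))) (x, y) = p (x, y)" for x y
  proof (cases "x + j = y + i \<and> 1 \<le> x \<and> 1 \<le> y \<and> x < i")
    case True
    then have s: "(x, Suc y) \<in> S" "(Suc x, y) \<in> S" using below by auto
    have "p (x, y) \<le> min (p (x + 1, y)) (p (x, y + 1))" using r d s by auto
    then have arith: "M + min (p (x + 1, y)) (p (x, y + 1)) - (M + (min (p (x + 1, y)) (p (x, y + 1)) - p (x, y))) = p (x, y)" for M
      by linarith
    have nb: "toggle i j (p, a) (x - 1, y) = p (x - 1, y)" "toggle i j (p, a) (x, y - 1) = p (x, y - 1)"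
      "toggle i j (p, a) (x + 1, y) = p (x + 1, y)" "toggle i j (p, a) (x, y + 1) = p (x, y + 1)"
      using True by (intro toggle_off off_diagonal; simp)+
    have on: "x + j = y + i" "1 \<le> x" "1 \<le> y" "x < i" using True by auto
    show ?thesis by (simp only: untoggle_on[OF on] toggle_on[OF on] nb arith)
  next
    case False
    show ?thesis
    proof (cases "x = i \<and> y = j")
      case True
      then show ?thesis using z new ij by (simp add: untoggle_def)
    next
      case nij: False
      then have "\<not> (x + j = y + i \<and> 1 \<le> x \<and> 1 \<le> y \<and> x \<le> i)" using False by auto
      then show ?thesis by (simp only: untoggle_out toggle_out not_False_eq_True)
    qed
  qed
  moreover have "snd (untoggle i j (toggle i j (p, a))) = a"
    using ij off_diagonal(1,2)[of i j] by (simp add: untoggle_def toggle_off toggle_corner)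
  ultimately show ?thesis by (simp add: prod_eq_iff fun_eq_iff)
qed

lemma toggle_untoggle: "toggle i j (untoggle i j p) = p" if p: "p \<in> reverse_pps S'"
proof -
  have r: "(x, Suc y) \<in> S' \<Longrightarrow> p (x, y) \<le> p (x, Suc y)" and d: "(Suc x, y) \<in> S' \<Longrightarrow> p (x, y) \<le> p (Suc x, y)" for x y
    using p by (auto simp: reverse_pps_def)
  obtain q a where qa: "untoggle i j p = (q, a)" by force
  have q_off: "x + j \<noteq> y + i \<Longrightarrow> q (x, y) = p (x, y)" for x y
    using untoggle_off[of x j y i p] by (simp add: qa)
  have "toggle i j (q, a) (x, y) = p (x, y)" for x y
  proof (cases "x + j = y + i \<and> 1 \<le> x \<and> 1 \<le> y \<and> x \<le> i")
    case True
    then have s: "(x, y) \<in> S'" by (cases "x = i") (use below[of x y] in auto)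
    have 1: "p (x - 1, y) \<le> p (x, y)" using d[of "x - 1" y] s True by auto
    have 2: "p (x, y - 1) \<le> p (x, y)" using r[of x "y - 1"] s True by auto
    have t: "q (x - 1, y) = p (x - 1, y)" "q (x, y - 1) = p (x, y - 1)"
      "q (x + 1, y) = p (x + 1, y)" "q (x, y + 1) = p (x, y + 1)"
      using True by (intro q_off off_diagonal; simp)+
    show ?thesis
    proof (cases "x = i")
      case xi: True
      then have "y = j" using True by simp
      moreover have "a = p (i, j) - max (p (i - 1, j)) (p (i, j - 1))"
        using qa by (simp add: untoggle_def)
      ultimately show ?thesis using 1 2 xi ij t(1,2)
        by (simp add: toggle_corner)
    next
      case False
      then have "(x, Suc y) \<in> S'" "(Suc x, y) \<in> S'" using below True by auto
      then have "p (x, y) \<le> min (p (x + 1, y)) (p (x, y + 1))" using r d by auto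
      moreover have "q (x, y) = max (p (x - 1, y)) (p (x, y - 1)) + min (p (x + 1, y)) (p (x, y + 1)) - p (x, y)"
        using untoggle_on[of x j y i p] True False by (simp add: qa)
      moreover have "max (p (x - 1, y)) (p (x, y - 1)) \<le> p (x, y)" using 1 2 by simp
      ultimately have arith: "max (p (x - 1, y)) (p (x, y - 1)) + (min (p (x + 1, y)) (p (x, y + 1)) - q (x, y)) = p (x, y)"
        by linarith
      have on: "x + j = y + i" "1 \<le> x" "1 \<le> y" "x < i" using True False by auto
      show ?thesis by (simp only: toggle_on[OF on] t arith)
    qed
  next
    case False
    then show ?thesis using untoggle_out[OF False, of p] toggle_out[OF False] by (simp add: qa)
  qed
  then show ?thesis by (simp add: fun_eq_iff qa)
qed

lemma bij_toggle: "bij_betw (toggle i j) (reverse_pps S \<times> UNIV) (reverse_pps S')"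
proof (rule bij_betw_byWitness[where f' = "untoggle i j"])
  show "untoggle i j ` reverse_pps S' \<subseteq> reverse_pps S \<times> UNIV"
    by (intro image_subsetI untoggle_in)
qed (use toggle_in untoggle_toggle toggle_untoggle in auto)

lemma diag_sum_toggle_off: "diag_sum (toggle i j (p, a)) x y = diag_sum p x y" if "x + j \<noteq> y + i"
  using that by (induction p x y rule: diag_sum.induct) (auto simp: toggle_def)

text \<open>Each toggle satisfies new + old = max of the smaller neighbours + min of the larger
  ones. Along the diagonal this telescopes: the \<open>max\<close> in the claim for one cell is the
  \<open>max\<close> of the smaller neighbours of the next cell, and max + min of the two larger
  neighbours is their sum, which extends both adjacent diagonal sums.\<close>

lemma diag_sum_toggle_aux:
  assumes p: "p \<in> reverse_pps S"
  shows "x + j = y + i \<Longrightarrow> x < i \<Longrightarrow> diag_sum (toggle i j (p, a)) x y + diag_sum p x y +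
    max (p (x, Suc y)) (p (Suc x, y)) = diag_sum p x (Suc y) + diag_sum p (Suc x) y"
proof (induction x arbitrary: y)
  case 0
  have "p (0, y) = 0" "p (y, 0) = 0" for y
    using p shape by (force simp: reverse_pps_def fillings_def shape_def)+
  then show ?case by (cases y) auto
next
  case (Suc x)
  have z: "p (x, 0) = 0" for x
    using p shape by (force simp: reverse_pps_def fillings_def shape_def)
  show ?case
  proof (cases y)
    case 0
    then show ?thesis using z by simp
  next
    case (Suc y')
    have r: "(x, Suc y) \<in> S \<Longrightarrow> p (x, y) \<le> p (x, Suc y)" and d: "(Suc x, y) \<in> S \<Longrightarrow> p (x, y) \<le> p (Suc x, y)" for x y
      using p by (auto simp: reverse_pps_def)
    have "p (Suc x, y) \<le> p (Suc x, Suc y)" "p (Suc x, y) \<le> p (Suc (Suc x), y)"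
      using r d below[of "Suc x" "Suc y"] below[of "Suc (Suc x)" y] Suc.prems \<open>y = _\<close> by auto
    then have "toggle i j (p, a) (Suc x, y) + p (Suc x, y) = max (p (x, y)) (p (Suc x, y')) + min (p (Suc (Suc x), y)) (p (Suc x, Suc y))"
      using Suc.prems \<open>y = _\<close> by (auto simp: toggle_def)
    then show ?thesis using Suc.IH[of y'] Suc.prems \<open>y = _\<close> by (auto simp: max_def min_def split: if_splits)
  qed
qed

text \<open>This is the inclusion-exclusion recursion \<open>rect_sum_Suc\<close> with diagonal sums
  in place of rectangle sums; the agreement of the two therefore survives the addition of a
  corner.\<close>

lemma diag_sum_toggle:
  assumes p: "p \<in> reverse_pps S"
  shows "diag_sum (toggle i j (p, a)) i j + diag_sum p (i - 1) (j - 1) = a + diag_sum p (i - 1) j + diag_sum p i (j - 1)"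
proof -
  obtain i' j' where ij': "i = Suc i'" "j = Suc j'" using ij by (metis Suc_pred' One_nat_def Suc_le_lessD)
  show ?thesis using diag_sum_toggle_aux[OF p, of i' j' a] by (auto simp: ij' toggle_def)
qed

end

section \<open>From fillings to reverse plane partitions\<close>

lemma sum_Times: "sum f (A \<times> B) = (\<Sum>x\<in>A. \<Sum>y\<in>B. f (x, y))"
  by (simp add: sum.cartesian_product)

lemma rect_sum_Suc:
  "rect_sum A (Suc x) (Suc y) + rect_sum A x y = A (Suc x, Suc y) + rect_sum A x (Suc y) + rect_sum A (Suc x) y"
  by (simp add: rect_sum_def sum_Times sum.distrib)

text \<open>A cell with the largest coordinate sum lies in the rectangle of no other cell, so it can
  be removed.\<close>

lemma exists_corner:
  assumes "finite S" "shape S" "S \<noteq> {}"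
  obtains i j where "(i, j) \<in> S" "shape (S - {(i, j)})"
proof -
  obtain u where u: "u \<in> S" "\<And>v. v \<in> S \<Longrightarrow> fst v + snd v \<le> fst u + snd u"
    using assms(1,3) Max_in[of "(\<lambda>u. fst u + snd u) ` S"] Max_ge[of "(\<lambda>u. fst u + snd u) ` S"]
    by (metis (no_types, lifting) finite_imageI imageE image_eqI image_is_empty)
  obtain i j where ij: "u = (i, j)" by force
  have "{1..x} \<times> {1..y} \<subseteq> S - {(i, j)}" if xy: "(x, y) \<in> S - {(i, j)}" for x y
  proof -
    have "(i, j) \<notin> {1..x} \<times> {1..y}" using u(2)[of "(x, y)"] xy by (auto simp: ij)
    then show ?thesis using xy assms(2) unfolding shape_def by blast
  qed
  then have "shape (S - {(i, j)})" using assms(2) unfolding shape_def by blast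
  then show thesis using that u(1) ij by blast
qed

lemma bij_betw_fillings_insert:
  assumes "u \<notin> S"
  shows "bij_betw (\<lambda>A. (A(u := 0), A u)) (fillings (insert u S)) (fillings S \<times> UNIV)"
proof (rule bij_betw_byWitness[where f' = "\<lambda>(A, a). A(u := a)"])
  show "\<forall>x\<in>fillings S \<times> UNIV. ((case x of (A, a) \<Rightarrow> A(u := a))(u := 0), (case x of (A, a) \<Rightarrow> A(u := a)) u) = x"
    using assms by (auto simp: fillings_def fun_eq_iff)
qed (auto simp: fillings_def)

text \<open>The condition on the cell \<open>(x, y)\<close> says that it is the last one on its diagonal; empty
  diagonals are included through the cells of index 0.\<close>

theorem fillings_reverse_pps_bij:
  assumes "finite S" "shape S"
  shows "\<exists>f. bij_betw f (fillings S) (reverse_pps S) \<and>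
    (\<forall>A\<in>fillings S. \<forall>x y. (x = 0 \<or> y = 0 \<or> (x, y) \<in> S) \<and> (Suc x, Suc y) \<notin> S \<longrightarrow>
       diag_sum (f A) x y = rect_sum A x y)"
  using assms
proof (induction "card S" arbitrary: S)
  case 0
  then have S: "S = {}" by simp
  have e: "diag_sum A 0 y = rect_sum A 0 y" "diag_sum A y 0 = rect_sum A y 0" for A y
    by (cases y; simp add: rect_sum_def)+
  have "diag_sum (id A) x y = rect_sum A x y" if "x = 0 \<or> y = 0 \<or> (x, y) \<in> S" for A x y
    using that by (elim disjE) (simp_all add: e del: diag_sum.simps, simp add: S)
  moreover have "bij_betw id (fillings S) (reverse_pps S)"
    by (simp add: S reverse_pps_def)
  ultimately show ?case by blast
next
  case (Suc n T)
  then have "T \<noteq> {}" by auto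
  then obtain i j where ijT: "(i, j) \<in> T" and sh: "shape (T - {(i, j)})"
    using exists_corner Suc.prems by metis
  define S where "S = T - {(i, j)}"
  have T: "T = insert (i, j) S" using ijT by (auto simp: S_def)
  interpret corner S i j
  proof
    show "shape S" using sh by (simp add: S_def)
    show "shape (insert (i, j) S)" using Suc.prems T by simp
    show "(i, j) \<notin> S" by (simp add: S_def)
  qed
  have "n = card S" "finite S" using Suc.hyps(2) Suc.prems ijT by (auto simp: S_def)
  from Suc.hyps(1)[OF this shape] obtain f where
    f: "bij_betw f (fillings S) (reverse_pps S)" and
    fs': "\<forall>A\<in>fillings S. \<forall>x y. (x = 0 \<or> y = 0 \<or> (x, y) \<in> S) \<and> (Suc x, Suc y) \<notin> S \<longrightarrow>
       diag_sum (f A) x y = rect_sum A x y" by (elim exE conjE)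
  have fs: "diag_sum (f A) x y = rect_sum A x y"
    if "A \<in> fillings S" "x = 0 \<or> y = 0 \<or> (x, y) \<in> S" "(Suc x, Suc y) \<notin> S" for A x y
    using bspec[OF fs' that(1)] that(2,3) by simp
  define s where "s = (\<lambda>A :: nat \<times> nat \<Rightarrow> nat. (A((i, j) := 0), A (i, j)))"
  define g where "g = toggle i j \<circ> map_prod f id \<circ> s"
  have "bij_betw s (fillings T) (fillings S \<times> UNIV)"
    unfolding s_def T by (rule bij_betw_fillings_insert[OF new])
  moreover have "bij_betw (map_prod f id) (fillings S \<times> UNIV) (reverse_pps S \<times> (UNIV :: nat set))"
    using f by (intro bij_betw_map_prod) auto
  ultimately have g: "bij_betw g (fillings T) (reverse_pps T)"
    unfolding g_def comp_assoc T using bij_toggle by (blast intro: bij_betw_trans)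
  have "diag_sum (g A) x y = rect_sum A x y"
    if A: "A \<in> fillings T" and xy: "x = 0 \<or> y = 0 \<or> (x, y) \<in> T" "(Suc x, Suc y) \<notin> T" for A x y
  proof -
    define B where "B = A((i, j) := 0)"
    have B: "B \<in> fillings S" using A by (auto simp: B_def fillings_def T)
    have gA: "g A = toggle i j (f B, A (i, j))" by (simp add: g_def s_def B_def)
    have fB: "f B \<in> reverse_pps S" using f B by (auto simp: bij_betw_def)
    have AB: "rect_sum A x y = rect_sum B x y" if "x < i \<or> y < j" for x y
      unfolding rect_sum_def by (rule sum.cong) (use that in \<open>auto simp: B_def\<close>)
    show ?thesis
    proof (cases "(x, y) = (i, j)")
      case True
      obtain i' j' where ij': "i = Suc i'" "j = Suc j'" using ij by (metis Suc_pred' One_nat_def Suc_le_lessD)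
      \<comment> \<open>Without the corner, each of the three cells (i', j'), (i, j') and (i', j) is
        the last on its diagonal or has index 0, so the induction hypothesis covers all of
        them.\<close>
      have "diag_sum (f B) i' j' = rect_sum B i' j'"
        by (rule fs[OF B]) (use below[of i' j'] new in \<open>auto simp: ij' Suc_le_eq\<close>)
      moreover have "diag_sum (f B) i j' = rect_sum B i j'"
        by (rule fs[OF B]) (use below[of i j'] above[of "Suc i" j] in \<open>auto simp: ij' Suc_le_eq\<close>)
      moreover have "diag_sum (f B) i' j = rect_sum B i' j"
        by (rule fs[OF B]) (use below[of i' j] above[of i "Suc j"] in \<open>auto simp: ij' Suc_le_eq\<close>)
      ultimately show ?thesis
        using diag_sum_toggle[OF fB, of "A (i, j)"] rect_sum_Suc[of A i' j'] AB True
        by (auto simp: gA ij')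
    next
      case False
      have *: "diag_sum (toggle i j (f B, A (i, j))) x y = diag_sum (f B) x y"
      proof (cases "x = 0 \<or> y = 0")
        case True
        then show ?thesis by (cases x; cases y; simp)
      next
        case nz: False
        then have xyS: "(x, y) \<in> S" using xy False by (auto simp: T)
        \<comment> \<open>A last cell other than the corner is not on the corner's diagonal: before
          the corner its successor would belong to \<open>T\<close>, and beyond the corner it could
          not belong to \<open>S\<close>.\<close>
        have "x + j \<noteq> y + i"
        proof
          assume e: "x + j = y + i"
          show False
          proof (cases "x < i")
            case True
            then show False using e xy(2) below[of "Suc x" "Suc y"] by (auto simp: T)
          next
            case False
            then show False using e xyS above[of x y] by auto
          qed
        qed
        then show ?thesis by (rule diag_sum_toggle_off)
      qed
      also have "\<dots> = rect_sum B x y"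
        by (rule fs[OF B]) (use xy False in \<open>auto simp: T\<close>)
      also have "\<dots> = rect_sum A x y"
      proof (cases "x < i \<or> y < j")
        case True
        then show ?thesis by (simp add: AB)
      next
        case False
        then have "(x, y) \<notin> S" using above by auto
        then have "x = 0 \<or> y = 0" using xy \<open>(x, y) \<noteq> _\<close> by (auto simp: T)
        then show ?thesis using False ij by auto
      qed
      finally show ?thesis by (simp add: gA)
    qed
  qed
  then show ?case using g by blast
qed

text \<open>Every diagonal of the square ends in the last row or the last column, and the cell (N,
  N) is counted once. The induction strips the last row and column, which shifts all diagonal sums
  by one step.\<close>

lemma sum_square_diag_sum:
  "(\<Sum>u\<in>{1..N} \<times> {1..N}. p u) = (\<Sum>y=1..N. diag_sum p N y) + (\<Sum>x=1..<N. diag_sum p x N)"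
proof (induction N)
  case (Suc N)
  have "(\<Sum>u\<in>{1..Suc N} \<times> {1..Suc N}. p u) =
    (\<Sum>u\<in>{1..N} \<times> {1..N}. p u) + (\<Sum>y=1..Suc N. p (Suc N, y)) + (\<Sum>x=1..N. p (x, Suc N))"
    by (simp add: sum_Times sum.distrib)
  moreover have "(\<Sum>y=1..Suc N. diag_sum p (Suc N) y) = (\<Sum>y=1..Suc N. p (Suc N, y)) + (\<Sum>y=0..N. diag_sum p N y)"
    unfolding atLeast0AtMost One_nat_def sum.shift_bounds_cl_Suc_ivl by (simp add: sum.distrib atLeast0AtMost)
  moreover have "(\<Sum>x=1..<Suc N. diag_sum p x (Suc N)) = (\<Sum>x=1..N. p (x, Suc N)) + (\<Sum>x=0..<N. diag_sum p x N)"
    unfolding One_nat_def atLeastLessThanSuc_atLeastAtMost[symmetric] sum.shift_bounds_Suc_ivl by (simp add: sum.distrib)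
  moreover have "(\<Sum>y=0..N. diag_sum p N y) = (\<Sum>y=1..N. diag_sum p N y)"
    by (cases N) (simp_all add: sum.atLeast_Suc_atMost)
  moreover have "(\<Sum>x=0..<N. diag_sum p x N) = (\<Sum>x=1..<N. diag_sum p x N)"
    by (cases N) (simp_all add: sum.atLeast_Suc_lessThan)
  ultimately show ?case using Suc.IH by linarith
qed simp

text \<open>The entry at (x, y) belongs to N + 1 - y of the rectangles of full height and to N - x
  of the others, so its total multiplicity is its hook length.\<close>

lemma sum_square_rect_sum:
  "(\<Sum>y=1..N. rect_sum A N y) + (\<Sum>x=1..<N. rect_sum A x N) =
   (\<Sum>(x, y)\<in>{1..N} \<times> {1..N}. (2 * N + 1 - x - y) * A (x, y))"
proof -
  have "(\<Sum>y=1..N. rect_sum A N y) = (\<Sum>y=1..N. \<Sum>u\<in>{1..N} \<times> {1..N}. if snd u \<le> y then A u else 0)"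
    unfolding rect_sum_def
    by (intro sum.cong refl sum.mono_neutral_cong_left) auto
  also have "\<dots> = (\<Sum>u\<in>{1..N} \<times> {1..N}. \<Sum>y=1..N. if snd u \<le> y then A u else 0)"
    by (rule sum.swap)
  also have "\<dots> = (\<Sum>u\<in>{1..N} \<times> {1..N}. (N + 1 - snd u) * A u)"
  proof (intro sum.cong refl)
    fix u assume "u \<in> {1..N} \<times> {1..N}"
    then have "{1..N} \<inter> {y. snd u \<le> y} = {snd u..N}" by auto
    then show "(\<Sum>y=1..N. if snd u \<le> y then A u else 0) = (N + 1 - snd u) * A u"
      by (simp add: sum.If_cases)
  qed
  finally have 1: "(\<Sum>y=1..N. rect_sum A N y) = (\<Sum>u\<in>{1..N} \<times> {1..N}. (N + 1 - snd u) * A u)" .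
  have "(\<Sum>x=1..<N. rect_sum A x N) = (\<Sum>x=1..<N. \<Sum>u\<in>{1..N} \<times> {1..N}. if fst u \<le> x then A u else 0)"
    unfolding rect_sum_def
    by (intro sum.cong refl sum.mono_neutral_cong_left) auto
  also have "\<dots> = (\<Sum>u\<in>{1..N} \<times> {1..N}. \<Sum>x=1..<N. if fst u \<le> x then A u else 0)"
    by (rule sum.swap)
  also have "\<dots> = (\<Sum>u\<in>{1..N} \<times> {1..N}. (N - fst u) * A u)"
  proof (intro sum.cong refl)
    fix u assume "u \<in> {1..N} \<times> {1..N}"
    then have "{1..<N} \<inter> {y. fst u \<le> y} = {fst u..<N}" by auto
    then show "(\<Sum>x=1..<N. if fst u \<le> x then A u else 0) = (N - fst u) * A u"
      by (simp add: sum.If_cases)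
  qed
  finally have 2: "(\<Sum>x=1..<N. rect_sum A x N) = (\<Sum>u\<in>{1..N} \<times> {1..N}. (N - fst u) * A u)" .
  show ?thesis unfolding 1 2 sum.distrib[symmetric]
    by (intro sum.cong) (auto simp: add_mult_distrib[symmetric])
qed

section \<open>Counting fillings by weighted size\<close>

definition wcount :: "('a \<Rightarrow> nat) \<Rightarrow> 'a set \<Rightarrow> nat \<Rightarrow> nat" where
  "wcount h U n = card {A \<in> fillings U. (\<Sum>u\<in>U. h u * A u) = n}"

lemma finite_weighted_fillings:
  assumes "finite U" "\<And>u. u \<in> U \<Longrightarrow> 1 \<le> h u"
  shows "finite {A \<in> fillings U. (\<Sum>u\<in>U. h u * A u) = n}"
proof (rule finite_subset[OF _ finite_set_of_finite_funs[of U "{..n}" 0]])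
  have "A u \<le> n" if "(\<Sum>u\<in>U. h u * A u) = n" "u \<in> U" for A u
  proof -
    have "A u \<le> h u * A u" using assms(2)[OF that(2)] by simp
    also have "\<dots> \<le> n" using that assms(1) member_le_sum[of u U "\<lambda>u. h u * A u"] by simp
    finally show ?thesis .
  qed
  then show "{A \<in> fillings U. (\<Sum>u\<in>U. h u * A u) = n} \<subseteq> {f. \<forall>x. (x \<in> U \<longrightarrow> f x \<in> {..n}) \<and> (x \<notin> U \<longrightarrow> f x = 0)}"
    unfolding fillings_def by blast
qed (use assms in auto)

lemma wcount_shift:
  assumes U: "finite U" "u \<in> U" and m: "h u * m \<le> n"
  shows "card {A \<in> fillings U. (\<Sum>u\<in>U. h u * A u) = n \<and> m \<le> A u} = wcount h U (n - h u * m)"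
proof -
  have s: "(\<Sum>v\<in>U. h v * (A(u := a)) v) = h u * a + (\<Sum>v\<in>U - {u}. h v * A v)" for A a
    using U by (subst sum.remove[of U u]) (auto intro!: sum.cong)
  have s': "(\<Sum>v\<in>U. h v * A v) = h u * A u + (\<Sum>v\<in>U - {u}. h v * A v)" for A
    using U by (subst sum.remove[of U u]) auto
  have "bij_betw (\<lambda>A. A(u := A u - m)) {A \<in> fillings U. (\<Sum>u\<in>U. h u * A u) = n \<and> m \<le> A u}
     {A \<in> fillings U. (\<Sum>u\<in>U. h u * A u) = n - h u * m}"
  proof (rule bij_betw_byWitness[where f' = "\<lambda>A. A(u := A u + m)"])
    show "(\<lambda>A. A(u := A u - m)) ` {A \<in> fillings U. (\<Sum>u\<in>U. h u * A u) = n \<and> m \<le> A u}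
       \<subseteq> {A \<in> fillings U. (\<Sum>u\<in>U. h u * A u) = n - h u * m}"
    proof (intro image_subsetI CollectI conjI)
      fix A assume A: "A \<in> {A \<in> fillings U. (\<Sum>u\<in>U. h u * A u) = n \<and> m \<le> A u}"
      then show "A(u := A u - m) \<in> fillings U" by (auto simp: fillings_def)
      have "h u * m \<le> h u * A u" using A by simp
      then show "(\<Sum>v\<in>U. h v * (A(u := A u - m)) v) = n - h u * m"
        using A unfolding s by (simp add: s' diff_mult_distrib2)
    qed
    show "(\<lambda>A. A(u := A u + m)) ` {A \<in> fillings U. (\<Sum>u\<in>U. h u * A u) = n - h u * m}
      \<subseteq> {A \<in> fillings U. (\<Sum>u\<in>U. h u * A u) = n \<and> m \<le> A u}"
    proof (intro image_subsetI CollectI conjI)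
      fix A assume A: "A \<in> {A \<in> fillings U. (\<Sum>u\<in>U. h u * A u) = n - h u * m}"
      then show "A(u := A u + m) \<in> fillings U" using U by (auto simp: fillings_def)
      show "(\<Sum>v\<in>U. h v * (A(u := A u + m)) v) = n"
        using A m unfolding s by (auto simp: s' add_mult_distrib2)
    qed simp
  qed (auto simp: fun_eq_iff)
  then show ?thesis unfolding wcount_def by (rule bij_betw_same_card)
qed

lemma card_multiples_le:
  assumes "h * a \<le> n" "1 \<le> (h :: nat)"
  shows "card {k \<in> {1..n}. h dvd k \<and> k \<le> h * a} = a"
proof -
  have "{k \<in> {1..n}. h dvd k \<and> k \<le> h * a} = (*) h ` {1..a}"
    using assms by (auto elim!: dvdE intro: order.trans[OF mult_le_mono2])
  moreover have "inj_on ((*) h) {1..a}" using assms by (auto simp: inj_on_def)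
  ultimately show ?thesis by (simp add: card_image)
qed

text \<open>Logarithmic derivative of the product of 1 / (1 - x^(h u)), carried out by double
  counting. The sum of n over all fillings is the sum of h u * A u; the entry A u counts the
  multiples k = h u * m with 1 <= m <= A u, and removing m units at \<open>u\<close> leaves a
  filling of weight n - k.\<close>

lemma wcount_recurrence:
  assumes U: "finite U" "\<And>u. u \<in> U \<Longrightarrow> 1 \<le> h u"
  shows "n * wcount h U n = (\<Sum>k=1..n. (\<Sum>u\<in>{u \<in> U. h u dvd k}. h u) * wcount h U (n - k))"
proof -
  define F where "F = {A \<in> fillings U. (\<Sum>u\<in>U. h u * A u) = n}"
  have F: "finite F" unfolding F_def using U by (rule finite_weighted_fillings)
  have Au: "(\<Sum>A\<in>F. A u) = (\<Sum>k\<in>{k \<in> {1..n}. h u dvd k}. wcount h U (n - k))" if u: "u \<in> U" for u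
  proof -
    have "(\<Sum>A\<in>F. A u) = (\<Sum>A\<in>F. card {k \<in> {1..n}. h u dvd k \<and> k \<le> h u * A u})"
    proof (intro sum.cong refl)
      fix A assume "A \<in> F"
      then have "h u * A u \<le> n"
        using U u member_le_sum[of u U "\<lambda>u. h u * A u"] by (simp add: F_def)
      then show "A u = card {k \<in> {1..n}. h u dvd k \<and> k \<le> h u * A u}"
        using U u by (intro card_multiples_le[symmetric]) auto
    qed
    also have "\<dots> = (\<Sum>A\<in>F. \<Sum>k\<in>{k \<in> {1..n}. h u dvd k}. if k \<le> h u * A u then 1 else 0)"
      by (intro sum.cong refl) (simp add: sum.If_cases Int_def conj_assoc)
    also have "\<dots> = (\<Sum>k\<in>{k \<in> {1..n}. h u dvd k}. \<Sum>A\<in>F. if k \<le> h u * A u then 1 else 0)"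
      by (rule sum.swap)
    also have "\<dots> = (\<Sum>k\<in>{k \<in> {1..n}. h u dvd k}. wcount h U (n - k))"
    proof (intro sum.cong refl)
      fix k assume k: "k \<in> {k \<in> {1..n}. h u dvd k}"
      then obtain m where m: "k = h u * m" by (auto elim: dvdE)
      have "h u * m \<le> h u * a \<longleftrightarrow> m \<le> a" for a using U(2)[OF u] by auto
      then have "(\<Sum>A\<in>F. if k \<le> h u * A u then 1 else 0) = card {A \<in> fillings U. (\<Sum>u\<in>U. h u * A u) = n \<and> m \<le> A u}"
        using F by (simp add: sum.If_cases m F_def Int_def conj_assoc)
      also have "\<dots> = wcount h U (n - k)" using wcount_shift[OF U(1) u, of h m n] k m by simp
      finally show "(\<Sum>A\<in>F. if k \<le> h u * A u then 1 else 0) = wcount h U (n - k)" .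
    qed
    finally show ?thesis .
  qed
  have "n * wcount h U n = (\<Sum>A\<in>F. n)" by (simp add: wcount_def F_def)
  also have "\<dots> = (\<Sum>A\<in>F. \<Sum>u\<in>U. h u * A u)" by (intro sum.cong refl) (simp add: F_def)
  also have "\<dots> = (\<Sum>u\<in>U. \<Sum>A\<in>F. h u * A u)" by (rule sum.swap)
  also have "\<dots> = (\<Sum>u\<in>U. \<Sum>k\<in>{1..n}. if h u dvd k then h u * wcount h U (n - k) else 0)"
    by (intro sum.cong refl)
       (simp add: sum_distrib_left[symmetric] Au sum.inter_filter[symmetric])
  also have "\<dots> = (\<Sum>k\<in>{1..n}. \<Sum>u\<in>U. if h u dvd k then h u * wcount h U (n - k) else 0)"
    by (rule sum.swap)
  also have "\<dots> = (\<Sum>k=1..n. (\<Sum>u\<in>{u \<in> U. h u dvd k}. h u) * wcount h U (n - k))"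
    using U by (simp add: sum.inter_filter[symmetric] sum_distrib_right)
  finally show ?thesis .
qed

text \<open>Every number divides 0, so \<open>sigma2 0\<close> is a sum over an infinite set and
  takes the default value 0.\<close>

definition sigma2 :: "nat \<Rightarrow> nat" where
  "sigma2 k = (\<Sum>d | d dvd k. d ^ 2)"

abbreviation square :: "nat \<Rightarrow> (nat \<times> nat) set" where
  "square N \<equiv> {1..N} \<times> {1..N}"

text \<open>Arm N - x plus leg N - y plus the cell itself, for a square whose hooks run towards (N,
  N).\<close>

abbreviation hook :: "nat \<Rightarrow> nat \<times> nat \<Rightarrow> nat" where
  "hook N u \<equiv> 2 * N + 1 - fst u - snd u"

text \<open>The cells of hook length d form an antidiagonal near (N, N), which has its full length d
  as long as d <= N. This is the source of the exponent k in MacMahon's factor (1 -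
  x^k)^(-k).\<close>

lemma card_hook:
  assumes "1 \<le> d" "d \<le> N"
  shows "card {u \<in> square N. hook N u = d} = d"
proof -
  have "bij_betw (\<lambda>i. (N - i, N + 1 + i - d)) {..<d} {u \<in> square N. hook N u = d}"
  proof (rule bij_betw_byWitness[where f' = "\<lambda>u. N - fst u"])
    show "\<forall>u\<in>{u \<in> square N. hook N u = d}. (N - (N - fst u), N + 1 + (N - fst u) - d) = u"
    proof
      fix u assume u: "u \<in> {u \<in> square N. hook N u = d}"
      obtain x y where xy: "u = (x, y)" by force
      have "x \<le> N" "y \<le> N" "2 * N + 1 - x - y = d" using u by (auto simp: xy)
      then show "(N - (N - fst u), N + 1 + (N - fst u) - d) = u" by (simp add: xy)
    qed
    show "(\<lambda>i. (N - i, N + 1 + i - d)) ` {..<d} \<subseteq> {u \<in> square N. hook N u = d}"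
    proof (intro image_subsetI CollectI conjI)
      fix i assume "i \<in> {..<d}"
      then have i: "i < d" by simp
      have "1 \<le> N - i" using i assms by linarith
      moreover have "1 \<le> N + 1 + i - d" using i assms by linarith
      moreover have "N + 1 + i - d \<le> N" using i assms by linarith
      ultimately show "(N - i, N + 1 + i - d) \<in> square N" by simp
      show "hook N (N - i, N + 1 + i - d) = d" unfolding fst_conv snd_conv using i assms by linarith
    qed
    show "(\<lambda>u. N - fst u) ` {u \<in> square N. hook N u = d} \<subseteq> {..<d}"
    proof (intro image_subsetI)
      fix u assume u: "u \<in> {u \<in> square N. hook N u = d}"
      obtain x y where xy: "u = (x, y)" by force
      have "x \<le> N" "y \<le> N" "2 * N + 1 - x - y = d" using u by (auto simp: xy)
      then show "N - fst u \<in> {..<d}" by (simp add: xy)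
    qed
  qed (use assms in simp)
  from bij_betw_same_card[OF this] show ?thesis by (simp only: card_lessThan)
qed

text \<open>Grouped by hook length: each divisor d of k contributes d cells of weight d, hence
  d^2.\<close>

lemma sum_hooks_dvd:
  assumes "1 \<le> k" "k \<le> N"
  shows "(\<Sum>u\<in>{u \<in> square N. hook N u dvd k}. hook N u) = sigma2 k"
proof -
  have "(\<Sum>u\<in>{u \<in> square N. hook N u dvd k}. hook N u) =
    (\<Sum>d\<in>{d. d dvd k}. \<Sum>u\<in>{u \<in> {u \<in> square N. hook N u dvd k}. hook N u = d}. hook N u)"
    using assms by (intro sum.group[symmetric]) auto
  also have "\<dots> = (\<Sum>d\<in>{d. d dvd k}. \<Sum>u\<in>{u \<in> square N. hook N u = d}. d)"
    by (intro sum.cong refl) auto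
  also have "\<dots> = (\<Sum>d\<in>{d. d dvd k}. d ^ 2)"
  proof (intro sum.cong refl)
    fix d assume "d \<in> {d. d dvd k}"
    then have "1 \<le> d" "d \<le> N" using assms by (auto simp: Suc_le_eq intro: dvd_pos_nat dest: dvd_imp_le)
    then show "(\<Sum>u\<in>{u \<in> square N. hook N u = d}. d) = d ^ 2"
      by (simp only: sum_constant card_hook) (simp add: power2_eq_square)
  qed
  finally show ?thesis by (simp add: sigma2_def)
qed

section \<open>Plane partitions as reverse plane partitions of a square\<close>

lemma bij_betw_filter:
  "bij_betw f A B \<Longrightarrow> bij_betw f {x \<in> A. P (f x)} {y \<in> B. P y}"
  unfolding bij_betw_def by (auto intro: inj_on_subset)

text \<open>A nonzero entry at (i, j) forces j + 1 nonzero entries in its row and i + 1 in its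
  column.\<close>

lemma plane_partition_support:
  assumes "plane_partition \<pi> n" "\<pi> i j \<noteq> 0"
  shows "i < n \<and> j < n"
proof -
  let ?S = "{(i, j). \<pi> i j \<noteq> 0}"
  have fin: "finite ?S" and tot: "(\<Sum>(i, j)\<in>?S. \<pi> i j) = n"
    using assms by (auto simp: plane_partition_def)
  have crd: "card T \<le> n" if "T \<subseteq> ?S" for T
  proof -
    have "card T = (\<Sum>x\<in>T. 1)" by simp
    also have "\<dots> \<le> (\<Sum>(i, j)\<in>T. \<pi> i j)" using that by (intro sum_mono) auto
    also have "\<dots> \<le> n" using sum_mono2[OF fin that, of "\<lambda>(i, j). \<pi> i j"] tot by auto
    finally show ?thesis .
  qed
  have row: "\<pi> i j \<le> \<pi> i j'" if "j' \<le> j" for j'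
    using assms by (intro lift_Suc_antimono_le[OF _ that]) (auto simp: plane_partition_def)
  have col: "\<pi> i j \<le> \<pi> i' j" if "i' \<le> i" for i'
    using assms by (intro lift_Suc_antimono_le[of "\<lambda>i. \<pi> i j", OF _ that]) (auto simp: plane_partition_def)
  have "Pair i ` {..j} \<subseteq> ?S" using row assms by fastforce
  from crd[OF this] have "j < n" by (simp add: card_image inj_on_def)
  moreover have "(\<lambda>i. (i, j)) ` {..i} \<subseteq> ?S" using col assms by fastforce
  from crd[OF this] have "i < n" by (simp add: card_image inj_on_def)
  ultimately show ?thesis by simp
qed

text \<open>Rotation by a half turn. For i >= N the truncated difference N - i is 0, an index at
  which \<open>p\<close> vanishes, so the rotated array extends by zeros automatically.\<close>

lemma bij_reverse_plane_partitions:
  assumes "n \<le> N"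
  shows "bij_betw (\<lambda>p i j. p (N - i, N - j)) {p \<in> reverse_pps (square N). sum p (square N) = n}
     {\<pi>. plane_partition \<pi> n}"
proof (rule bij_betw_byWitness[where f' = "\<lambda>\<pi> (x, y). if (x, y) \<in> square N then \<pi> (N - x) (N - y) else 0"])
  let ?h = "\<lambda>(p :: nat \<times> nat \<Rightarrow> nat) i j. p (N - i, N - j)"
  let ?g = "\<lambda>\<pi> (x, y). if (x, y) \<in> square N then \<pi> (N - x) (N - y) else (0 :: nat)"
  have reindex: "(\<Sum>(i, j)\<in>{..<N} \<times> {..<N}. \<pi> i j) = (\<Sum>(x, y)\<in>square N. \<pi> (N - x) (N - y))" for \<pi> :: "nat \<Rightarrow> nat \<Rightarrow> nat"
    by (rule sum.reindex_bij_witness[of _ "\<lambda>(x, y). (N - x, N - y)" "\<lambda>(x, y). (N - x, N - y)"]) auto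
  show "\<forall>p\<in>{p \<in> reverse_pps (square N). sum p (square N) = n}. ?g (?h p) = p"
    by (auto simp: fun_eq_iff reverse_pps_def fillings_def)
  show "\<forall>\<pi>\<in>{\<pi>. plane_partition \<pi> n}. ?h (?g \<pi>) = \<pi>"
  proof
    fix \<pi> assume "\<pi> \<in> {\<pi>. plane_partition \<pi> n}"
    then have "i < N \<and> j < N" if "\<pi> i j \<noteq> 0" for i j using plane_partition_support[of \<pi> n i j] that assms by auto
    then show "?h (?g \<pi>) = \<pi>" by (fastforce simp: fun_eq_iff)
  qed
  show "?h ` {p \<in> reverse_pps (square N). sum p (square N) = n} \<subseteq> {\<pi>. plane_partition \<pi> n}"
  proof (intro image_subsetI CollectI)
    fix p assume "p \<in> {p \<in> reverse_pps (square N). sum p (square N) = n}"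
    then have z: "(x, y) \<notin> square N \<Longrightarrow> p (x, y) = 0"
      and r: "(x, Suc y) \<in> square N \<Longrightarrow> p (x, y) \<le> p (x, Suc y)"
      and d: "(Suc x, y) \<in> square N \<Longrightarrow> p (x, y) \<le> p (Suc x, y)" and s: "sum p (square N) = n" for x y
      by (auto simp: reverse_pps_def fillings_def)
    have sub: "{(i, j). ?h p i j \<noteq> 0} \<subseteq> {..<N} \<times> {..<N}"
    proof
      fix u assume "u \<in> {(i, j). ?h p i j \<noteq> 0}"
      then obtain i j where u: "u = (i, j)" and "p (N - i, N - j) \<noteq> 0" by auto
      then have "(N - i, N - j) \<in> square N" using z[of "N - i" "N - j"] by metis
      then show "u \<in> {..<N} \<times> {..<N}" by (auto simp: u)
    qed
    have "?h p i (Suc j) \<le> ?h p i j" for i j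
    proof (cases "i < N \<and> j < N")
      case True
      then have e: "Suc (N - Suc j) = N - j" and "(N - i, N - j) \<in> square N"
        by (simp_all add: Suc_le_eq Suc_diff_Suc)
      then show ?thesis using r[of "N - i" "N - Suc j"] unfolding e by blast
    next
      case False
      then show ?thesis using z[of "N - i" "N - Suc j"] by auto
    qed
    moreover have "?h p (Suc i) j \<le> ?h p i j" for i j
    proof (cases "i < N \<and> j < N")
      case True
      then have e: "Suc (N - Suc i) = N - i" and "(N - i, N - j) \<in> square N"
        by (simp_all add: Suc_le_eq Suc_diff_Suc)
      then show ?thesis using d[of "N - Suc i" "N - j"] unfolding e by blast
    next
      case False
      then show ?thesis using z[of "N - Suc i" "N - j"] by auto
    qed
    moreover have "finite {(i, j). ?h p i j \<noteq> 0}" using sub by (rule finite_subset) simp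
    moreover have "(\<Sum>(i, j)\<in>{(i, j). ?h p i j \<noteq> 0}. ?h p i j) = n"
    proof -
      have "(\<Sum>(i, j)\<in>{(i, j). ?h p i j \<noteq> 0}. ?h p i j) = (\<Sum>(i, j)\<in>{..<N} \<times> {..<N}. ?h p i j)"
        using sub by (intro sum.mono_neutral_left) auto
      also have "\<dots> = (\<Sum>(x, y)\<in>square N. p (x, y))" unfolding reindex by (intro sum.cong) auto
      finally show ?thesis using s by simp
    qed
    ultimately show "plane_partition (?h p) n" by (simp add: plane_partition_def)
  qed
  show "?g ` {\<pi>. plane_partition \<pi> n} \<subseteq> {p \<in> reverse_pps (square N). sum p (square N) = n}"
  proof (intro image_subsetI CollectI conjI)
    fix \<pi> assume "\<pi> \<in> {\<pi>. plane_partition \<pi> n}"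
    then have pp: "plane_partition \<pi> n" by simp
    have r: "\<pi> i (Suc j) \<le> \<pi> i j" and d: "\<pi> (Suc i) j \<le> \<pi> i j" for i j
      using pp by (auto simp: plane_partition_def)
    have "\<pi> (N - x) (N - y) \<le> \<pi> (N - x) (N - Suc y)" if "Suc y \<le> N" for x y
      using r[of "N - x" "N - Suc y"] that by (simp add: Suc_diff_Suc)
    moreover have "\<pi> (N - x) (N - y) \<le> \<pi> (N - Suc x) (N - y)" if "Suc x \<le> N" for x y
      using d[of "N - Suc x" "N - y"] that by (simp add: Suc_diff_Suc)
    ultimately show "?g \<pi> \<in> reverse_pps (square N)" by (auto simp: reverse_pps_def fillings_def)
    have "n = (\<Sum>(i, j)\<in>{(i, j). \<pi> i j \<noteq> 0}. \<pi> i j)" using pp by (simp add: plane_partition_def)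
    also have "\<dots> = (\<Sum>(i, j)\<in>{..<N} \<times> {..<N}. \<pi> i j)"
      using plane_partition_support[OF pp] assms by (intro sum.mono_neutral_left) fastforce+
    also have "\<dots> = sum (?g \<pi>) (square N)" unfolding reindex by (intro sum.cong) auto
    finally show "sum (?g \<pi>) (square N) = n" by simp
  qed
qed

text \<open>The side \<open>N\<close> may be any number from \<open>n\<close> on, so the recurrence
  below can evaluate all of \<open>PL (n - k)\<close> in one and the same square.\<close>

lemma PL_eq_wcount:
  assumes "n \<le> N"
  shows "PL n = wcount (hook N) (square N) n"
proof -
  have "finite (square N)" "shape (square N)" by (auto simp: shape_def)
  from fillings_reverse_pps_bij[OF this] obtain f where f: "bij_betw f (fillings (square N)) (reverse_pps (square N))"
    and fs: "\<forall>A\<in>fillings (square N). \<forall>x y. (x = 0 \<or> y = 0 \<or> (x, y) \<in> square N) \<and> (Suc x, Suc y) \<notin> square N \<longrightarrow>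
       diag_sum (f A) x y = rect_sum A x y"
    by (elim exE conjE)
  have w: "sum (f A) (square N) = (\<Sum>u\<in>square N. hook N u * A u)" if A: "A \<in> fillings (square N)" for A
  proof -
    have fs: "diag_sum (f A) x y = rect_sum A x y" if "(x, y) \<in> square N" "x = N \<or> y = N" for x y
      using bspec[OF fs A] that by auto
    have "(\<Sum>y=1..N. diag_sum (f A) N y) = (\<Sum>y=1..N. rect_sum A N y)"
      by (intro sum.cong refl fs) auto
    moreover have "(\<Sum>x=1..<N. diag_sum (f A) x N) = (\<Sum>x=1..<N. rect_sum A x N)"
      by (intro sum.cong refl fs) auto
    ultimately have "sum (f A) (square N) = (\<Sum>(x, y)\<in>square N. (2 * N + 1 - x - y) * A (x, y))"
      using sum_square_diag_sum[of "f A" N] sum_square_rect_sum[of A N] by simp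
    then show ?thesis by (simp only: case_prod_unfold prod.collapse)
  qed
  have "wcount (hook N) (square N) n = card {A \<in> fillings (square N). sum (f A) (square N) = n}"
    unfolding wcount_def by (rule arg_cong[where f = card]) (auto simp only: w)
  also have "\<dots> = card {p \<in> reverse_pps (square N). sum p (square N) = n}"
    by (rule bij_betw_same_card[OF bij_betw_filter[OF f]])
  also have "\<dots> = PL n"
    unfolding PL_def by (rule bij_betw_same_card[OF bij_reverse_plane_partitions[OF assms]])
  finally show ?thesis by simp
qed

theorem PL_recurrence: "n * PL n = (\<Sum>k=1..n. sigma2 k * PL (n - k))"
proof -
  have "n * PL n = (\<Sum>k=1..n. (\<Sum>u\<in>{u \<in> square n. hook n u dvd k}. hook n u) * wcount (hook n) (square n) (n - k))"
    unfolding PL_eq_wcount[OF order_refl] by (rule wcount_recurrence) auto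
  also have "\<dots> = (\<Sum>k=1..n. sigma2 k * PL (n - k))"
    by (intro sum.cong refl arg_cong2[where f = "(*)"] sum_hooks_dvd PL_eq_wcount[symmetric]) auto
  finally show ?thesis .
qed

lemma PL_0: "PL 0 = 1"
proof -
  have "PL 0 = wcount (hook 0) (square 0) 0" by (rule PL_eq_wcount) simp
  also have "\<dots> = card {\<lambda>_ :: nat \<times> nat. 0 :: nat}"
    unfolding wcount_def fillings_def by (rule arg_cong[where f = card]) auto
  finally show ?thesis by simp
qed

section \<open>Hermite polynomials\<close>

fun hermite :: "nat \<Rightarrow> real poly" where
  "hermite 0 = 1"
| "hermite (Suc 0) = [:0, 1:]"
| "hermite (Suc (Suc n)) = [:0, 1:] * hermite (Suc n) - smult (real (Suc n)) (hermite n)"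

lemma poly_hermite_rec:
  "poly (hermite (Suc (Suc n))) x = x * poly (hermite (Suc n)) x - real (Suc n) * poly (hermite n) x"
  by simp

lemma degree_hermite: "degree (hermite n) = n" and lead_coeff_hermite: "lead_coeff (hermite n) = 1"
proof -
  have "degree (hermite n) = n \<and> coeff (hermite n) n = 1"
  proof (induction n rule: hermite.induct)
    case (3 n)
    let ?p = "[:0, 1:] * hermite (Suc n)" and ?q = "smult (real (Suc n)) (hermite n)"
    have nz: "hermite (Suc n) \<noteq> 0" using 3 by auto
    have p: "degree ?p = Suc (Suc n)" "coeff ?p (Suc (Suc n)) = 1"
      using 3 nz by (simp_all add: degree_mult_eq)
    have q: "degree ?q < Suc (Suc n)" using 3 by simp
    have "degree (?p - ?q) = Suc (Suc n)"
      using degree_add_eq_left[of "- ?q" ?p] p q by simp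
    moreover have "coeff (?p - ?q) (Suc (Suc n)) = 1"
      using p(2) q coeff_eq_0[of ?q "Suc (Suc n)"] by simp
    ultimately show ?case by simp
  qed auto
  then show "degree (hermite n) = n" "lead_coeff (hermite n) = 1" by auto
qed

text \<open>The quantity on the left is the Wronskian of two consecutive Hermite polynomials; it is a
  positive combination of squares by the Christoffel--Darboux formula.\<close>


lemma hermite_wronskian_ge_1:
  "real (Suc n) * (poly (hermite n) x)\<^sup>2 - real n * poly (hermite (Suc n)) x * poly (hermite (n - 1)) x \<ge> 1"
proof (induction n)
  case (Suc n)
  show ?case
  proof (cases n)
    case 0
    then show ?thesis by (simp add: power2_eq_square algebra_simps)
  next
    case (Suc m)
    define a b c where "a = poly (hermite m) x" and "b = poly (hermite (Suc m)) x" and "c = poly (hermite (Suc (Suc m))) x"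
    define K where "K = real (m + 2) * b\<^sup>2 - real (m + 1) * c * a"
    have K: "1 \<le> K" using Suc.IH by (simp add: Suc a_def b_def c_def K_def)
    have c: "c = x * b - real (m + 1) * a" unfolding a_def b_def c_def by simp
    \<comment> \<open>Eliminating \<open>a\<close> by (m + 1) a = x b - c gives K = (m + 2) b^2 - x
      b c + c^2, and the next Wronskian becomes c^2 + (m + 2) K, which preserves the bound
      1.\<close>
    have "real (Suc (Suc (Suc m))) * c\<^sup>2 - real (Suc (Suc m)) * (x * c - real (m + 2) * b) * b = c\<^sup>2 + real (m + 2) * K"
      unfolding K_def by (simp add: c algebra_simps power2_eq_square)
    moreover have "c\<^sup>2 + real (m + 2) * K \<ge> 1"
      using K mult_mono[of 1 "real (m + 2)" 1 K] by (simp add: add_increasing)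
    ultimately show ?thesis using Suc by (simp add: a_def b_def c_def)
  qed
qed simp

text \<open>At a zero of the n-th polynomial the first term of the Wronskian vanishes, and the
  three-term recurrence turns the remaining product into the square of the next polynomial.\<close>

lemma hermite_at_root:
  assumes "poly (hermite n) x = 0" "n \<ge> 1"
  shows "\<bar>poly (hermite (Suc n)) x\<bar> \<ge> 1"
proof -
  obtain m where m: "n = Suc m" using assms by (cases n) auto
  define y where "y = poly (hermite (Suc n)) x"
  have e: "y = - real n * poly (hermite m) x"
    using assms by (simp add: m y_def algebra_simps)
  have "y\<^sup>2 = - real n * y * poly (hermite m) x"
    by (simp add: e power2_eq_square algebra_simps)
  also have "\<dots> \<ge> 1"
    using hermite_wronskian_ge_1[of n x] assms(1) by (simp add: m y_def del: hermite.simps of_nat_Suc)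
  finally have "y\<^sup>2 \<ge> 1" .
  then show ?thesis using abs_le_square_iff[of 1 y] by (simp add: y_def)
qed

text \<open>For x >= n the values increase with the degree: x b - (k + 1) a >= (x - k - 1) b >= b
  when 0 < a <= b and x >= k + 2. This confines the zeros to [-n, n] and fixes the interval on which
  the approximation has to be uniform.\<close>

lemma hermite_pos:
  assumes "x \<ge> real n" "x > 0"
  shows "poly (hermite n) x > 0"
proof -
  have "k \<le> n \<Longrightarrow> poly (hermite k) x > 0 \<and> (k < n \<longrightarrow> poly (hermite (Suc k)) x \<ge> poly (hermite k) x)" for k
  proof (induction k)
    case 0
    then show ?case using assms by auto
  next
    case (Suc k)
    let ?a = "poly (hermite k) x" and ?b = "poly (hermite (Suc k)) x"
    have ab: "0 < ?a" "?a \<le> ?b" using Suc by auto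
    have "?b \<le> x * ?b - real (Suc k) * ?a" if "Suc k < n"
    proof -
      have "?b + real (Suc k) * ?a \<le> ?b + real (Suc k) * ?b" using ab by simp
      also have "\<dots> = real (Suc (Suc k)) * ?b" by (simp add: algebra_simps)
      also have "\<dots> \<le> x * ?b" using that assms ab by (intro mult_right_mono) auto
      finally show ?thesis by simp
    qed
    then show ?case using ab by (simp only: poly_hermite_rec) auto
  qed
  then show ?thesis by blast
qed

lemma hermite_uminus: "poly (hermite n) (- x) = (- 1) ^ n * poly (hermite n) x"
  by (induction n rule: hermite.induct) (auto simp: algebra_simps)

lemma hermite_root_le:
  assumes "poly (hermite n) x = 0"
  shows "\<bar>x\<bar> \<le> real n"
proof (rule ccontr)
  assume "\<not> ?thesis"
  then have "poly (hermite n) \<bar>x\<bar> > 0" by (intro hermite_pos) auto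
  then show False using assms hermite_uminus[of n x] by (auto simp: abs_if split: if_splits)
qed

section \<open>Sign changes and real zeros\<close>

lemma sign_prod_linear:
  fixes x :: "nat \<Rightarrow> real"
  assumes "i \<le> m" "\<And>j. j < i \<Longrightarrow> x j < y" "\<And>j. i \<le> j \<Longrightarrow> j < m \<Longrightarrow> y < x j"
  shows "(- 1) ^ (m - i) * (\<Prod>j<m. y - x j) > 0"
  using assms
proof (induction "m - i" arbitrary: m)
  case 0
  then show ?case by (auto intro!: prod_pos)
next
  case (Suc k)
  then obtain m' where m: "m = Suc m'" by (cases m) auto
  have "(- 1) ^ (m' - i) * (\<Prod>j<m'. y - x j) > 0" using Suc by (intro Suc.hyps) (auto simp: m)
  moreover have "y - x m' < 0" using Suc by (auto simp: m)
  moreover have "m - i = Suc (m' - i)" using Suc by (auto simp: m)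
  ultimately show ?case by (simp add: m mult_less_0_iff zero_less_mult_iff)
qed

lemma poly_eq_prod_roots:
  fixes p :: "'a :: idom poly"
  assumes "degree p = m" "inj_on y {..<m}" "\<And>i. i < m \<Longrightarrow> poly p (y i) = 0"
  shows "p = smult (lead_coeff p) (\<Prod>i<m. [:- y i, 1:])"
  using assms
proof (induction m arbitrary: p)
  case 0
  then show ?case by (auto elim: degree_eq_zeroE)
next
  case (Suc m)
  then obtain q where q: "p = [:- y m, 1:] * q" using poly_eq_0_iff_dvd[of p "y m"] by (auto elim: dvdE)
  have "p \<noteq> 0" using Suc.prems by auto
  then have q0: "q \<noteq> 0" using q by auto
  have dq: "degree q = m" using Suc.prems(1) q q0 by (simp add: degree_mult_eq del: mult_pCons_left)
  have "poly q (y i) = 0" if "i < m" for i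
    using Suc.prems(3)[of i] inj_onD[OF Suc.prems(2), of i m] that by (auto simp: q)
  then have "q = smult (lead_coeff q) (\<Prod>i<m. [:- y i, 1:])"
    using Suc dq by (intro Suc.IH) (auto intro: inj_on_subset)
  moreover have "lead_coeff p = lead_coeff q" unfolding q lead_coeff_mult by simp
  ultimately show ?case unfolding q by (metis mult.commute mult_smult_right prod.lessThan_Suc)
qed

lemma poly_map_of_real: "poly (map_poly of_real p) (of_real x :: 'a :: {real_algebra_1, comm_semiring_0}) = of_real (poly p x)"
  by (induction p) (simp_all add: map_poly_pCons)

text \<open>Together with two points far outside, the m alternating points bound m + 1 intervals,
  each with a zero by the intermediate value theorem; these zeros exhaust the degree. The lemma
  serves both the Hermite polynomials and their perturbations.\<close>

lemma interlacing_roots: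
  fixes p :: "real poly"
  assumes deg: "degree p = Suc m" and lc: "lead_coeff p > 0"
    and mono: "\<And>i j. i < j \<Longrightarrow> j < m \<Longrightarrow> x i < x j"
    and sgn: "\<And>i. i < m \<Longrightarrow> (- 1) ^ (m - i) * poly p (x i) > 0"
  obtains y where "\<And>i j. i < j \<Longrightarrow> j < Suc m \<Longrightarrow> y i < y j"
    "p = smult (lead_coeff p) (\<Prod>i<Suc m. [:- y i, 1:])"
    "\<And>i j. i < j \<Longrightarrow> j < Suc m \<Longrightarrow> x i < y j" "\<And>i j. i \<le> j \<Longrightarrow> j < m \<Longrightarrow> y i < x j"
proof -
  obtain L1 where L1: "\<And>t. t \<ge> L1 \<Longrightarrow> poly p t > 0"
    using poly_pinfty_gt_lc[OF lc] lc by (metis less_le_trans)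
  \<comment> \<open>The reflection of \<open>p\<close>, with its sign corrected so that the leading
    coefficient is positive again; its positivity at large arguments gives the sign of
    \<open>p\<close> far to the left.\<close>
  define q where "q = smult ((- 1) ^ Suc m) (p \<circ>\<^sub>p [:0, -1:])"
  have "lead_coeff (p \<circ>\<^sub>p [:0, -1:]) = lead_coeff p * (- 1) ^ Suc m"
    using lead_coeff_comp[of "[:0, -1 :: real:]" p] deg by simp
  then have "lead_coeff q = lead_coeff p * ((- 1) ^ Suc m * (- 1) ^ Suc m)"
    unfolding q_def lead_coeff_smult by (simp only: mult_ac)
  then have lq: "lead_coeff q = lead_coeff p" by (simp add: power_mult_distrib[symmetric])
  obtain L2 where L2: "\<And>t. t \<ge> L2 \<Longrightarrow> poly q t > 0"
    using poly_pinfty_gt_lc[of q] lc lq by (metis less_le_trans)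
  define X where "X = (\<Sum>i<m. \<bar>x i\<bar>)"
  have X: "\<bar>x i\<bar> \<le> X" if "i < m" for i unfolding X_def using that by (intro member_le_sum) auto
  define L where "L = Max {L1, L2, X, 0} + 1"
  have L: "L \<ge> L1" "L \<ge> L2" "L > X" "L > 0"
    by (auto simp: L_def max_def)
  define z where "z = (\<lambda>i. if i = 0 then - L else if i \<le> m then x (i - 1) else L)"
  have z_less: "z i < z (Suc i)" if "i \<le> m" for i
  proof (cases i)
    case 0
    then show ?thesis using L X[of 0] by (auto simp: z_def)
  next
    case (Suc k)
    then show ?thesis using that L X[of k] mono[of k i] by (auto simp: z_def)
  qed
  have z_sgn: "(- 1) ^ (Suc m - i) * poly p (z i) > 0" if i: "i \<le> Suc m" for i
  proof -
    consider "i = 0" | "i = Suc m" | "0 < i" "i \<le> m" using i by linarith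
    then show ?thesis
    proof cases
      case 1
      then show ?thesis using L2[OF L(2)] by (simp add: z_def q_def poly_pcompose)
    next
      case 2
      then show ?thesis using L1[OF L(1)] by (simp add: z_def)
    next
      case 3
      then have "i - 1 < m" "Suc m - i = m - (i - 1)" by auto
      then show ?thesis using sgn[of "i - 1"] 3 by (simp add: z_def)
    qed
  qed
  have "\<exists>t. z i < t \<and> t < z (Suc i) \<and> poly p t = 0" if "i < Suc m" for i
  proof -
    have e: "Suc m - i = Suc (Suc m - Suc i)" using that by simp
    have "(- 1) ^ (Suc m - i) * poly p (z i) > 0" "(- 1) ^ (Suc m - Suc i) * poly p (z (Suc i)) > 0"
      using that by (intro z_sgn; simp)+
    then have "poly p (z i) * poly p (z (Suc i)) < 0"
      unfolding e by (cases "even (Suc m - Suc i)") (auto simp: mult_less_0_iff)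
    then show ?thesis using poly_IVT[OF z_less, of i p] that by auto
  qed
  then obtain y where y: "\<And>i. i < Suc m \<Longrightarrow> z i < y i \<and> y i < z (Suc i) \<and> poly p (y i) = 0"
    by metis
  have z_le: "z i \<le> z j" if "i \<le> j" "j \<le> Suc m" for i j
    using that by (induction j rule: dec_induct) (auto intro: order.trans less_imp_le[OF z_less])
  have mono_y: "y i < y j" if "i < j" "j < Suc m" for i j
    using y[of i] y[of j] z_le[of "Suc i" j] that by force
  have "inj_on y {..<Suc m}"
    by (rule inj_onI) (metis mono_y lessThan_iff linorder_neqE_nat less_irrefl)
  then have "p = smult (lead_coeff p) (\<Prod>i<Suc m. [:- y i, 1:])"
    using y deg by (intro poly_eq_prod_roots) auto
  moreover have "x i < y j" if "i < j" "j < Suc m" for i j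
    using y[of j] z_le[of "Suc i" j] that by (force simp: z_def split: if_splits)
  moreover have "y i < x j" if "i \<le> j" "j < m" for i j
    using y[of i] z_le[of "Suc i" "Suc j"] that by (force simp: z_def split: if_splits)
  ultimately show thesis using that mono_y by blast
qed

text \<open>At a zero of one Hermite polynomial the next one is a negative multiple of the previous
  one, whose sign there follows from interlacing.\<close>

lemma hermite_roots:
  "\<exists>x. (\<forall>i j. i < j \<and> j < n \<longrightarrow> x i < x j) \<and> hermite n = (\<Prod>i<n. [:- x i, 1:]) \<and>
     (\<forall>i<n. (- 1) ^ (n - i) * poly (hermite (Suc n)) (x i) > 0)"
proof (induction n)
  case (Suc n)
  then obtain x where x: "\<And>i j. i < j \<Longrightarrow> j < n \<Longrightarrow> x i < x j" "hermite n = (\<Prod>i<n. [:- x i, 1:])"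
    "\<And>i. i < n \<Longrightarrow> (- 1) ^ (n - i) * poly (hermite (Suc n)) (x i) > 0" by blast
  obtain y where y: "\<And>i j. i < j \<Longrightarrow> j < Suc n \<Longrightarrow> y i < y j"
    "hermite (Suc n) = smult (lead_coeff (hermite (Suc n))) (\<Prod>i<Suc n. [:- y i, 1:])"
    "\<And>i j. i < j \<Longrightarrow> j < Suc n \<Longrightarrow> x i < y j" "\<And>i j. i \<le> j \<Longrightarrow> j < n \<Longrightarrow> y i < x j"
    using interlacing_roots[of "hermite (Suc n)" n x] x degree_hermite[of "Suc n"] lead_coeff_hermite[of "Suc n"]
    by (metis zero_less_one)
  then have h: "hermite (Suc n) = (\<Prod>i<Suc n. [:- y i, 1:])" by (simp add: lead_coeff_hermite)
  have "(- 1) ^ (Suc n - i) * poly (hermite (Suc (Suc n))) (y i) > 0" if i: "i < Suc n" for i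
  proof -
    have "poly (hermite (Suc n)) (y i) = 0" unfolding h poly_prod using i by (intro prod_zero) auto
    then have "(- 1) ^ (Suc n - i) * poly (hermite (Suc (Suc n))) (y i) =
      real (Suc n) * ((- 1) ^ (n - i) * poly (hermite n) (y i))"
      using i by (simp add: Suc_diff_le del: of_nat_Suc)
    moreover have "(- 1) ^ (n - i) * (\<Prod>j<n. y i - x j) > 0"
      using i y(3,4) by (intro sign_prod_linear) auto
    then have "(- 1) ^ (n - i) * poly (hermite n) (y i) > 0" by (simp add: x(2) poly_prod)
    ultimately show ?thesis by simp
  qed
  then show ?case using y(1) h by blast
qed auto

theorem near_hermite_real_rooted:
  fixes p :: "real poly"
  assumes deg: "degree p = d" "1 \<le> d" and lc: "lead_coeff p > 0"
    and near: "\<And>x. \<bar>x\<bar> \<le> real d \<Longrightarrow> \<bar>poly p x - poly (hermite d) x\<bar> < 1"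
    and root: "poly (map_poly complex_of_real p) z = 0"
  shows "z \<in> \<real>"
proof -
  obtain n where d: "d = Suc n" using deg by (cases d) auto
  obtain x where x: "\<And>i j. i < j \<Longrightarrow> j < n \<Longrightarrow> x i < x j" "hermite n = (\<Prod>i<n. [:- x i, 1:])"
    "\<And>i. i < n \<Longrightarrow> (- 1) ^ (n - i) * poly (hermite (Suc n)) (x i) > 0" using hermite_roots[of n] by blast
  have sgn: "(- 1) ^ (n - i) * poly p (x i) > 0" if i: "i < n" for i
  proof -
    have r: "poly (hermite n) (x i) = 0" unfolding x(2) poly_prod using i by (intro prod_zero) auto
    have "\<bar>poly (hermite d) (x i)\<bar> \<ge> 1" unfolding d using r i by (intro hermite_at_root) auto
    moreover have "\<bar>poly p (x i) - poly (hermite d) (x i)\<bar> < 1"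
      using hermite_root_le[OF r] by (intro near) (simp add: d)
    ultimately show ?thesis using x(3)[OF i] unfolding d
      by (cases "even (n - i)") auto
  qed
  obtain y where y: "\<And>i j. i < j \<Longrightarrow> j < Suc n \<Longrightarrow> y i < y j"
    and py: "p = smult (lead_coeff p) (\<Prod>i<Suc n. [:- y i, 1:])"
    using interlacing_roots[of p n x] deg lc x(1) sgn unfolding d by metis
  have r: "poly p (y i) = 0" if "i < d" for i
  proof -
    have "(\<Prod>k<Suc n. poly [:- y k, 1:] (y i)) = 0"
      using that by (intro prod_zero) (auto simp: d)
    then show ?thesis by (subst py) (simp only: poly_smult poly_prod mult_zero_right)
  qed
  have inj: "inj_on y {..<d}"
    by (rule inj_onI) (metis y d lessThan_iff linorder_neqE_nat less_irrefl)
  \<comment> \<open>The d real zeros split the complexified polynomial into linear factors, which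
    leaves room for no other complex zero.\<close>
  let ?P = "map_poly complex_of_real p"
  define c where "c = lead_coeff ?P"
  have dP: "degree ?P = d" using deg by (subst degree_map_poly) auto
  then have h: "?P = smult c (\<Prod>i<d. [:- complex_of_real (y i), 1:])"
    unfolding c_def using r inj by (intro poly_eq_prod_roots) (auto simp: poly_map_of_real inj_on_def)
  have "c \<noteq> 0" using dP deg by (auto simp: c_def)
  moreover have "c * (\<Prod>i<d. poly [:- complex_of_real (y i), 1:] z) = 0"
    using root by (subst (asm) h) (simp only: poly_smult poly_prod)
  ultimately have "(\<Prod>i<d. poly [:- complex_of_real (y i), 1:] z) = 0" by simp
  then obtain i where "poly [:- complex_of_real (y i), 1:] z = 0" by auto
  then have "z = complex_of_real (y i)" by simp
  then show ?thesis by auto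
qed

section \<open>Hermite polynomials as Gaussian integrals\<close>

definition normal_mom :: "nat \<Rightarrow> real" where
  "normal_mom k = (LINT t|lborel. std_normal_density t * t ^ k)"

lemma normal_mom_simps:
  "normal_mom 0 = 1" "normal_mom 1 = 0" "normal_mom (k + 2) = real (k + 1) * normal_mom k"
proof -
  show "normal_mom 0 = 1" using integral_std_normal_moment_even[of 0] by (simp add: normal_mom_def)
  show "normal_mom 1 = 0" using integral_std_normal_moment_odd[of 0] by (simp add: normal_mom_def)
  show "normal_mom (k + 2) = real (k + 1) * normal_mom k"
  proof (cases "even k")
    case True
    then obtain l where k: "k = 2 * l" by (elim evenE)
    have "normal_mom (k + 2) = fact (2 * Suc l) / (2 ^ Suc l * fact (Suc l))"
      using integral_std_normal_moment_even[of "Suc l"] by (simp add: normal_mom_def k)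
    moreover have "normal_mom k = fact (2 * l) / (2 ^ l * fact l)"
      using integral_std_normal_moment_even[of l] by (simp add: normal_mom_def k)
    moreover have "fact (2 * Suc l) = 2 * real (Suc l) * (real (k + 1) * fact (2 * l))"
      by (simp add: k algebra_simps)
    moreover have "2 ^ Suc l * fact (Suc l) = 2 * real (Suc l) * (2 ^ l * fact l)" by simp
    ultimately show ?thesis by (simp del: of_nat_Suc fact_Suc power_Suc of_nat_add)
  next
    case False
    then obtain l where k: "k = 2 * l + 1" by (elim oddE)
    have "normal_mom (k + 2) = 0"
      using integral_std_normal_moment_odd[of "Suc l"] by (simp add: normal_mom_def k)
    moreover have "normal_mom k = 0"
      using integral_std_normal_moment_odd[of l] by (simp add: normal_mom_def k)
    ultimately show ?thesis by simp
  qed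
qed

lemma has_integral_normal_shift:
  fixes w :: complex
  shows "has_bochner_integral lborel (\<lambda>t. of_real (std_normal_density t) * of_real t ^ m * (w - \<i> * of_real t) ^ n)
    (\<Sum>j\<le>n. of_nat (n choose j) * (- \<i>) ^ j * of_real (normal_mom (m + j)) * w ^ (n - j))"
proof -
  have "has_bochner_integral lborel (\<lambda>t. \<Sum>j\<le>n. of_nat (n choose j) * (- \<i>) ^ j * w ^ (n - j) * of_real (std_normal_density t * t ^ (m + j)))
     (\<Sum>j\<le>n. of_nat (n choose j) * (- \<i>) ^ j * w ^ (n - j) * of_real (normal_mom (m + j)))"
    unfolding normal_mom_def
    by (intro has_bochner_integral_sum has_bochner_integral_mult_right has_bochner_integral_of_real
        has_bochner_integral_integrable integrable_std_normal_moment)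
  moreover have "(\<Sum>j\<le>n. of_nat (n choose j) * (- \<i>) ^ j * w ^ (n - j) * of_real (std_normal_density t * t ^ (m + j)))
     = of_real (std_normal_density t) * of_real t ^ m * (w - \<i> * of_real t) ^ n" for t
  proof -
    have "(w - \<i> * of_real t) ^ n = (\<Sum>j\<le>n. of_nat (n choose j) * (- \<i> * of_real t) ^ j * w ^ (n - j))"
      using binomial_ring[of "- \<i> * of_real t" w n] by (simp add: add.commute)
    then show ?thesis
      by (simp add: sum_distrib_left power_mult_distrib power_add mult_ac power_minus[of "\<i> * _"] power_minus[of \<i>])
  qed
  ultimately show ?thesis by (simp add: mult_ac)
qed

text \<open>With E m n the expectation of Z^m (w - i Z)^n, splitting off one factor gives E 0 (n+1)
  = w E 0 n - i E 1 n, and the moment recursion (Gaussian integration by parts) gives E 1 (n+1) = -i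
  (n+1) E 0 n. Together these are the Hermite recurrence.\<close>

lemma hermite_normal_sum:
  "(\<Sum>j\<le>n. of_nat (n choose j) * (- \<i>) ^ j * of_real (normal_mom j) * complex_of_real w ^ (n - j)) = of_real (poly (hermite n) w)"
proof -
  define E where "E = (\<lambda>m n. \<Sum>j\<le>n. of_nat (n choose j) * (- \<i>) ^ j * of_real (normal_mom (m + j)) * complex_of_real w ^ (n - j))"
  have E: "has_bochner_integral lborel (\<lambda>t. of_real (std_normal_density t) * of_real t ^ m * (of_real w - \<i> * of_real t) ^ n) (E m n)" for m n
    unfolding E_def by (rule has_integral_normal_shift)
  have rec: "E 0 (Suc n) = of_real w * E 0 n - \<i> * E 1 n" for n
  proof (rule has_bochner_integral_eq[OF E[of 0 "Suc n"]])
    have "has_bochner_integral lborel (\<lambda>t. of_real w * (of_real (std_normal_density t) * of_real t ^ 0 * (of_real w - \<i> * of_real t) ^ n)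
        - \<i> * (of_real (std_normal_density t) * of_real t ^ 1 * (of_real w - \<i> * of_real t) ^ n)) (of_real w * E 0 n - \<i> * E 1 n)"
      by (intro has_bochner_integral_diff has_bochner_integral_mult_right E)
    then show "has_bochner_integral lborel (\<lambda>t. of_real (std_normal_density t) * of_real t ^ 0 * (of_real w - \<i> * of_real t) ^ Suc n) (of_real w * E 0 n - \<i> * E 1 n)"
      by (simp add: algebra_simps)
  qed
  have E1: "E 1 (Suc n) = - \<i> * of_nat (Suc n) * E 0 n" for n
  proof -
    have "E 1 (Suc n) = (\<Sum>j\<le>n. of_nat (Suc n choose Suc j) * (- \<i>) ^ Suc j * of_real (normal_mom (j + 2)) * complex_of_real w ^ (n - j))"
      unfolding E_def by (subst sum.atMost_Suc_shift) (simp add: normal_mom_simps(2)[unfolded One_nat_def])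
    also have "\<dots> = (\<Sum>j\<le>n. - \<i> * of_nat (Suc n) * (of_nat (n choose j) * (- \<i>) ^ j * of_real (normal_mom (0 + j)) * complex_of_real w ^ (n - j)))"
    proof (intro sum.cong refl)
      fix j
      have "of_nat (Suc n choose Suc j) * complex_of_real (normal_mom (j + 2)) = of_nat ((Suc n choose Suc j) * Suc j) * of_real (normal_mom j)"
        by (simp add: normal_mom_simps(3)[simplified] algebra_simps del: binomial_Suc_Suc)
      also have "\<dots> = of_nat (Suc n) * of_nat (n choose j) * of_real (normal_mom j)"
        by (subst Suc_times_binomial_eq[symmetric]) (simp add: algebra_simps)
      finally have "of_nat (Suc n choose Suc j) * complex_of_real (normal_mom (j + 2)) = of_nat (Suc n) * of_nat (n choose j) * of_real (normal_mom j)" .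
      then show "of_nat (Suc n choose Suc j) * (- \<i>) ^ Suc j * of_real (normal_mom (j + 2)) * complex_of_real w ^ (n - j) =
        - \<i> * of_nat (Suc n) * (of_nat (n choose j) * (- \<i>) ^ j * of_real (normal_mom (0 + j)) * complex_of_real w ^ (n - j))"
        by (simp only: power_Suc add_0) (simp only: mult_ac)
    qed
    also have "\<dots> = - \<i> * of_nat (Suc n) * E 0 n" by (simp only: E_def sum_distrib_left)
    finally show ?thesis .
  qed
  have "E 0 n = of_real (poly (hermite n) w)"
  proof (induction n rule: hermite.induct)
    case (3 n)
    have "\<i> * E 1 (Suc n) = of_nat (Suc n) * E 0 n" unfolding E1 by (simp add: mult.assoc[symmetric] del: of_nat_Suc)
    then show ?case using 3 by (subst rec) (simp del: of_nat_Suc)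
  qed (simp_all add: E_def normal_mom_simps(1) normal_mom_simps(2)[unfolded One_nat_def])
  then show ?thesis by (simp add: E_def)
qed

lemma hermite_integral:
  fixes \<sigma> w :: real
  assumes "\<sigma> > 0"
  shows "has_bochner_integral lborel (\<lambda>t. of_real (exp (- \<sigma>\<^sup>2 * t\<^sup>2 / 2)) * (of_real w - \<i> * of_real (\<sigma> * t)) ^ n)
    (of_real (sqrt (2 * pi) / \<sigma>) * complex_of_real (poly (hermite n) w))"
proof -
  have "has_bochner_integral lborel (\<lambda>t. of_real (std_normal_density t) * (of_real w - \<i> * of_real t) ^ n) (complex_of_real (poly (hermite n) w))"
    using has_integral_normal_shift[of 0 "of_real w" n] by (simp add: hermite_normal_sum)
  then have "has_bochner_integral lborel (\<lambda>t. of_real (std_normal_density (0 + \<sigma> * t)) * (of_real w - \<i> * of_real (0 + \<sigma> * t)) ^ n)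
     (complex_of_real (poly (hermite n) w) /\<^sub>R \<bar>\<sigma>\<bar>)"
    using lborel_has_bochner_integral_real_affine_iff[of \<sigma> "\<lambda>t. of_real (std_normal_density t) * (of_real w - \<i> * of_real t) ^ n" _ 0] assms by auto
  then have "has_bochner_integral lborel (\<lambda>t. of_real (sqrt (2 * pi)) * (of_real (std_normal_density (0 + \<sigma> * t)) * (of_real w - \<i> * of_real (0 + \<sigma> * t)) ^ n))
     (of_real (sqrt (2 * pi)) * (complex_of_real (poly (hermite n) w) /\<^sub>R \<bar>\<sigma>\<bar>))"
    by (intro has_bochner_integral_mult_right) auto
  then show ?thesis using assms
    by (simp add: std_normal_density_def power_mult_distrib scaleR_conv_of_real field_simps)
qed

lemma gaussian_integral:
  fixes c :: real
  assumes "c > 0"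
  shows "has_bochner_integral lborel (\<lambda>x. exp (- c * x\<^sup>2)) (sqrt (pi / c))"
proof -
  define s where "s = sqrt (1 / (2 * c))"
  have s: "s > 0" "s\<^sup>2 = 1 / (2 * c)" using assms by (auto simp: s_def)
  have "has_bochner_integral lborel (\<lambda>x. normal_density 0 s x) 1"
    using integral_normal_density[OF s(1), of 0] integrable_normal_density[OF s(1), of 0] by (simp add: has_bochner_integral_iff)
  then have "has_bochner_integral lborel (\<lambda>x. sqrt (pi / c) * normal_density 0 s x) (sqrt (pi / c) * 1)"
    by (intro has_bochner_integral_mult_right) auto
  moreover have "sqrt (pi / c) * normal_density 0 s x = exp (- c * x\<^sup>2)" for x
    using assms by (simp add: normal_density_def s(2))
  ultimately show ?thesis by simp
qed

section \<open>The generating function\<close>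

lemma sum_inverse_squares_le: "(\<Sum>k=1..n. 1 / (real k)\<^sup>2) \<le> 2"
proof -
  have "(\<Sum>k=1..Suc n. 1 / (real k)\<^sup>2) \<le> 2 - 1 / real (Suc n)" for n
  proof (induction n)
    case (Suc n)
    have "1 / (real (Suc (Suc n)))\<^sup>2 \<le> 1 / (real (Suc n) * real (Suc (Suc n)))"
      by (intro divide_left_mono) (auto simp: power2_eq_square)
    also have "\<dots> = 1 / real (Suc n) - 1 / real (Suc (Suc n))" by (simp add: field_simps)
    finally show ?case using Suc by simp
  qed simp
  from this[of "n - 1"] show ?thesis by (cases n) (auto intro: order.trans)
qed

lemma sigma2_ge: "n ^ 2 \<le> sigma2 n"
proof (cases "n = 0")
  case False
  then show ?thesis unfolding sigma2_def by (intro member_le_sum) auto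
qed simp

text \<open>Passing to the complementary divisor turns the sum into n^2 times a sum of 1 / d^2 over
  the divisors d.\<close>

lemma sigma2_le: "sigma2 n \<le> 2 * n ^ 2"
proof (cases "n = 0")
  case True
  then show ?thesis by (simp add: sigma2_def)
next
  case False
  have "real (sigma2 n) = (\<Sum>d | d dvd n. (real d)\<^sup>2)" by (simp add: sigma2_def)
  also have "\<dots> = (\<Sum>d | d dvd n. (real n)\<^sup>2 * (1 / (real d)\<^sup>2))"
  proof (rule sum.reindex_bij_witness[of _ "\<lambda>d. n div d" "\<lambda>d. n div d"])
    fix d assume "d \<in> {d. d dvd n}"
    then obtain k where "n = d * k" by auto
    then show "n div (n div d) = d" "n div (n div d) = d" "n div d \<in> {d. d dvd n}" "n div d \<in> {d. d dvd n}"
      "(real n)\<^sup>2 * (1 / (real (n div d))\<^sup>2) = (real d)\<^sup>2"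
      using False by (auto simp: power_mult_distrib)
  qed
  also have "\<dots> \<le> (\<Sum>d=1..n. (real n)\<^sup>2 * (1 / (real d)\<^sup>2))"
    using False by (intro sum_mono2) (auto dest: dvd_imp_le intro!: Nat.gr0I simp: Suc_le_eq)
  also have "\<dots> \<le> (real n)\<^sup>2 * 2"
    unfolding sum_distrib_left[symmetric] by (intro mult_left_mono sum_inverse_squares_le) auto
  finally have "real (sigma2 n) \<le> real (2 * n ^ 2)" by simp
  then show ?thesis by (simp only: of_nat_le_iff)
qed

text \<open>Coefficients of the logarithm of the generating function: \<open>PL_recurrence\<close>
  says x G' = (x L') G for the series L with these coefficients. Division by zero makes the constant
  term 0.\<close>

definition lcoeff :: "nat \<Rightarrow> real" where
  "lcoeff n = real (sigma2 n) / real n"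

lemma lcoeff_0 [simp]: "lcoeff 0 = 0"
  by (simp add: lcoeff_def)

lemma lcoeff_ge: "real n \<le> lcoeff n"
proof (cases "n = 0")
  case False
  have "real (n ^ 2) \<le> real (sigma2 n)" using sigma2_ge of_nat_le_iff by blast
  then show ?thesis using False by (simp add: lcoeff_def field_simps power2_eq_square)
qed simp

lemma lcoeff_le: "lcoeff n \<le> 2 * real n"
proof (cases "n = 0")
  case False
  have "real (sigma2 n) \<le> real (2 * n ^ 2)" using sigma2_le of_nat_le_iff by blast
  then show ?thesis using False by (simp add: lcoeff_def field_simps power2_eq_square)
qed simp

lemma lcoeff_nonneg: "0 \<le> lcoeff n"
  by (simp add: lcoeff_def)

lemma of_nat_lcoeff: "real n * lcoeff n = real (sigma2 n)"
  by (cases "n = 0") (simp_all add: lcoeff_def sigma2_def)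

lemma binomial_power_sums:
  fixes q :: real
  assumes "0 \<le> q" "q < 1"
  shows "(\<lambda>n. real ((n + p) choose p) * q ^ n) sums (1 / (1 - q) ^ Suc p)"
proof (induction p)
  case 0
  then show ?case using geometric_sums[of q] assms by simp
next
  case (Suc p)
  have g: "(\<lambda>n. q ^ n) sums (1 / (1 - q))" using geometric_sums[of q] assms by simp
  have "(\<lambda>k. \<Sum>i\<le>k. real ((i + p) choose p) * q ^ i * q ^ (k - i)) sums
     ((\<Sum>k. real ((k + p) choose p) * q ^ k) * (\<Sum>k. q ^ k))"
    using Suc g assms by (intro Cauchy_product_sums) (auto simp: abs_mult sums_iff)
  moreover have "(\<Sum>i\<le>k. real ((i + p) choose p) * q ^ i * q ^ (k - i)) = real ((k + Suc p) choose (Suc p)) * q ^ k" for k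
  proof -
    have "(\<Sum>i\<le>k. real ((i + p) choose p) * q ^ i * q ^ (k - i)) = (\<Sum>i\<le>k. real ((p + i) choose p) * q ^ k)"
      by (intro sum.cong refl) (simp add: power_add[symmetric] add.commute)
    also have "\<dots> = real (\<Sum>i\<le>k. (p + i) choose p) * q ^ k" by (simp add: sum_distrib_right)
    also have "(\<Sum>i\<le>k. (p + i) choose p) = (k + Suc p) choose (Suc p)"
      using choose_rising_sum(1)[of p k] by (simp add: add.commute)
    finally show ?thesis .
  qed
  ultimately show ?case using Suc g by (simp add: sums_iff)
qed

text \<open>From n^p <= p! * ((n + p) choose p), whose generating function is an exact power of 1 /
  (1 - q).\<close>

lemma power_times_geometric_summable:
  fixes q :: real
  assumes "0 \<le> q" "q < 1"
  shows "summable (\<lambda>n. real n ^ p * q ^ n)"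
    and "(\<Sum>n. real n ^ p * q ^ n) \<le> fact p / (1 - q) ^ Suc p"
proof -
  have "n ^ p \<le> fact p * ((n + p) choose p)" for n
  proof (induction p)
    case (Suc p)
    have "n ^ Suc p \<le> Suc (n + p) * (fact p * ((n + p) choose p))"
      using Suc by (simp del: mult_Suc) (intro mult_mono; simp)
    also have "\<dots> = fact p * (Suc (n + p) * ((n + p) choose p))" by (simp only: mult_ac)
    also have "\<dots> = fact (Suc p) * ((n + Suc p) choose Suc p)"
      unfolding Suc_times_binomial_eq by (simp add: algebra_simps)
    finally show ?case .
  qed simp
  then have le: "real n ^ p \<le> fact p * real ((n + p) choose p)" for n
    by (metis of_nat_le_iff of_nat_mult of_nat_fact of_nat_power)
  have s: "(\<lambda>n. fact p * (real ((n + p) choose p) * q ^ n)) sums (fact p * (1 / (1 - q) ^ Suc p))"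
    using assms by (intro sums_mult binomial_power_sums)
  have le': "real n ^ p * q ^ n \<le> fact p * (real ((n + p) choose p) * q ^ n)" for n
    using mult_right_mono[OF le[of n], of "q ^ n"] assms by (simp add: mult_ac)
  show sm: "summable (\<lambda>n. real n ^ p * q ^ n)"
    by (rule summable_comparison_test[OF _ sums_summable[OF s]]) (use le' assms in auto)
  show "(\<Sum>n. real n ^ p * q ^ n) \<le> fact p / (1 - q) ^ Suc p"
    using suminf_le[OF le' sm sums_summable[OF s]] sums_unique[OF s] by simp
qed

text \<open>The three cases p = 0, 1, 2 give the size of n, of the variance and of the cubic Taylor
  remainder, namely eps^-3, eps^-4 and eps^-5.\<close>

lemma sigma2_sum:
  fixes q :: real
  assumes "0 \<le> q" "q < 1"
  shows summable_sigma2: "summable (\<lambda>n. real n ^ p * real (sigma2 n) * q ^ n)"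
    and suminf_sigma2_le: "(\<Sum>n. real n ^ p * real (sigma2 n) * q ^ n) \<le> 2 * fact (p + 2) / (1 - q) ^ (p + 3)"
    and suminf_sigma2_ge: "(\<Sum>n. real n ^ (p + 2) * q ^ n) \<le> (\<Sum>n. real n ^ p * real (sigma2 n) * q ^ n)"
proof -
  have b: "(real n)\<^sup>2 \<le> real (sigma2 n)" "real (sigma2 n) \<le> 2 * (real n)\<^sup>2" for n
    using sigma2_ge[of n] sigma2_le[of n] of_nat_le_iff[of "n ^ 2" "sigma2 n", where 'a = real]
      of_nat_le_iff[of "sigma2 n" "2 * n ^ 2", where 'a = real] by auto
  have le: "real n ^ p * real (sigma2 n) * q ^ n \<le> 2 * (real n ^ (p + 2) * q ^ n)" for n
    using mult_left_mono[OF b(2)[of n], of "real n ^ p * q ^ n"] assms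
    by (simp add: power_add mult_ac power2_eq_square)
  have ge: "real n ^ (p + 2) * q ^ n \<le> real n ^ p * real (sigma2 n) * q ^ n" for n
    using mult_left_mono[OF b(1)[of n], of "real n ^ p * q ^ n"] assms
    by (simp add: power_add mult_ac power2_eq_square)
  note s = power_times_geometric_summable[OF assms, of "p + 2"]
  have s2: "summable (\<lambda>n. 2 * (real n ^ (p + 2) * q ^ n))" by (rule summable_mult[OF s(1)])
  show sm: "summable (\<lambda>n. real n ^ p * real (sigma2 n) * q ^ n)"
    by (rule summable_comparison_test[OF _ s2]) (use le assms in auto)
  have "(\<Sum>n. real n ^ p * real (sigma2 n) * q ^ n) \<le> 2 * (\<Sum>n. real n ^ (p + 2) * q ^ n)"
    using suminf_le[OF le sm s2] suminf_mult[OF s(1)] by simp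
  also have "\<dots> \<le> 2 * (fact (p + 2) / (1 - q) ^ Suc (p + 2))" using s(2) by simp
  finally show "(\<Sum>n. real n ^ p * real (sigma2 n) * q ^ n) \<le> 2 * fact (p + 2) / (1 - q) ^ (p + 3)"
    by (simp add: numeral_3_eq_3)
  show "(\<Sum>n. real n ^ (p + 2) * q ^ n) \<le> (\<Sum>n. real n ^ p * real (sigma2 n) * q ^ n)"
    by (rule suminf_le[OF ge s(1) sm])
qed

lemma summable_lcoeff:
  fixes z :: complex
  assumes "norm z < 1"
  shows "summable (\<lambda>n. norm (of_real (lcoeff n) * z ^ n))"
proof -
  have "summable (\<lambda>n. 2 * (real n ^ 1 * norm z ^ n))"
    using assms by (intro summable_mult power_times_geometric_summable) auto
  moreover have "norm (norm (of_real (lcoeff n) * z ^ n)) \<le> 2 * (real n ^ 1 * norm z ^ n)" for n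
    using mult_right_mono[OF lcoeff_le[of n], of "norm z ^ n"] lcoeff_nonneg[of n]
    by (simp add: norm_mult norm_power)
  ultimately show ?thesis by (rule summable_comparison_test'[where N = 0])
qed

section \<open>The exponential of the logarithmic series\<close>

definition lfps :: "complex fps" where
  "lfps = Abs_fps (\<lambda>n. of_real (lcoeff n))"

lemma fps_conv_radius_lfps: "fps_conv_radius lfps \<ge> 1"
  unfolding fps_conv_radius_def
proof (rule conv_radius_geI_ex)
  fix r :: real assume "0 < r" "ereal r < 1"
  then show "\<exists>z. norm z = r \<and> summable (\<lambda>n. fps_nth lfps n * z ^ n)"
    using summable_norm_cancel[OF summable_lcoeff[of "of_real r"]]
    by (intro exI[of _ "of_real r"]) (auto simp: lfps_def)
qed

text \<open>Both sides satisfy x G' = (x L') G with constant term 1, which determines all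
  coefficients.\<close>

lemma fps_exp_lfps_nth: "fps_nth (fps_exp 1 oo lfps) n = of_nat (PL n)"
proof (induction n rule: less_induct)
  case (less n)
  let ?G = "fps_exp 1 oo lfps"
  show ?case
  proof (cases "n = 0")
    case True
    then show ?thesis by (simp add: PL_0)
  next
    case False
    have l0: "fps_nth lfps 0 = 0" by (simp add: lfps_def)
    have "fps_deriv ?G = ?G * fps_deriv lfps"
      using fps_compose_deriv[OF l0, of "fps_exp 1"] by simp
    then have "fps_X * fps_deriv ?G = (fps_X * fps_deriv lfps) * ?G" by (simp only: mult_ac)
    then have "fps_nth (fps_X * fps_deriv ?G) n = fps_nth ((fps_X * fps_deriv lfps) * ?G) n" by (rule arg_cong)
    moreover have X: "fps_nth (fps_X * fps_deriv f) n = of_nat n * fps_nth f n" for f :: "complex fps" and n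
      by (cases n) auto
    ultimately have "of_nat n * fps_nth ?G n = (\<Sum>k=0..n. of_nat k * fps_nth lfps k * fps_nth ?G (n - k))"
      by (simp add: fps_mult_nth)
    also have "\<dots> = (\<Sum>k=1..n. of_nat k * fps_nth lfps k * fps_nth ?G (n - k))"
      by (intro sum.mono_neutral_right) auto
    also have "\<dots> = (\<Sum>k=1..n. of_nat (sigma2 k * PL (n - k)))"
    proof (intro sum.cong refl)
      fix k assume "k \<in> {1..n}"
      then have "fps_nth ?G (n - k) = of_nat (PL (n - k))" by (intro less.IH) auto
      moreover have "of_nat k * fps_nth lfps k = of_nat (sigma2 k)"
        using arg_cong[OF of_nat_lcoeff[of k], of complex_of_real] by (simp add: lfps_def)
      ultimately show "of_nat k * fps_nth lfps k * fps_nth ?G (n - k) = of_nat (sigma2 k * PL (n - k))" by simp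
    qed
    also have "\<dots> = of_nat (n * PL n)" unfolding PL_recurrence by simp
    finally show ?thesis using False by simp
  qed
qed

definition logPL :: "complex \<Rightarrow> complex" where
  "logPL z = (\<Sum>n. of_real (lcoeff n) * z ^ n)"

text \<open>The formal identity becomes analytic because exp (logPL z) is holomorphic on the unit
  disc, so its power series has radius of convergence at least 1. Absolute summability feeds the
  uniform convergence on circles.\<close>

theorem PL_generating_function:
  fixes z :: complex
  assumes "norm z < 1"
  shows "(\<lambda>n. of_nat (PL n) * z ^ n) sums exp (logPL z)"
    and "summable (\<lambda>n. norm (of_nat (PL n) * z ^ n))"
proof -
  have ev: "eval_fps lfps z = logPL z" for z by (simp add: eval_fps_def logPL_def lfps_def)
  let ?G = "fps_exp 1 oo lfps"
  have l: "logPL has_fps_expansion lfps"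
    using fps_conv_radius_lfps ev by (auto simp: has_fps_expansion_def intro: less_le_trans[of 0 1])
  have sub: "eball (0 :: complex) 1 \<subseteq> eball 0 (fps_conv_radius lfps)"
  proof
    fix z :: complex assume "z \<in> eball 0 1"
    then have "ereal (dist 0 z) < 1" by (simp add: eball_def)
    from less_le_trans[OF this fps_conv_radius_lfps] show "z \<in> eball 0 (fps_conv_radius lfps)"
      by (simp add: eball_def)
  qed
  have "eval_fps lfps holomorphic_on eball 0 1"
    by (rule holomorphic_on_eval_fps[OF sub])
  moreover have "eval_fps lfps = logPL" by (rule ext) (rule ev)
  ultimately have hol: "(\<lambda>z. exp (logPL z)) holomorphic_on eball 0 1"
    by (intro holomorphic_on_exp holomorphic_on_compose[of logPL _ exp, unfolded o_def] holomorphic_intros) simp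
  have e: "(\<lambda>z. exp (logPL z)) has_fps_expansion ?G"
    using has_fps_expansion_compose[OF has_fps_expansion_exp1 l] by (simp add: lfps_def o_def)
  show "(\<lambda>n. of_nat (PL n) * z ^ n) sums exp (logPL z)"
    using has_fps_expansion_imp_sums_complex[OF e hol] assms by (simp add: fps_exp_lfps_nth)
  have "fps_conv_radius ?G \<ge> 1"
    by (rule holomorphic_on_imp_fps_conv_radius_ge[OF e hol])
  then have "ereal (norm z) < conv_radius (fps_nth ?G)"
    using assms unfolding fps_conv_radius_def by (metis ereal_less(3) less_le_trans)
  then have "summable (\<lambda>n. norm (fps_nth ?G n * z ^ n))"
    by (rule abs_summable_in_conv_radius)
  then show "summable (\<lambda>n. norm (of_nat (PL n) * z ^ n))" unfolding fps_exp_lfps_nth .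
qed

lemma PL_pos: "PL n > 0"
proof (cases "n = 0")
  case False
  have "0 < n ^ 2" using False by simp
  also have "n ^ 2 \<le> sigma2 n * PL (n - n)"
    using sigma2_ge[of n] by (simp add: PL_0)
  also have "\<dots> \<le> (\<Sum>k=1..n. sigma2 k * PL (n - k))"
    using False by (intro member_le_sum) auto
  finally show ?thesis unfolding PL_recurrence[symmetric] by simp
qed (simp add: PL_0)

section \<open>Coefficients as integrals over a circle\<close>

lemma has_integral_cis_int:
  "((\<lambda>t. exp (\<i> * of_int k * complex_of_real t)) has_integral (if k = 0 then 2 * of_real pi else 0)) {- pi..pi}"
proof (cases "k = 0")
  case True
  then show ?thesis using has_integral_const_real[of "1 :: complex" "- pi" pi] by (simp add: scaleR_conv_of_real)
next
  case False
  define F where "F = (\<lambda>t. exp (\<i> * of_int k * complex_of_real t) / (\<i> * of_int k))"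
  have "((\<lambda>t. exp (\<i> * of_int k * complex_of_real t)) has_integral (F pi - F (- pi))) {- pi..pi}"
  proof (rule fundamental_theorem_of_calculus)
    fix t assume "t \<in> {- pi..pi}"
    have "((\<lambda>z. exp (\<i> * of_int k * z) / (\<i> * of_int k)) has_field_derivative exp (\<i> * of_int k * of_real t)) (at (of_real t))"
      using False by (auto intro!: derivative_eq_intros)
    then show "(F has_vector_derivative exp (\<i> * of_int k * complex_of_real t)) (at t within {- pi..pi})"
      unfolding F_def by (rule has_vector_derivative_real_field)
  qed simp
  moreover have "F pi = F (- pi)"
  proof -
    have "exp (\<i> * of_int k * of_real pi) = exp (\<i> * of_int k * of_real (- pi))"
      by (subst exp_eq) (auto simp: algebra_simps)
    then show ?thesis by (simp add: F_def)
  qed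
  ultimately show ?thesis using False by simp
qed

lemma fourier_coefficient:
  fixes a :: "nat \<Rightarrow> complex"
  assumes "summable (\<lambda>m. norm (a m))"
  shows "((\<lambda>t. (\<Sum>m. a m * exp (\<i> * of_nat m * of_real t)) * exp (- \<i> * of_nat k * of_real t)) has_integral 2 * of_real pi * a k) {- pi..pi}"
    and "continuous_on {- pi..pi} (\<lambda>t. \<Sum>m. a m * exp (\<i> * of_nat m * complex_of_real t))"
proof -
  define f where "f = (\<lambda>N t. \<Sum>m<N. a m * exp (\<i> * of_nat m * complex_of_real t))"
  define F where "F = (\<lambda>t. \<Sum>m. a m * exp (\<i> * of_nat m * complex_of_real t))"
  have n: "norm (exp (\<i> * of_nat m * complex_of_real t)) = 1" for m t
    using norm_exp_i_times[of "real m * t"] by (simp add: mult.assoc)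
  have u: "uniform_limit {- pi..pi} f F sequentially"
    unfolding f_def F_def by (rule Weierstrass_m_test[OF _ assms]) (simp add: norm_mult n)
  have cf: "continuous_on {- pi..pi} (f N)" for N unfolding f_def by (intro continuous_intros)
  show c: "continuous_on {- pi..pi} (\<lambda>t. \<Sum>m. a m * exp (\<i> * of_nat m * complex_of_real t))"
    using uniform_limit_theorem[OF _ u] cf unfolding F_def by simp
  let ?e = "\<lambda>t. exp (- \<i> * of_nat k * complex_of_real t)"
  have ue: "uniform_limit {- pi..pi} (\<lambda>N t. f N t * ?e t) (\<lambda>t. F t * ?e t) sequentially"
  proof (rule uniform_lim_mult[OF u uniform_limit_const])
    show "bounded (F ` {- pi..pi})" "bounded (?e ` {- pi..pi})"
      using c by (auto simp: F_def intro!: compact_imp_bounded compact_continuous_image continuous_intros)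
  qed
  have i: "((\<lambda>t. f N t * ?e t) has_integral (\<Sum>m<N. if m = k then a m * (2 * of_real pi) else 0)) {- pi..pi}" for N
  proof -
    have "((\<lambda>t. \<Sum>m<N. a m * exp (\<i> * of_int (int m - int k) * complex_of_real t)) has_integral
        (\<Sum>m<N. a m * (if int m - int k = 0 then 2 * of_real pi else 0))) {- pi..pi}"
      by (intro has_integral_sum has_integral_mult_right has_integral_cis_int) auto
    moreover have "(\<Sum>m<N. a m * exp (\<i> * of_int (int m - int k) * complex_of_real t)) = f N t * ?e t" for t
      unfolding f_def sum_distrib_right by (intro sum.cong refl) (simp add: mult.assoc exp_add[symmetric] algebra_simps)
    moreover have "(\<Sum>m<N. a m * (if int m - int k = 0 then 2 * of_real pi else 0)) = (\<Sum>m<N. if m = k then a m * (2 * of_real pi) else 0)"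
      by (intro sum.cong) auto
    ultimately show ?thesis by simp
  qed
  obtain I J where I: "\<And>N. ((\<lambda>t. f N t * ?e t) has_integral I N) {- pi..pi}"
    and J: "((\<lambda>t. F t * ?e t) has_integral J) {- pi..pi}" and IJ: "I \<longlonglongrightarrow> J"
    by (rule uniform_limit_integral[OF ue]) (use cf in \<open>auto intro!: continuous_intros\<close>)
  have "I N = (\<Sum>m<N. if m = k then a m * (2 * of_real pi) else 0)" for N
    using has_integral_unique[OF I i] .
  then have "I N = a k * (2 * of_real pi)" if "N > k" for N using that by (simp add: sum.delta)
  then have "I \<longlonglongrightarrow> a k * (2 * of_real pi)"
    by (intro tendsto_eventually) (auto simp: eventually_at_top_dense)
  then have "J = a k * (2 * of_real pi)" using IJ LIMSEQ_unique by blast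
  then show "((\<lambda>t. (\<Sum>m. a m * exp (\<i> * of_nat m * of_real t)) * exp (- \<i> * of_nat k * of_real t)) has_integral 2 * of_real pi * a k) {- pi..pi}"
    using J by (simp add: F_def mult_ac)
qed

section \<open>The saddle point\<close>

lemma pi_squared_less_10: "pi\<^sup>2 < 10"
proof -
  have "pi < 3.15" using pi_approx by simp
  then have "pi * pi < 3.15 * 3.15" by (intro mult_strict_mono) auto
  then show ?thesis by (simp add: power2_eq_square)
qed

text \<open>Taylor expansion with remainder t^4 / 24; since t^2 <= pi^2 < 10, the remainder is at
  most 10 t^2 / 24, and 1/2 - 10/24 = 1/12.\<close>

lemma one_minus_cos_ge:
  assumes "\<bar>t\<bar> \<le> pi"
  shows "t\<^sup>2 / 12 \<le> 1 - cos t"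
proof -
  have e: "cos t - 1 + t\<^sup>2 / 2 = Re (iexp t - (\<Sum>k\<le>3. (\<i> * t) ^ k / fact k))"
    by (simp add: Re_exp eval_nat_numeral)
  have "cos t - 1 + t\<^sup>2 / 2 \<le> \<bar>t\<bar> ^ 4 / 24"
    unfolding e
    by (rule order.trans[OF complex_Re_le_cmod order.trans[OF iexp_approx1]]) (simp add: fact_numeral)
  then have "cos t - 1 + t\<^sup>2 / 2 \<le> t ^ 4 / 24" by (simp add: power_even_abs)
  moreover have "t\<^sup>2 \<le> 10"
    using assms pi_squared_less_10 power_mono[of "\<bar>t\<bar>" pi 2] by simp
  then have "t\<^sup>2 * t\<^sup>2 \<le> t\<^sup>2 * 10" by (intro mult_left_mono) auto
  then have "t ^ 4 \<le> 10 * t\<^sup>2" by (simp add: power2_eq_square eval_nat_numeral algebra_simps)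
  ultimately show ?thesis by linarith
qed

lemma norm_exp_diff_le:
  fixes a b :: complex
  assumes "Re a \<le> c" "Re b \<le> c"
  shows "norm (exp a - exp b) \<le> exp c * norm (a - b)"
proof (rule field_differentiable_bound[where S = "{z. Re z \<le> c}" and f' = exp])
  show "convex {z. Re z \<le> c}" by (rule convex_halfspace_Re_le)
qed (use assms in \<open>auto intro!: derivative_eq_intros\<close>)

lemma norm_power_diff_le:
  fixes a b :: "'a :: real_normed_field"
  assumes "norm a \<le> r" "norm b \<le> r" "1 \<le> r"
  shows "norm (a ^ k - b ^ k) \<le> real k * norm (a - b) * r ^ k"
proof (induction k)
  case (Suc k)
  have "a ^ Suc k - b ^ Suc k = a * (a ^ k - b ^ k) + (a - b) * b ^ k" by (simp add: algebra_simps)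
  then have "norm (a ^ Suc k - b ^ Suc k) \<le> norm a * norm (a ^ k - b ^ k) + norm (a - b) * norm b ^ k"
    by (metis norm_triangle_ineq norm_mult norm_power)
  also have "\<dots> \<le> r * (real k * norm (a - b) * r ^ k) + norm (a - b) * r ^ Suc k"
  proof (intro add_mono mult_mono Suc.IH)
    have "norm b ^ k \<le> r ^ k" using assms by (intro power_mono) auto
    also have "\<dots> \<le> r ^ Suc k" using assms by (intro power_increasing) auto
    finally show "norm b ^ k \<le> r ^ Suc k" .
  qed (use assms in auto)
  also have "\<dots> = real (Suc k) * norm (a - b) * r ^ Suc k" by (simp add: algebra_simps)
  finally show ?case .
qed simp

section \<open>The exponent on the saddle circle\<close>

locale saddle =
  fixes n :: nat and q :: real
  assumes q: "1 / 2 \<le> q" "q < 1"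
    and saddle: "(\<Sum>N. real (sigma2 N) * q ^ N) = real n"
begin

definition eps :: real where "eps = 1 - q"

lemma eps: "0 < eps" "eps \<le> 1 / 2"
  using q by (auto simp: eps_def)

lemma q_bounds: "0 \<le> q" "0 < q" "q < 1" "norm (complex_of_real q) < 1"
  using q by auto

definition var :: real where "var = (\<Sum>N. real N * real (sigma2 N) * q ^ N)"

lemma summable_var: "summable (\<lambda>N. real N * real (sigma2 N) * q ^ N)"
  using summable_sigma2[of q 1] q_bounds by simp

lemma var_le: "var \<le> 12 / eps ^ 4"
  using suminf_sigma2_le[of q 1] q_bounds by (simp add: var_def eps_def fact_numeral)

text \<open>By \<open>sigma2_ge\<close>, \<open>var\<close> is at least the sum of N^3 q^N, which is
  compared with the expansion of eps^-4 through ((N + 3) choose 3) <= 4 N^3 for N >= 1. The constant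
  5: (y - 1) / 4 >= y / 5 as soon as y >= 5, and eps <= 1 / 2 gives eps^-4 >= 16.\<close>

lemma var_ge: "1 / (5 * eps ^ 4) \<le> var"
proof -
  define b where "b = (\<lambda>N. real ((N + 3) choose 3) * q ^ N)"
  have b: "b sums (1 / eps ^ 4)"
    unfolding b_def eps_def using binomial_power_sums[of q 3] q_bounds by (simp add: eval_nat_numeral)
  \<comment> \<open>Removes the term N = 0, where the binomial coefficient is 1 but N^3 is
    0.\<close>
  define d where "d = (\<lambda>N :: nat. if N = 0 then 1 else (0 :: real))"
  have d: "d sums 1" unfolding d_def using sums_single[of 0 "\<lambda>_. 1"] by simp
  have le: "(b N - d N) / 4 \<le> real N ^ (1 + 2) * q ^ N" for N
  proof (cases "N = 0")
    case False
    have "real ((N + 3) choose 3) = (real N + 1) * (real N + 2) * (real N + 3) / 6"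
      by (simp add: binomial_gbinomial gbinomial_prod_rev eval_nat_numeral fact_numeral field_simps lessThan_Suc)
    also have "\<dots> \<le> 4 * real N ^ 3"
    proof -
      have "(real N + 1) * (real N + 2) * (real N + 3) \<le> (2 * real N) * (3 * real N) * (4 * real N)"
        using False by (intro mult_mono) auto
      then show ?thesis by (simp add: eval_nat_numeral)
    qed
    finally have "real ((N + 3) choose 3) * q ^ N \<le> 4 * real N ^ 3 * q ^ N"
      using q_bounds by (intro mult_right_mono) auto
    then show ?thesis using False by (simp add: b_def d_def power3_eq_cube mult_ac)
  qed (simp add: b_def d_def)
  have s: "(\<lambda>N. (b N - d N) / 4) sums ((1 / eps ^ 4 - 1) / 4)"
    by (intro sums_divide sums_diff b d)
  have "(1 / eps ^ 4 - 1) / 4 \<le> (\<Sum>N. real N ^ (1 + 2) * q ^ N)"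
    using sums_le[OF le s summable_sums[OF power_times_geometric_summable(1)]] q_bounds by auto
  also have "\<dots> \<le> var"
    using suminf_sigma2_ge[of q 1] q_bounds by (simp add: var_def)
  finally have "(1 / eps ^ 4 - 1) / 4 \<le> var" .
  moreover have "eps ^ 4 \<le> (1 / 2) ^ 4" using eps by (intro power_mono) auto
  then have "5 \<le> 1 / eps ^ 4" using eps by (simp add: field_simps)
  then have "1 / (5 * eps ^ 4) \<le> (1 / eps ^ 4 - 1) / 4" by (simp add: field_simps)
  ultimately show ?thesis by linarith
qed

lemma n_le: "real n \<le> 4 / eps ^ 3"
  using suminf_sigma2_le[of q 0] q_bounds saddle by (simp add: eps_def fact_numeral)

text \<open>The logarithm of the Cauchy integrand, normalised to 0 at t = 0. The subtracted linear
  terms add up to i n t by the saddle equation, so they are exactly the factor exp (-i n t) of the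
  coefficient integral; compare \<open>exp_psi\<close>.\<close>

definition psi :: "real \<Rightarrow> complex" where
  "psi t = (\<Sum>N. of_real (lcoeff N * q ^ N) * (iexp (real N * t) - 1 - \<i> * of_real (real N * t)))"

lemma iexp_bounds:
  "norm (iexp x - 1) \<le> \<bar>x\<bar>"
  "norm (iexp x - 1 - \<i> * of_real x) \<le> x\<^sup>2 / 2"
  "norm (iexp x - 1 - \<i> * of_real x + of_real (x\<^sup>2 / 2)) \<le> \<bar>x\<bar> ^ 3 / 6"
proof -
  show "norm (iexp x - 1) \<le> \<bar>x\<bar>" using iexp_approx1[of x 0] by simp
  show "norm (iexp x - 1 - \<i> * of_real x) \<le> x\<^sup>2 / 2"
    using iexp_approx1[of x 1] by (simp add: algebra_simps power2_eq_square)
  show "norm (iexp x - 1 - \<i> * of_real x + of_real (x\<^sup>2 / 2)) \<le> \<bar>x\<bar> ^ 3 / 6"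
    using iexp_approx1[of x 2] by (simp add: eval_nat_numeral algebra_simps)
qed

lemma norm_coeff: "norm (complex_of_real (lcoeff N * q ^ N)) = lcoeff N * q ^ N"
  unfolding norm_of_real using lcoeff_nonneg[of N] q_bounds by (intro abs_of_nonneg) auto

lemma psi_sums:
  "(\<lambda>N. of_real (lcoeff N * q ^ N) * (iexp (real N * t) - 1 - \<i> * of_real (real N * t))) sums psi t"
proof -
  have "summable (\<lambda>N. of_real (lcoeff N * q ^ N) * (iexp (real N * t) - 1 - \<i> * of_real (real N * t)))"
  proof (rule summable_comparison_test'[where N = 0])
    show "summable (\<lambda>N. t\<^sup>2 / 2 * (real N * real (sigma2 N) * q ^ N))"
      by (intro summable_mult summable_var)
    fix N
    have "norm (of_real (lcoeff N * q ^ N) * (iexp (real N * t) - 1 - \<i> * of_real (real N * t))) \<le> lcoeff N * q ^ N * ((real N * t)\<^sup>2 / 2)"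
      unfolding norm_mult[of "complex_of_real (lcoeff N * q ^ N)"] norm_coeff using lcoeff_nonneg[of N] q_bounds iexp_bounds(2)[of "real N * t"]
      by (intro mult_mono) auto
    also have "\<dots> = t\<^sup>2 / 2 * (real N * real (sigma2 N) * q ^ N)"
      unfolding of_nat_lcoeff[symmetric] by (simp add: power2_eq_square)
    finally show "norm (of_real (lcoeff N * q ^ N) * (iexp (real N * t) - 1 - \<i> * of_real (real N * t))) \<le> t\<^sup>2 / 2 * (real N * real (sigma2 N) * q ^ N)" .
  qed
  then show ?thesis unfolding psi_def by (rule summable_sums)
qed

text \<open>Termwise third-order remainder |N t|^3 / 6; the constant is 2 * 4! / 6 = 8.\<close>

lemma psi_near: "norm (psi t + of_real (var * t\<^sup>2 / 2)) \<le> 8 * \<bar>t\<bar> ^ 3 / eps ^ 5"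
proof -
  let ?f = "\<lambda>N. of_real (lcoeff N * q ^ N) * (iexp (real N * t) - 1 - \<i> * of_real (real N * t) + of_real ((real N * t)\<^sup>2 / 2))"
  let ?g = "\<lambda>N. \<bar>t\<bar> ^ 3 / 6 * (real N ^ 2 * real (sigma2 N) * q ^ N)"
  have "(\<lambda>N. complex_of_real (t\<^sup>2 / 2 * (real N * real (sigma2 N) * q ^ N))) sums of_real (t\<^sup>2 / 2 * var)"
    unfolding var_def by (intro sums_of_real sums_mult summable_sums summable_var)
  moreover have "of_real (lcoeff N * q ^ N) * of_real ((real N * t)\<^sup>2 / 2) = complex_of_real (t\<^sup>2 / 2 * (real N * real (sigma2 N) * q ^ N))" for N
    unfolding of_nat_lcoeff[symmetric] by (simp add: power2_eq_square)
  ultimately have "(\<lambda>N. of_real (lcoeff N * q ^ N) * of_real ((real N * t)\<^sup>2 / 2)) sums complex_of_real (t\<^sup>2 / 2 * var)"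
    by (simp only:)
  from sums_add[OF psi_sums[of t] this] have s: "?f sums (psi t + of_real (var * t\<^sup>2 / 2))"
    by (simp add: distrib_left mult.commute)
  have le: "norm (?f N) \<le> ?g N" for N
  proof -
    have "norm (?f N) \<le> lcoeff N * q ^ N * (\<bar>real N * t\<bar> ^ 3 / 6)"
      unfolding norm_mult[of "complex_of_real (lcoeff N * q ^ N)"] norm_coeff using lcoeff_nonneg[of N] q_bounds iexp_bounds(3)[of "real N * t"]
      by (intro mult_mono) auto
    also have "\<dots> = ?g N"
      unfolding of_nat_lcoeff[symmetric] by (simp add: eval_nat_numeral abs_mult)
    finally show ?thesis .
  qed
  have sg: "summable ?g" using q_bounds by (intro summable_mult summable_sigma2) auto
  have sf: "summable (\<lambda>N. norm (?f N))"
    by (rule summable_comparison_test'[OF sg, where N = 0]) (use le in auto)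
  have "norm (psi t + of_real (var * t\<^sup>2 / 2)) \<le> (\<Sum>N. norm (?f N))"
    using sums_unique[OF s] summable_norm[OF sf] by simp
  also have "\<dots> \<le> (\<Sum>N. ?g N)" by (rule suminf_le[OF le sf sg])
  also have "\<dots> = \<bar>t\<bar> ^ 3 / 6 * (\<Sum>N. real N ^ 2 * real (sigma2 N) * q ^ N)"
    using q_bounds by (intro suminf_mult summable_sigma2) auto
  also have "\<dots> \<le> \<bar>t\<bar> ^ 3 / 6 * (2 * fact (2 + 2) / (1 - q) ^ (2 + 3))"
    using q_bounds by (intro mult_left_mono suminf_sigma2_le) auto
  also have "\<dots> = 8 * \<bar>t\<bar> ^ 3 / eps ^ 5" by (simp add: eps_def fact_numeral)
  finally show ?thesis .
qed

text \<open>Every term of the real part has the factor cos (N t) - 1 <= 0, so replacing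
  \<open>lcoeff N\<close> by the smaller N can only increase the sum. The new sum is Re k(z) - k(q)
  for k(z) = z / (1 - z)^2, and |1 - z|^2 = eps^2 + 2 q (1 - cos t) >= eps^2 + t^2 / 12 bounds Re
  k(z) <= |k(z)|.\<close>

lemma Re_psi_le:
  assumes "\<bar>t\<bar> \<le> pi"
  shows "Re (psi t) \<le> - (t\<^sup>2 / (2 * eps\<^sup>2 * (12 * eps\<^sup>2 + t\<^sup>2)))"
proof -
  define z where "z = of_real q * iexp t"
  have nz: "norm z = q" using q_bounds by (simp add: z_def norm_mult)
  have k: "(\<lambda>N. of_nat N * y ^ N) sums (y / (1 - y)\<^sup>2)" if "norm y < 1" for y :: complex
  proof -
    have "(\<lambda>N. y * (of_nat (Suc N) * y ^ N)) sums (y * (1 / (1 - y)\<^sup>2))"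
      by (intro sums_mult geometric_deriv_sums that)
    then have "(\<lambda>N. of_nat (Suc N) * y ^ Suc N) sums (y / (1 - y)\<^sup>2)" by (simp add: mult_ac)
    then show ?thesis using sums_Suc_iff[of "\<lambda>N. of_nat N * y ^ N"] by simp
  qed
  have ReS: "(\<lambda>N. lcoeff N * q ^ N * (cos (real N * t) - 1)) sums Re (psi t)"
    using sums_Re[OF psi_sums[of t]] by (simp add: Re_exp)
  have zN: "Re (of_nat N * z ^ N) = real N * q ^ N * cos (real N * t)" for N
  proof -
    have "z ^ N = of_real (q ^ N) * iexp (real N * t)"
      by (simp add: z_def power_mult_distrib exp_of_nat_mult[symmetric] mult_ac)
    then show ?thesis by (simp add: Re_exp)
  qed
  have "(\<lambda>N. Re (of_nat N * z ^ N - of_nat N * of_real q ^ N)) sums Re (z / (1 - z)\<^sup>2 - of_real q / (1 - of_real q)\<^sup>2)"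
    using q_bounds nz by (intro sums_Re sums_diff k) auto
  moreover have "Re (of_nat N * z ^ N - of_nat N * of_real q ^ N) = real N * q ^ N * (cos (real N * t) - 1)" for N
  proof -
    have "Re (of_nat N * of_real q ^ N) = real N * q ^ N" by (metis Re_complex_of_real of_real_mult of_real_of_nat_eq of_real_power)
    then show ?thesis by (simp only: minus_complex.sel zN) (simp add: algebra_simps)
  qed
  moreover have "Re (of_real q / (1 - of_real q)\<^sup>2) = q / eps\<^sup>2"
    unfolding eps_def by (metis Re_complex_of_real of_real_1 of_real_diff of_real_divide of_real_power)
  ultimately have KS: "(\<lambda>N. real N * q ^ N * (cos (real N * t) - 1)) sums (Re (z / (1 - z)\<^sup>2) - q / eps\<^sup>2)"
    by simp
  have "Re (psi t) \<le> Re (z / (1 - z)\<^sup>2) - q / eps\<^sup>2"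
  proof (rule sums_le[OF _ ReS KS])
    fix N
    show "lcoeff N * q ^ N * (cos (real N * t) - 1) \<le> real N * q ^ N * (cos (real N * t) - 1)"
      using q_bounds by (intro mult_right_mono_neg mult_right_mono lcoeff_ge) auto
  qed
  also have "Re (z / (1 - z)\<^sup>2) \<le> q / (norm (1 - z))\<^sup>2"
    using complex_Re_le_cmod[of "z / (1 - z)\<^sup>2"] nz by (simp add: norm_divide norm_power)
  also have "(norm (1 - z))\<^sup>2 = eps\<^sup>2 + 2 * q * (1 - cos t)"
  proof -
    have "(norm (1 - z))\<^sup>2 = (1 - q * cos t)\<^sup>2 + (q * sin t)\<^sup>2"
      unfolding cmod_power2 by (simp add: z_def Re_exp Im_exp)
    also have "\<dots> = 1 - 2 * (q * cos t) + ((q * cos t)\<^sup>2 + (q * sin t)\<^sup>2)"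
      by (simp add: power2_diff)
    also have "(q * cos t)\<^sup>2 + (q * sin t)\<^sup>2 = q\<^sup>2"
      unfolding power_mult_distrib distrib_left[symmetric] by simp
    finally show ?thesis by (simp add: eps_def power2_eq_square algebra_simps)
  qed
  also have "q / (eps\<^sup>2 + 2 * q * (1 - cos t)) \<le> q / (eps\<^sup>2 + t\<^sup>2 / 12)"
  proof -
    have "1 * (t\<^sup>2 / 12) \<le> 2 * q * (1 - cos t)"
      using q one_minus_cos_ge[OF assms] by (intro mult_mono) auto
    then show ?thesis using q_bounds eps by (intro divide_left_mono mult_pos_pos add_pos_nonneg) auto
  qed
  also have "q / (eps\<^sup>2 + t\<^sup>2 / 12) - q / eps\<^sup>2 = - (q * (t\<^sup>2 / (eps\<^sup>2 * (12 * eps\<^sup>2 + t\<^sup>2))))"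
  proof -
    have "eps\<^sup>2 \<noteq> 0" "12 * eps\<^sup>2 + t\<^sup>2 \<noteq> 0" using eps by (auto simp: sum_power2_eq_zero_iff add_nonneg_eq_0_iff)
    then show ?thesis by (simp add: divide_simps) (simp add: algebra_simps)
  qed
  also have "\<dots> \<le> - (1 / 2 * (t\<^sup>2 / (eps\<^sup>2 * (12 * eps\<^sup>2 + t\<^sup>2))))"
    using q by (intro le_imp_neg_le mult_right_mono) auto
  finally show ?thesis by simp
qed

text \<open>For t^2 <= eps^2 the denominator of \<open>Re_psi_le\<close> is at most 2 eps^2 * 13
  eps^2, whence 26. The same number appears for t^2 >= eps^2, where t^2 / (12 eps^2 + t^2) >= 1 /
  13.\<close>

lemma Re_psi_inner:
  assumes "\<bar>t\<bar> \<le> eps"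
  shows "Re (psi t) \<le> - (t\<^sup>2 / (26 * eps ^ 4))"
proof -
  have "\<bar>t\<bar> \<le> pi" using assms eps pi_gt3 by linarith
  note Re_psi_le[OF this]
  also have "t\<^sup>2 \<le> eps\<^sup>2" using assms power_mono[of "\<bar>t\<bar>" eps 2] by simp
  then have "t\<^sup>2 / (26 * eps ^ 4) \<le> t\<^sup>2 / (2 * eps\<^sup>2 * (12 * eps\<^sup>2 + t\<^sup>2))"
  proof (intro divide_left_mono)
    assume "t\<^sup>2 \<le> eps\<^sup>2"
    then have "2 * eps\<^sup>2 * (12 * eps\<^sup>2 + t\<^sup>2) \<le> 2 * eps\<^sup>2 * (13 * eps\<^sup>2)" by (intro mult_left_mono) auto
    then show "2 * eps\<^sup>2 * (12 * eps\<^sup>2 + t\<^sup>2) \<le> 26 * eps ^ 4" by (simp add: eval_nat_numeral)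
    have "0 < 12 * eps\<^sup>2 + t\<^sup>2" using eps by (intro add_pos_nonneg) auto
    then show "0 < 26 * eps ^ 4 * (2 * eps\<^sup>2 * (12 * eps\<^sup>2 + t\<^sup>2))" using eps by simp
  qed auto
  then have "- (t\<^sup>2 / (2 * eps\<^sup>2 * (12 * eps\<^sup>2 + t\<^sup>2))) \<le> - (t\<^sup>2 / (26 * eps ^ 4))" by simp
  finally show ?thesis .
qed

lemma Re_psi_outer:
  assumes "eps \<le> \<bar>t\<bar>" "\<bar>t\<bar> \<le> pi"
  shows "Re (psi t) \<le> - (1 / (26 * eps\<^sup>2))"
proof -
  note Re_psi_le[OF assms(2)]
  also have te: "eps\<^sup>2 \<le> t\<^sup>2" using assms eps power_mono[of eps "\<bar>t\<bar>" 2] by simp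
  have "1 / (26 * eps\<^sup>2) \<le> t\<^sup>2 / (2 * eps\<^sup>2 * (12 * eps\<^sup>2 + t\<^sup>2))"
  proof -
    have "eps\<^sup>2 > 0" "12 * eps\<^sup>2 + t\<^sup>2 > 0" using eps by (auto intro: add_pos_nonneg)
    then show ?thesis using te by (simp add: divide_simps) 
  qed
  then have "- (t\<^sup>2 / (2 * eps\<^sup>2 * (12 * eps\<^sup>2 + t\<^sup>2))) \<le> - (1 / (26 * eps\<^sup>2))" by simp
  finally show ?thesis .
qed

definition gq :: real where "gq = exp (\<Sum>N. lcoeff N * q ^ N)"

lemma exp_psi: "exp (psi t) = exp (logPL (of_real q * iexp t)) / of_real gq * exp (- \<i> * of_nat n * of_real t)"
proof -
  have 1: "(\<lambda>N. of_real (lcoeff N) * (of_real q * iexp t) ^ N) sums logPL (of_real q * iexp t)"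
    unfolding logPL_def using q_bounds
    by (intro summable_sums summable_norm_cancel[OF summable_lcoeff]) (auto simp: norm_mult)
  have "summable (\<lambda>N. of_real (lcoeff N) * complex_of_real q ^ N)"
    using q_bounds by (intro summable_norm_cancel[OF summable_lcoeff]) auto
  then have "summable (\<lambda>N. complex_of_real (lcoeff N * q ^ N))" by simp
  then have "summable (\<lambda>N. lcoeff N * q ^ N)" by (simp only: summable_of_real_iff)
  then have 2: "(\<lambda>N. complex_of_real (lcoeff N * q ^ N)) sums of_real (\<Sum>N. lcoeff N * q ^ N)"
    by (intro sums_of_real summable_sums)
  have 3: "(\<lambda>N. \<i> * of_real t * complex_of_real (real (sigma2 N) * q ^ N)) sums (\<i> * of_real t * complex_of_real (real n))"
    unfolding saddle[symmetric] using summable_sigma2[of q 0] q_bounds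
    by (intro sums_mult sums_of_real summable_sums) auto
  have t: "of_real (lcoeff N) * (of_real q * iexp t) ^ N - complex_of_real (lcoeff N * q ^ N) - \<i> * of_real t * complex_of_real (real (sigma2 N) * q ^ N)
    = of_real (lcoeff N * q ^ N) * (iexp (real N * t) - 1 - \<i> * of_real (real N * t))" for N
    unfolding of_nat_lcoeff[symmetric]
    by (simp add: power_mult_distrib exp_of_nat_mult[symmetric] algebra_simps)
  have psi: "psi t = logPL (of_real q * iexp t) - of_real (\<Sum>N. lcoeff N * q ^ N) - \<i> * of_real t * complex_of_real (real n)"
    using sums_unique2[OF psi_sums sums_diff[OF sums_diff[OF 1 2] 3, unfolded t]] .
  show ?thesis unfolding psi exp_diff gq_def
    by (simp add: exp_minus exp_of_real divide_inverse mult_ac)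
qed

definition weight :: "nat \<Rightarrow> real" where "weight m = real (PL m) * q ^ m / gq"

lemma gq_pos: "gq > 0" by (simp add: gq_def)

lemma weight_pos: "weight m > 0"
  using PL_pos[of m] gq_pos q_bounds by (simp add: weight_def)

lemma exp_psi_fourier:
  shows "((\<lambda>t. exp (psi t) * exp (- \<i> * of_nat j * of_real t)) has_integral of_real (2 * pi * weight (n + j))) {- pi..pi}"
    and "continuous_on {- pi..pi} (\<lambda>t. exp (psi t))"
proof -
  have sm: "summable (\<lambda>m. norm (complex_of_real (weight m)))"
  proof -
    have "summable (\<lambda>m. norm (of_nat (PL m) * complex_of_real q ^ m))"
      using q_bounds by (intro PL_generating_function) auto
    then have "summable (\<lambda>m. norm (of_nat (PL m) * complex_of_real q ^ m) / gq)" by (rule summable_divide)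
    moreover have "norm (of_nat (PL m) * complex_of_real q ^ m) / gq = norm (complex_of_real (weight m))" for m
      using gq_pos q_bounds by (simp add: weight_def norm_mult norm_power norm_divide)
    ultimately show ?thesis by (simp only:)
  qed
  have F: "(\<Sum>m. of_real (weight m) * exp (\<i> * of_nat m * of_real t)) = exp (logPL (of_real q * iexp t)) / of_real gq" for t
  proof -
    have "(\<lambda>m. of_nat (PL m) * (of_real q * iexp t) ^ m / of_real gq) sums (exp (logPL (of_real q * iexp t)) / of_real gq)"
      using q_bounds by (intro sums_divide PL_generating_function) (auto simp: norm_mult)
    moreover have "of_nat (PL m) * (of_real q * iexp t) ^ m / of_real gq = of_real (weight m) * exp (\<i> * of_nat m * of_real t)" for m
      by (simp add: weight_def power_mult_distrib exp_of_nat_mult[symmetric] mult_ac)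
    ultimately show ?thesis by (simp add: sums_iff)
  qed
  have e: "exp (psi t) = (\<Sum>m. of_real (weight m) * exp (\<i> * of_nat m * of_real t)) * exp (- \<i> * of_nat n * of_real t)" for t
    unfolding exp_psi F ..
  show "continuous_on {- pi..pi} (\<lambda>t. exp (psi t))"
    unfolding e by (intro continuous_intros fourier_coefficient sm)
  have "exp (psi t) * exp (- \<i> * of_nat j * of_real t) =
     (\<Sum>m. of_real (weight m) * exp (\<i> * of_nat m * of_real t)) * exp (- \<i> * of_nat (n + j) * of_real t)" for t
    unfolding e mult.assoc exp_add[symmetric] by (simp add: algebra_simps)
  then show "((\<lambda>t. exp (psi t) * exp (- \<i> * of_nat j * of_real t)) has_integral of_real (2 * pi * weight (n + j))) {- pi..pi}"
    using fourier_coefficient(1)[OF sm, of "n + j"] by (simp only: of_real_mult of_real_numeral)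
qed

end

section \<open>Comparison with the Gaussian integral\<close>

lemma power_le_exp:
  fixes u :: real
  assumes "0 \<le> u"
  shows "u ^ k \<le> real k ^ k * exp u"
proof (cases "k = 0")
  case False
  have "u / real k \<le> exp (u / real k)" using exp_ge_add_one_self[of "u / real k"] by linarith
  then have "(u / real k) ^ k \<le> exp (u / real k) ^ k" using assms by (intro power_mono) auto
  also have "\<dots> = exp u" using False by (simp add: exp_of_nat_mult[symmetric])
  finally show ?thesis using False by (simp add: power_divide field_simps)
qed (use assms in simp)

lemma shifted_power_le_exp:
  fixes d :: nat and v :: real
  assumes "1 \<le> d" "0 \<le> v"
  shows "(real d + v) ^ d \<le> real d ^ d * exp v"
proof -
  have "real d + v \<le> real d * exp (v / real d)"
    using exp_ge_add_one_self[of "v / real d"] assms by (simp add: field_simps)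
  then have "(real d + v) ^ d \<le> (real d * exp (v / real d)) ^ d" using assms by (intro power_mono) auto
  also have "\<dots> = real d ^ d * exp v"
    using assms by (simp add: power_mult_distrib exp_of_nat_mult[symmetric])
  finally show ?thesis .
qed

lemma linear_minus_square_le: "5 * u - u\<^sup>2 / 26 \<le> 325 - u\<^sup>2 / (52 :: real)"
proof -
  have "0 \<le> (u - 130)\<^sup>2" by simp
  then show ?thesis by (simp add: power2_eq_square algebra_simps)
qed

context saddle
begin

definition sd :: real where "sd = sqrt var"

lemma sd: "sd > 0" "sd \<le> 4 / eps\<^sup>2" "sd\<^sup>2 = var" "1 / (5 * eps ^ 4) \<le> sd\<^sup>2"
proof -
  have "1 / (5 * eps ^ 4) > 0" using eps by simp
  then have v: "var > 0" using var_ge by linarith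
  then show "sd > 0" "sd\<^sup>2 = var" by (simp_all add: sd_def)
  then show "1 / (5 * eps ^ 4) \<le> sd\<^sup>2" using var_ge by simp
  have "var \<le> (4 / eps\<^sup>2)\<^sup>2"
    using var_le eps by (simp add: power_divide divide_right_mono) (rule order.trans, assumption, simp add: divide_right_mono)
  then show "sd \<le> 4 / eps\<^sup>2" unfolding sd_def using eps by (intro real_le_lsqrt) (use v in auto)
qed

text \<open>Near t = 0, \<open>psi t\<close> is close to -(sd * t)^2 / 2 and exp (-i t) - 1 to -i t;
  the two replacements turn \<open>osc\<close> into \<open>gauss\<close>, whose integral over the
  line is a multiple of the Hermite polynomial.\<close>

definition osc :: "nat \<Rightarrow> real \<Rightarrow> real \<Rightarrow> complex" where
  "osc d w t = exp (psi t) * (of_real w + of_real sd * (iexp (- t) - 1)) ^ d"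

definition gauss :: "nat \<Rightarrow> real \<Rightarrow> real \<Rightarrow> complex" where
  "gauss d w t = of_real (exp (- sd\<^sup>2 * t\<^sup>2 / 2)) * (of_real w - \<i> * of_real (sd * t)) ^ d"

text \<open>With \<open>u = \<bar>t\<bar> / eps\<^sup>2\<close>, the factor \<open>exp 325\<close> comes from completing the square in
  \<open>5 u - u\<^sup>2 / 26\<close>, and 216 from \<open>8 u\<^sup>3 \<le> 8 \<cdot> 27 exp u\<close>.\<close>

definition inner_const :: "nat \<Rightarrow> real" where
  "inner_const d = real d ^ d * (216 + 4 * real d) * exp 325"

definition outer_const :: "nat \<Rightarrow> real" where
  "outer_const d = exp (- (1 / (26 * eps\<^sup>2))) * (real d + 8 / eps\<^sup>2) ^ d"

lemma base_bounds:
  fixes t w :: real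
  assumes "\<bar>w\<bar> \<le> real d"
  shows "norm (of_real w + of_real sd * (iexp (- t) - 1)) \<le> real d + 4 * (\<bar>t\<bar> / eps\<^sup>2)"
    and "norm (of_real w - \<i> * of_real (sd * t)) \<le> real d + 4 * (\<bar>t\<bar> / eps\<^sup>2)"
    and "norm (of_real w + of_real sd * (iexp (- t) - 1)) \<le> real d + 8 / eps\<^sup>2"
    and "norm ((of_real w + of_real sd * (iexp (- t) - 1)) - (of_real w - \<i> * of_real (sd * t))) \<le> 2 * t\<^sup>2 / eps\<^sup>2"
proof -
  have st: "sd * \<bar>t\<bar> \<le> 4 * (\<bar>t\<bar> / eps\<^sup>2)"
    using mult_right_mono[OF sd(2), of "\<bar>t\<bar>"] by simp
  have "norm (of_real w + of_real sd * (iexp (- t) - 1)) \<le> \<bar>w\<bar> + sd * norm (iexp (- t) - 1)"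
    using norm_triangle_ineq[of "of_real w" "of_real sd * (iexp (- t) - 1)"] sd(1) unfolding norm_mult norm_of_real by simp
  note triangle = this
  also have "sd * norm (iexp (- t) - 1) \<le> sd * \<bar>t\<bar>"
    using iexp_bounds(1)[of "- t"] sd(1) by (intro mult_left_mono) auto
  finally show "norm (of_real w + of_real sd * (iexp (- t) - 1)) \<le> real d + 4 * (\<bar>t\<bar> / eps\<^sup>2)"
    using assms st by linarith
  have "norm (iexp (- t) - 1) \<le> 2"
    using norm_triangle_ineq4[of "iexp (- t)" 1] norm_exp_i_times[of "- t"] by simp
  then have "sd * norm (iexp (- t) - 1) \<le> sd * 2" using sd(1) by (intro mult_left_mono) auto
  then show "norm (of_real w + of_real sd * (iexp (- t) - 1)) \<le> real d + 8 / eps\<^sup>2"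
    using triangle assms sd(2) by simp
  have "norm (of_real w - \<i> * of_real (sd * t)) \<le> norm (complex_of_real w) + norm (\<i> * complex_of_real (sd * t))"
    by (rule norm_triangle_ineq4)
  also have "\<dots> = \<bar>w\<bar> + sd * \<bar>t\<bar>" using sd(1) by (simp add: norm_mult abs_mult)
  finally show "norm (of_real w - \<i> * of_real (sd * t)) \<le> real d + 4 * (\<bar>t\<bar> / eps\<^sup>2)"
    using assms st by linarith
  have "(of_real w + of_real sd * (iexp (- t) - 1)) - (of_real w - \<i> * of_real (sd * t)) = of_real sd * (iexp (- t) - 1 - \<i> * of_real (- t))"
    by (simp add: algebra_simps)
  then have "norm ((of_real w + of_real sd * (iexp (- t) - 1)) - (of_real w - \<i> * of_real (sd * t))) = sd * norm (iexp (- t) - 1 - \<i> * of_real (- t))"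
    using sd(1) by (simp only: norm_mult norm_of_real abs_of_pos)
  also have "\<dots> \<le> (4 / eps\<^sup>2) * ((- t)\<^sup>2 / 2)"
    using sd iexp_bounds(2)[of "- t"] by (intro mult_mono) auto
  finally show "norm ((of_real w + of_real sd * (iexp (- t) - 1)) - (of_real w - \<i> * of_real (sd * t))) \<le> 2 * t\<^sup>2 / eps\<^sup>2"
    by simp
qed

text \<open>In the variable u = |t| / eps^2 the exponents differ by at most 8 eps u^3 and the bases
  by 2 eps^2 u^2, so the difference of the products keeps a factor eps. Both exponentials are at
  most exp (-u^2 / 26); half of this decay pays for the polynomial factors and half remains for
  integration.\<close>

lemma inner_bound:
  assumes d: "1 \<le> d" and w: "\<bar>w\<bar> \<le> real d" and t: "\<bar>t\<bar> \<le> eps"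
  shows "norm (osc d w t - gauss d w t) \<le> inner_const d * eps * exp (- (1 / (52 * eps ^ 4)) * t\<^sup>2)"
proof -
  define u where "u = \<bar>t\<bar> / eps\<^sup>2"
  have u: "0 \<le> u" using eps by (simp add: u_def)
  have tu: "\<bar>t\<bar> = u * eps\<^sup>2" using eps by (simp add: u_def)
  have t2: "t\<^sup>2 = u\<^sup>2 * eps ^ 4" using arg_cong[OF tu, of "\<lambda>x. x\<^sup>2"] by (simp add: power_mult_distrib)
  define A B where "A = of_real w + of_real sd * (iexp (- t) - 1)" and "B = complex_of_real w - \<i> * of_real (sd * t)"
  define R where "R = real d + 4 * u"
  have "2 * t\<^sup>2 / eps\<^sup>2 = 2 * u\<^sup>2 * eps\<^sup>2"
    unfolding t2 using eps by (simp add: field_simps eval_nat_numeral)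
  then have R: "1 \<le> R" "norm A \<le> R" "norm B \<le> R" "norm (A - B) \<le> 2 * u\<^sup>2 * eps\<^sup>2"
    using base_bounds[OF w, of t] d u unfolding A_def B_def R_def u_def[symmetric] by simp_all
  let ?s = "sd\<^sup>2 * t\<^sup>2 / 2" and ?E = "exp (- (u\<^sup>2 / 26))"
  have "u\<^sup>2 / 5 \<le> sd\<^sup>2 * t\<^sup>2"
    using mult_right_mono[OF sd(4), of "t\<^sup>2"] eps by (simp add: t2)
  then have s: "- ?s \<le> - (u\<^sup>2 / 26)" by (simp add: field_simps) (use zero_le_power2[of u] in linarith)
  have "Re (psi t) \<le> - (t\<^sup>2 / (26 * eps ^ 4))" by (rule Re_psi_inner[OF t])
  also have "t\<^sup>2 / (26 * eps ^ 4) = u\<^sup>2 / 26" using eps by (simp add: t2)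
  finally have r: "Re (psi t) \<le> - (u\<^sup>2 / 26)" .
  have "norm (exp (psi t) - exp (of_real (- ?s))) \<le> ?E * norm (psi t - of_real (- ?s))"
    using r s by (intro norm_exp_diff_le) auto
  also have "norm (psi t - of_real (- ?s)) \<le> 8 * \<bar>t\<bar> ^ 3 / eps ^ 5"
    using psi_near[of t] by (simp add: sd(3))
  also have "8 * \<bar>t\<bar> ^ 3 / eps ^ 5 = 8 * eps * u ^ 3"
    unfolding tu using eps by (simp add: power_mult_distrib field_simps) (simp add: eval_nat_numeral)
  finally have e: "norm (exp (psi t) - exp (of_real (- ?s))) \<le> ?E * (8 * eps * u ^ 3)" by simp
  have p: "norm (A ^ d - B ^ d) \<le> real d * (2 * u\<^sup>2 * eps\<^sup>2) * R ^ d"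
  proof -
    have "norm (A ^ d - B ^ d) \<le> real d * norm (A - B) * R ^ d" by (rule norm_power_diff_le[OF R(2,3,1)])
    also have "\<dots> \<le> real d * (2 * u\<^sup>2 * eps\<^sup>2) * R ^ d" using R by (intro mult_right_mono mult_left_mono) auto
    finally show ?thesis .
  qed
  have Ad: "norm (A ^ d) \<le> R ^ d" unfolding norm_power using R by (intro power_mono) auto
  have ex: "exp (complex_of_real (- ?s)) = of_real (exp (- ?s))" by (rule exp_of_real)
  have "osc d w t - gauss d w t = (exp (psi t) - exp (of_real (- ?s))) * A ^ d + of_real (exp (- ?s)) * (A ^ d - B ^ d)"
    unfolding osc_def gauss_def A_def[symmetric] B_def[symmetric] ex by (simp add: algebra_simps)
  then have "norm (osc d w t - gauss d w t) \<le> norm (exp (psi t) - exp (of_real (- ?s))) * norm (A ^ d) + exp (- ?s) * norm (A ^ d - B ^ d)"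
    using norm_triangle_ineq[of "(exp (psi t) - exp (of_real (- ?s))) * A ^ d" "of_real (exp (- ?s)) * (A ^ d - B ^ d)"]
    unfolding norm_mult norm_of_real by simp
  also have "\<dots> \<le> ?E * (8 * eps * u ^ 3) * R ^ d + ?E * (real d * (2 * u\<^sup>2 * eps\<^sup>2) * R ^ d)"
    using e Ad p s u eps R(1) by (intro add_mono mult_mono) auto
  also have "\<dots> = ?E * R ^ d * eps * (8 * u ^ 3 + 2 * real d * eps * u\<^sup>2)"
    by (simp add: algebra_simps power2_eq_square)
  \<comment> \<open>Here u^3 <= 27 exp u, u^2 <= 4 exp u and eps <= 1 / 2; together with exp (4 u)
    from the d-th power this makes exp (5 u).\<close>
  also have "\<dots> \<le> ?E * (real d ^ d * exp (4 * u)) * eps * (8 * (27 * exp u) + 2 * real d * (1 / 2) * (4 * exp u))"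
    using power_le_exp[OF u, of 3] power_le_exp[OF u, of 2] shifted_power_le_exp[OF d, of "4 * u"] u eps R(1)
    unfolding R_def by (intro mult_mono add_mono) auto
  also have "\<dots> = real d ^ d * (216 + 4 * real d) * eps * exp (5 * u - u\<^sup>2 / 26)"
  proof -
    have "exp (5 * u - u\<^sup>2 / 26) = ?E * exp (4 * u) * exp u" by (simp add: exp_add[symmetric])
    then show ?thesis by (simp add: algebra_simps)
  qed
  also have "\<dots> \<le> real d ^ d * (216 + 4 * real d) * eps * exp (325 - u\<^sup>2 / 52)"
    using linear_minus_square_le[of u] eps by (intro mult_left_mono) auto
  also have "exp (325 - u\<^sup>2 / 52) = exp 325 * exp (- (1 / (52 * eps ^ 4)) * t\<^sup>2)"
    unfolding exp_add[symmetric] using eps by (simp add: t2)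
  finally show ?thesis by (simp add: inner_const_def mult_ac)
qed

text \<open>For |t| >= eps the product eps * u is at least 1, and this supplies the factor eps; the
  Gaussian tail then fits under the majorant of the inner part.\<close>

lemma gauss_outer_bound:
  assumes d: "1 \<le> d" and w: "\<bar>w\<bar> \<le> real d" and t: "eps \<le> \<bar>t\<bar>"
  shows "norm (gauss d w t) \<le> inner_const d * eps * exp (- (1 / (52 * eps ^ 4)) * t\<^sup>2)"
proof -
  define u where "u = \<bar>t\<bar> / eps\<^sup>2"
  have u: "0 \<le> u" using eps by (simp add: u_def)
  have tu: "\<bar>t\<bar> = u * eps\<^sup>2" using eps by (simp add: u_def)
  have t2: "t\<^sup>2 = u\<^sup>2 * eps ^ 4" using arg_cong[OF tu, of "\<lambda>x. x\<^sup>2"] by (simp add: power_mult_distrib)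
  have eu: "1 \<le> eps * u" using t eps by (simp add: tu power2_eq_square mult.commute)
  have "u\<^sup>2 / 5 \<le> sd\<^sup>2 * t\<^sup>2"
    using mult_right_mono[OF sd(4), of "t\<^sup>2"] eps by (simp add: t2)
  then have s: "- sd\<^sup>2 * t\<^sup>2 / 2 \<le> - (u\<^sup>2 / 26)" by (simp add: field_simps) (use zero_le_power2[of u] in linarith)
  have "norm (gauss d w t) = exp (- sd\<^sup>2 * t\<^sup>2 / 2) * norm (complex_of_real w - \<i> * of_real (sd * t)) ^ d"
    unfolding gauss_def norm_mult norm_of_real norm_power by simp
  also have "\<dots> \<le> exp (- (u\<^sup>2 / 26)) * (real d + 4 * u) ^ d"
    using s base_bounds(2)[OF w, of t] by (intro mult_mono power_mono) (auto simp: u_def)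
  also have "\<dots> \<le> exp (- (u\<^sup>2 / 26)) * (real d ^ d * exp (4 * u))"
    using shifted_power_le_exp[OF d, of "4 * u"] u by (intro mult_left_mono) auto
  also have "\<dots> = exp (- (u\<^sup>2 / 26)) * (real d ^ d * exp (4 * u)) * 1" by simp
  also have "\<dots> \<le> exp (- (u\<^sup>2 / 26)) * (real d ^ d * exp (4 * u)) * (eps * exp u)"
  proof -
    have "u \<le> exp u" using exp_ge_add_one_self[of u] by linarith
    then have "1 \<le> eps * exp u" using eu mult_left_mono[of u "exp u" eps] eps by linarith
    then show ?thesis by (intro mult_left_mono) auto
  qed
  also have "\<dots> = real d ^ d * eps * exp (5 * u - u\<^sup>2 / 26)"
  proof -
    have "exp (5 * u - u\<^sup>2 / 26) = exp (- (u\<^sup>2 / 26)) * exp (4 * u) * exp u" by (simp add: exp_add[symmetric])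
    then show ?thesis by (simp add: algebra_simps)
  qed
  also have "\<dots> \<le> real d ^ d * eps * exp (325 - u\<^sup>2 / 52)"
    using linear_minus_square_le[of u] eps by (intro mult_left_mono) auto
  also have "\<dots> \<le> (real d ^ d * (216 + 4 * real d)) * eps * exp (325 - u\<^sup>2 / 52)"
    using eps mult_left_mono[of 1 "216 + 4 * real d" "real d ^ d"] by (intro mult_right_mono) auto
  also have "exp (325 - u\<^sup>2 / 52) = exp 325 * exp (- (1 / (52 * eps ^ 4)) * t\<^sup>2)"
    unfolding exp_add[symmetric] using eps by (simp add: t2)
  finally show ?thesis by (simp add: inner_const_def mult_ac)
qed

lemma osc_outer_bound:
  assumes w: "\<bar>w\<bar> \<le> real d" and t: "eps \<le> \<bar>t\<bar>" "\<bar>t\<bar> \<le> pi"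
  shows "norm (osc d w t) \<le> outer_const d"
proof -
  have "norm (osc d w t) = exp (Re (psi t)) * norm (of_real w + of_real sd * (iexp (- t) - 1)) ^ d"
    unfolding osc_def norm_mult norm_power by simp
  also have "\<dots> \<le> outer_const d"
    unfolding outer_const_def using Re_psi_outer[OF t] base_bounds(3)[OF w, of t]
    by (intro mult_mono power_mono) auto
  finally show ?thesis .
qed

text \<open>\<open>osc\<close> lives on one period and \<open>gauss\<close> on the whole line; the
  indicator puts both under one integrable majorant.\<close>

lemma total_bound:
  assumes d: "1 \<le> d" and w: "\<bar>w\<bar> \<le> real d"
  shows "norm (indicator {- pi..pi} t *\<^sub>R osc d w t - gauss d w t) \<le>
    inner_const d * eps * exp (- (1 / (52 * eps ^ 4)) * t\<^sup>2) + outer_const d * indicator {- pi..pi} t"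
    (is "_ \<le> ?M + _")
proof -
  have T: "outer_const d \<ge> 0" using eps by (auto simp: outer_const_def intro!: mult_nonneg_nonneg add_nonneg_nonneg)
  have M: "?M \<ge> 0" using eps by (auto simp: inner_const_def)
  consider "\<bar>t\<bar> \<le> eps" | "eps \<le> \<bar>t\<bar>" "\<bar>t\<bar> \<le> pi" | "pi < \<bar>t\<bar>" by linarith
  then show ?thesis
  proof cases
    case 1
    then have "t \<in> {- pi..pi}" using eps pi_gt3 by (auto simp: abs_le_iff)
    then show ?thesis using inner_bound[OF d w 1] T by simp
  next
    case 2
    then have "t \<in> {- pi..pi}" by (auto simp: abs_le_iff)
    then have "norm (indicator {- pi..pi} t *\<^sub>R osc d w t - gauss d w t) \<le> norm (osc d w t) + norm (gauss d w t)"
      by (simp add: norm_triangle_ineq4)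
    also have "\<dots> \<le> outer_const d + ?M" using gauss_outer_bound[OF d w 2(1)] osc_outer_bound[OF w 2] by linarith
    finally show ?thesis using \<open>t \<in> _\<close> by simp
  next
    case 3
    then have "t \<notin> {- pi..pi}" "eps \<le> \<bar>t\<bar>" using eps pi_gt3 by auto
    then show ?thesis using gauss_outer_bound[OF d w, of t] by simp
  qed
qed

text \<open>Up to a constant and a power of \<open>z\<close>, this is the Jensen polynomial at \<open>z\<close> in the variable
  \<open>w = sd (1 + q / z)\<close>.\<close>

definition saddle_poly :: "nat \<Rightarrow> real poly" where
  "saddle_poly d = smult (sqrt (2 * pi) * sd) (\<Sum>j\<le>d. smult (real (d choose j) * weight (n + j) * sd ^ j) ([:- sd, 1:] ^ (d - j)))"

lemma osc_integral:
  "has_bochner_integral lborel (\<lambda>t. indicator {- pi..pi} t *\<^sub>R osc d w t) (of_real (sqrt (2 * pi) / sd * poly (saddle_poly d) w))"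
proof -
  have "((\<lambda>t. \<Sum>j\<le>d. of_real (real (d choose j) * sd ^ j * (w - sd) ^ (d - j)) * (exp (psi t) * exp (- \<i> * of_nat j * of_real t))) has_integral
     (\<Sum>j\<le>d. of_real (real (d choose j) * sd ^ j * (w - sd) ^ (d - j)) * of_real (2 * pi * weight (n + j)))) {- pi..pi}"
    by (intro has_integral_sum has_integral_mult_right exp_psi_fourier) auto
  moreover have "(\<Sum>j\<le>d. of_real (real (d choose j) * sd ^ j * (w - sd) ^ (d - j)) * (exp (psi t) * exp (- \<i> * of_nat j * of_real t))) = osc d w t" for t
  proof -
    have "exp (- \<i> * of_nat j * of_real t) = iexp (- t) ^ j" for j
      by (simp add: exp_of_nat_mult[symmetric] mult_ac)
    moreover have "(of_real w + of_real sd * (iexp (- t) - 1)) ^ d = (\<Sum>j\<le>d. of_nat (d choose j) * (of_real sd * iexp (- t)) ^ j * of_real (w - sd) ^ (d - j))"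
      unfolding binomial_ring[symmetric] by (simp add: algebra_simps)
    ultimately show ?thesis unfolding osc_def
      by (simp add: sum_distrib_left power_mult_distrib mult_ac)
  qed
  moreover have "(\<Sum>j\<le>d. of_real (real (d choose j) * sd ^ j * (w - sd) ^ (d - j)) * of_real (2 * pi * weight (n + j))) =
     complex_of_real (sqrt (2 * pi) / sd * poly (saddle_poly d) w)"
  proof -
    have s: "sqrt (2 * pi) / sd * poly (saddle_poly d) w = 2 * pi * (\<Sum>j\<le>d. real (d choose j) * weight (n + j) * sd ^ j * (w - sd) ^ (d - j))"
      using sd(1) by (simp add: saddle_poly_def poly_sum)
    show ?thesis unfolding s sum_distrib_left of_real_sum[symmetric] of_real_mult[symmetric] by (simp add: mult_ac)
  qed
  ultimately have I: "(osc d w has_integral complex_of_real (sqrt (2 * pi) / sd * poly (saddle_poly d) w)) {- pi..pi}"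
    by simp
  have "continuous_on {- pi..pi} (osc d w)"
    unfolding osc_def by (intro continuous_intros exp_psi_fourier)
  then have si: "set_integrable lborel {- pi..pi} (osc d w)" by (rule borel_integrable_atLeastAtMost')
  then have "(LINT t:{- pi..pi}|lborel. osc d w t) = complex_of_real (sqrt (2 * pi) / sd * poly (saddle_poly d) w)"
    using set_borel_integral_eq_integral(2)[OF si] I by (simp add: integral_unique)
  then show ?thesis using si unfolding set_integrable_def set_lebesgue_integral_def by (simp add: has_bochner_integral_iff)
qed

text \<open>Integrating the majorant gives sqrt (52 pi) eps^2 <= 13 eps^2 for the Gaussian part and
  2 pi <= 6.5 for the constant part. The common factor sqrt (2 pi) / sd is at least eps^2 / 2, and
  dividing by it doubles both constants.\<close>

lemma saddle_poly_near_hermite: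
  assumes d: "1 \<le> d" and w: "\<bar>w\<bar> \<le> real d"
  shows "\<bar>poly (saddle_poly d) w - poly (hermite d) w\<bar> \<le> 26 * inner_const d * eps + 13 * outer_const d / eps\<^sup>2"
proof -
  let ?M = "\<lambda>t. inner_const d * eps * exp (- (1 / (52 * eps ^ 4)) * t\<^sup>2) + outer_const d * indicator {- pi..pi} t"
  let ?c = "sqrt (2 * pi) / sd"
  have e4: "0 < 1 / (52 * eps ^ 4)" using eps by simp
  have D: "has_bochner_integral lborel (\<lambda>t. indicator {- pi..pi} t *\<^sub>R osc d w t - gauss d w t)
     (of_real (?c * poly (saddle_poly d) w) - of_real ?c * complex_of_real (poly (hermite d) w))"
    unfolding gauss_def by (intro has_bochner_integral_diff osc_integral hermite_integral sd)
  have "has_bochner_integral lborel (indicator {- pi..pi}) (measure lborel {- pi..pi})"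
    by (rule has_bochner_integral_real_indicator) auto
  then have ind: "has_bochner_integral lborel (indicator {- pi..pi}) (2 * pi)" by simp
  have M: "has_bochner_integral lborel ?M (inner_const d * eps * sqrt (pi / (1 / (52 * eps ^ 4))) + outer_const d * (2 * pi))"
    by (intro has_bochner_integral_add has_bochner_integral_mult_right gaussian_integral e4 ind)
  let ?D = "\<lambda>t. indicator {- pi..pi} t *\<^sub>R osc d w t - gauss d w t"
  have "norm (integral\<^sup>L lborel ?D) \<le> (LINT t|lborel. norm (?D t))" by (rule integral_norm_bound)
  also have "\<dots> \<le> integral\<^sup>L lborel ?M"
    using total_bound[OF d w] D M by (intro integral_mono) (auto simp: has_bochner_integral_iff simp del: of_real_mult)
  finally have "norm (of_real (?c * poly (saddle_poly d) w) - of_real ?c * complex_of_real (poly (hermite d) w)) \<le>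
     inner_const d * eps * sqrt (pi / (1 / (52 * eps ^ 4))) + outer_const d * (2 * pi)"
    using D M by (simp only: has_bochner_integral_iff)
  also have "of_real (?c * poly (saddle_poly d) w) - of_real ?c * complex_of_real (poly (hermite d) w) =
    of_real (?c * (poly (saddle_poly d) w - poly (hermite d) w))" by (simp add: algebra_simps)
  also have "norm (complex_of_real (?c * (poly (saddle_poly d) w - poly (hermite d) w))) = ?c * \<bar>poly (saddle_poly d) w - poly (hermite d) w\<bar>"
    unfolding norm_of_real abs_mult using sd(1) by simp
  finally have 1: "?c * \<bar>poly (saddle_poly d) w - poly (hermite d) w\<bar> \<le> inner_const d * eps * sqrt (pi / (1 / (52 * eps ^ 4))) + outer_const d * (2 * pi)" .
  have T: "outer_const d \<ge> 0" using eps by (auto simp: outer_const_def intro!: mult_nonneg_nonneg add_nonneg_nonneg)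
  have K: "inner_const d \<ge> 0" by (auto simp: inner_const_def)
  have "pi / (1 / (52 * eps ^ 4)) \<le> (13 * eps\<^sup>2)\<^sup>2"
  proof -
    have "pi * 52 \<le> 169" using pi_approx by simp
    then have "pi * 52 * eps ^ 4 \<le> 169 * eps ^ 4" using eps by (intro mult_right_mono) auto
    then show ?thesis by (simp add: power_mult_distrib)
  qed
  then have sq: "sqrt (pi / (1 / (52 * eps ^ 4))) \<le> 13 * eps\<^sup>2" by (intro real_le_lsqrt) auto
  have "2 * pi \<le> 6.5" using pi_approx by simp
  then have "inner_const d * eps * sqrt (pi / (1 / (52 * eps ^ 4))) + outer_const d * (2 * pi) \<le> inner_const d * eps * (13 * eps\<^sup>2) + outer_const d * 6.5"
    using sq T K eps by (intro add_mono mult_left_mono) auto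
  also have "\<dots> = (eps\<^sup>2 / 2) * (26 * inner_const d * eps + 13 * outer_const d / eps\<^sup>2)"
    using eps by (simp add: field_simps)
  finally have 2: "?c * \<bar>poly (saddle_poly d) w - poly (hermite d) w\<bar> \<le> (eps\<^sup>2 / 2) * (26 * inner_const d * eps + 13 * outer_const d / eps\<^sup>2)"
    using 1 by linarith
  have "2 \<le> sqrt (2 * pi)" using pi_gt3 by (intro real_le_rsqrt) auto
  then have "2 / (4 / eps\<^sup>2) \<le> ?c" using sd eps by (intro frac_le) auto
  then have "eps\<^sup>2 / 2 \<le> ?c" by simp
  then have "(eps\<^sup>2 / 2) * \<bar>poly (saddle_poly d) w - poly (hermite d) w\<bar> \<le> ?c * \<bar>poly (saddle_poly d) w - poly (hermite d) w\<bar>"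
    by (intro mult_right_mono) auto
  then have "(eps\<^sup>2 / 2) * \<bar>poly (saddle_poly d) w - poly (hermite d) w\<bar> \<le> (eps\<^sup>2 / 2) * (26 * inner_const d * eps + 13 * outer_const d / eps\<^sup>2)"
    using 2 by linarith
  then show ?thesis by (rule mult_left_le_imp_le) (use eps in simp)
qed

end

section \<open>Hyperbolicity of the Jensen polynomials\<close>

lemma map_poly_of_real_mult:
  "map_poly of_real (p * q) = map_poly of_real p * (map_poly of_real q :: 'a :: {real_algebra_1, comm_semiring_0} poly)"
  by (rule poly_eqI) (simp add: coeff_map_poly coeff_mult)

lemma map_poly_of_real_sum:
  "map_poly of_real (\<Sum>i\<in>A. f i) = (\<Sum>i\<in>A. map_poly of_real (f i) :: 'a :: {real_algebra_1, comm_semiring_0} poly)"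
  by (rule poly_eqI) (simp add: coeff_map_poly coeff_sum)

lemma map_poly_of_real_power:
  "map_poly of_real (p ^ k) = (map_poly of_real p ^ k :: 'a :: {real_algebra_1, comm_semiring_1} poly)"
  by (induction k) (simp_all add: map_poly_of_real_mult)

lemma map_poly_of_real_smult:
  "map_poly of_real (smult c p) = smult (of_real c) (map_poly of_real p :: 'a :: {real_algebra_1, comm_semiring_0} poly)"
  by (rule map_poly_smult) auto

lemma coeff_linear_power_top:
  fixes a :: "'a :: idom"
  assumes "k \<le> d"
  shows "coeff ([:a, 1:] ^ k) d = (if k = d then 1 else 0)"
proof (cases "k = d")
  case True
  have "degree ([:a, 1:] ^ d) = d" by (simp add: degree_power_eq)
  then have "coeff ([:a, 1:] ^ d) d = lead_coeff ([:a, 1:] ^ d)" by simp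
  also have "\<dots> = 1" unfolding lead_coeff_power by simp
  finally show ?thesis using True by simp
next
  case False
  then show ?thesis using assms by (simp add: coeff_eq_0 degree_power_eq)
qed

context saddle
begin

lemma coeff_saddle_poly: "coeff (saddle_poly d) d = sqrt (2 * pi) * sd * weight n"
  and degree_saddle_poly: "degree (saddle_poly d) = d"
proof -
  have "coeff (\<Sum>j\<le>d. smult (real (d choose j) * weight (n + j) * sd ^ j) ([:- sd, 1:] ^ (d - j))) d =
      (\<Sum>j\<le>d. if j = 0 then weight n else 0)"
    unfolding coeff_sum by (intro sum.cong refl) (auto simp: coeff_linear_power_top)
  then show c: "coeff (saddle_poly d) d = sqrt (2 * pi) * sd * weight n"
    by (simp add: saddle_poly_def sum.delta)
  have "degree (saddle_poly d) \<le> d"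
    unfolding saddle_poly_def
    by (intro order.trans[OF degree_smult_le] degree_sum_le) (auto intro: order.trans[OF degree_power_le])
  moreover have "coeff (saddle_poly d) d \<noteq> 0" unfolding c using sd(1) weight_pos[of n] by simp
  then have "d \<le> degree (saddle_poly d)" by (rule le_degree)
  ultimately show "degree (saddle_poly d) = d" by simp
qed

lemma poly_saddle_poly_complex:
  "poly (map_poly complex_of_real (saddle_poly d)) (of_real sd * (1 + of_real q / z)) =
     of_real (sqrt (2 * pi) * sd ^ Suc d * q ^ (n + d) / gq) * poly (map_poly of_real (jensen_poly (\<lambda>k. real (PL k)) d n)) z / z ^ d"
  if z: "z \<noteq> 0"
proof -
  have Q: "poly (map_poly complex_of_real (saddle_poly d)) (of_real sd * (1 + of_real q / z)) =
     of_real (sqrt (2 * pi) * sd) * (\<Sum>j\<le>d. of_real (real (d choose j) * weight (n + j) * sd ^ j) * (of_real sd * (of_real q / z)) ^ (d - j))"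
    unfolding saddle_poly_def map_poly_of_real_smult map_poly_of_real_sum map_poly_of_real_power
    by (simp add: poly_sum map_poly_pCons algebra_simps)
  have J: "poly (map_poly complex_of_real (jensen_poly (\<lambda>k. real (PL k)) d n)) z = (\<Sum>j\<le>d. of_real (real (d choose j) * real (PL (n + j))) * z ^ j)"
    unfolding jensen_poly_def map_poly_of_real_sum by (simp add: map_poly_monom poly_monom poly_sum atLeast0AtMost)
  have t: "of_real (sqrt (2 * pi) * sd) * (of_real (real (d choose j) * weight (n + j) * sd ^ j) * (of_real sd * (of_real q / z)) ^ (d - j)) =
     of_real (sqrt (2 * pi) * sd ^ Suc d * q ^ (n + d) / gq) * (of_real (real (d choose j) * real (PL (n + j))) * z ^ j) / z ^ d" if "j \<le> d" for j
  proof -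
    have "complex_of_real sd ^ d = of_real sd ^ j * of_real sd ^ (d - j)"
      "complex_of_real q ^ (n + d) = of_real q ^ (n + j) * of_real q ^ (d - j)" "z ^ d = z ^ j * z ^ (d - j)"
      using that by (simp_all add: power_add[symmetric])
    then show ?thesis using z gq_pos by (simp add: weight_def power_mult_distrib power_divide)
  qed
  show ?thesis unfolding Q J sum_distrib_left sum_divide_distrib by (intro sum.cong refl t) simp
qed

lemma jensen_hyperbolic:
  assumes d: "1 \<le> d" and small: "26 * inner_const d * eps + 13 * outer_const d / eps\<^sup>2 < 1"
  shows "hyperbolic (jensen_poly (\<lambda>k. real (PL k)) d n)"
  unfolding hyperbolic_def
proof (intro allI impI)
  fix z :: complex
  assume root: "poly (map_poly complex_of_real (jensen_poly (\<lambda>k. real (PL k)) d n)) z = 0"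
  show "z \<in> \<real>"
  proof (cases "z = 0")
    case False
    have "lead_coeff (saddle_poly d) > 0"
      unfolding degree_saddle_poly coeff_saddle_poly using sd(1) weight_pos[of n] by simp
    moreover have "poly (map_poly complex_of_real (saddle_poly d)) (of_real sd * (1 + of_real q / z)) = 0"
      unfolding poly_saddle_poly_complex[OF False] root by simp
    moreover have "\<bar>poly (saddle_poly d) x - poly (hermite d) x\<bar> < 1" if "\<bar>x\<bar> \<le> real d" for x
      using saddle_poly_near_hermite[OF d that] small by linarith
    ultimately have "of_real sd * (1 + of_real q / z) \<in> \<real>"
      using near_hermite_real_rooted[OF degree_saddle_poly d] by blast
    \<comment> \<open>The substitution inverts to z = q / (w / sd - 1), so a real w comes from a
      real z.\<close>
    then have "of_real q / (of_real sd * (1 + of_real q / z) / of_real sd - 1) \<in> \<real>"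
      by (intro Reals_divide Reals_diff Reals_1 Reals_of_real)
    also have "of_real q / (of_real sd * (1 + of_real q / z) / of_real sd - 1) = z"
      using sd(1) q_bounds(2) False by simp
    finally show ?thesis .
  qed simp
qed

end

section \<open>Existence of the saddle point and an explicit threshold\<close>

lemma saddle_exists:
  assumes "32 \<le> n"
  shows "\<exists>q. saddle n q"
proof -
  define f where "f = (\<lambda>q :: real. \<Sum>N. real (sigma2 N) * q ^ N)"
  have sm: "summable (\<lambda>N. real (sigma2 N) * q ^ N)" if "0 \<le> q" "q < 1" for q :: real
    using summable_sigma2[of q 0] that by simp
  \<comment> \<open>Chosen so that the geometric series without its constant term, 1 / (1 - b) - 1,
    equals n; at the other end q = 1 / 2 the upper bound 2 * 2! * 2^3 = 32 explains the hypothesis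
    on n.\<close>
  define b where "b = real n / (real n + 1)"
  have b: "1 / 2 \<le> b" "b < 1" "1 - b = 1 / (real n + 1)" using assms by (auto simp: b_def field_simps)
  have "f (1 / 2) \<le> real n"
    using suminf_sigma2_le[of "1 / 2" 0] assms by (simp add: f_def fact_numeral eval_nat_numeral)
  moreover have "real n \<le> f b"
  proof -
    have "(\<lambda>N. b ^ N - (if N = 0 then 1 else 0)) sums (1 / (1 - b) - 1)"
      using b sums_single[of 0 "\<lambda>_. 1 :: real"] by (intro sums_diff geometric_sums) auto
    moreover have "b ^ N - (if N = 0 then 1 else 0) \<le> real (sigma2 N) * b ^ N" for N
    proof (cases "N = 0")
      case False
      then have "1 \<le> N ^ 2" by simp
      then have "1 \<le> sigma2 N" using sigma2_ge[of N] by linarith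
      then have "1 * b ^ N \<le> real (sigma2 N) * b ^ N" using b by (intro mult_right_mono) auto
      then show ?thesis using False by simp
    qed (simp add: sigma2_def)
    ultimately have "1 / (1 - b) - 1 \<le> f b"
      unfolding f_def using b by (intro sums_le[OF _ _ summable_sums[OF sm]]) auto
    then show ?thesis unfolding b(3) by simp
  qed
  moreover have "continuous_on {1 / 2..b} f"
  proof (rule continuous_at_imp_continuous_on, rule ballI)
    fix x assume x: "x \<in> {1 / 2..b}"
    have "norm x < norm ((x + 1) / 2)" using x b by auto
    moreover have "summable (\<lambda>N. real (sigma2 N) * ((x + 1) / 2) ^ N)" using x b by (intro sm) auto
    ultimately show "isCont f x" unfolding f_def by (intro isCont_powser)
  qed
  ultimately obtain q where "1 / 2 \<le> q" "q \<le> b" "f q = real n"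
    using IVT'[of f "1 / 2" "real n" b] b by auto
  then have "saddle n q" using b by unfold_locales (auto simp: f_def)
  then show ?thesis ..
qed

text \<open>A common bound for the two error terms: exp 325 stems from \<open>inner_const\<close>,
  and 468 = 9 * 52 from the outer part, where d + 8 y <= 9 y and 26 (d + 2) <= 52 d. The exponent d
  + 2 is that of y in the outer estimate.\<close>

definition threshold :: "nat \<Rightarrow> real" where
  "threshold d = exp 325 * 468 ^ d * real d ^ (d + 2)"

lemma exp_325_ge: "140608 \<le> exp (325 :: real)"
proof -
  have "(140608 :: real) \<le> 2 ^ 20" by simp
  also have "\<dots> \<le> exp 1 ^ 20" using exp_ge_add_one_self[of "1 :: real"] by (intro power_mono) auto
  also have "\<dots> = exp 20" by (simp add: exp_of_nat_mult[symmetric])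
  also have "\<dots> \<le> exp 325" by simp
  finally show ?thesis .
qed

lemma (in saddle) saddle_error_small:
  assumes d: "4 \<le> d" and n: "4 * threshold d ^ 3 \<le> real n"
  shows "26 * inner_const d * eps + 13 * outer_const d / eps\<^sup>2 < 1"
proof -
  define X where "X = 1 / eps"
  have X: "0 < X" "eps = 1 / X" using eps by (auto simp: X_def)
  have T: "0 < threshold d" using d by (simp add: threshold_def)
  have "4 * threshold d ^ 3 \<le> 4 * X ^ 3" using n n_le by (simp add: X_def power_divide)
  \<comment> \<open>\<open>n_le\<close> turns the lower bound on n into one on 1 / eps by taking
    cube roots.\<close>
  then have TX: "threshold d \<le> X" using X(1) T by (intro power_le_imp_le_base[of "threshold d" 2]) (auto simp: numeral_3_eq_3)
  have "52 * inner_const d \<le> threshold d"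
  proof -
    have "(52 :: real) * (216 + 4 * real d) \<le> 468 ^ 2 * real d" using d by simp
    also have "\<dots> \<le> 468 ^ d * real d ^ 2" using d by (intro mult_mono power_increasing) (auto simp: power2_eq_square)
    finally have "exp 325 * real d ^ d * (52 * (216 + 4 * real d)) \<le> exp 325 * real d ^ d * (468 ^ d * real d ^ 2)"
      by (intro mult_left_mono) auto
    then show ?thesis unfolding inner_const_def threshold_def power_add by (simp only: mult_ac)
  qed
  then have "52 * inner_const d \<le> X" using TX by linarith
  then have "52 * inner_const d * eps \<le> X * eps" using eps by (intro mult_right_mono) auto
  then have 1: "26 * inner_const d * eps \<le> 1 / 2" using eps by (simp add: X_def)
  define y where "y = X\<^sup>2"
  have "1 \<le> threshold d"
  proof -
    have "1 * 1 * 1 \<le> exp 325 * 468 ^ d * real d ^ (d + 2)"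
      using d by (intro mult_mono one_le_power) auto
    then show ?thesis by (simp add: threshold_def)
  qed
  then have "1 * X \<le> X * X" using TX by (intro mult_right_mono) auto
  then have yT: "threshold d \<le> y" using TX by (simp add: y_def power2_eq_square)
  have "52 * (9 ^ d * (26 * (real d + 2)) ^ (d + 2)) \<le> threshold d"
  proof -
    have "(26 * (real d + 2)) ^ (d + 2) \<le> (52 * real d) ^ (d + 2)" using d by (intro power_mono) auto
    also have "\<dots> = 52 ^ d * 2704 * real d ^ (d + 2)" unfolding power_mult_distrib by (simp add: power_add)
    finally have "52 * (9 ^ d * (26 * (real d + 2)) ^ (d + 2)) \<le> 52 * (9 ^ d * (52 ^ d * 2704 * real d ^ (d + 2)))"
      by (intro mult_left_mono) auto
    also have "\<dots> = 140608 * 468 ^ d * real d ^ (d + 2)"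
      using power_mult_distrib[of "9 :: real" 52 d] by simp
    also have "\<dots> \<le> exp 325 * 468 ^ d * real d ^ (d + 2)" using exp_325_ge by (intro mult_right_mono) auto
    finally show ?thesis by (simp add: threshold_def)
  qed
  then have y: "52 * (9 ^ d * (26 * (real d + 2)) ^ (d + 2)) \<le> y" using yT by linarith
  have y0: "0 < y" using X by (simp add: y_def)
  have dy: "real d \<le> y"
  proof -
    have "1 * 1 * real d ^ 1 \<le> exp 325 * 468 ^ d * real d ^ (d + 2)"
      using d by (intro mult_mono one_le_power power_increasing) auto
    then show ?thesis using yT by (simp add: threshold_def)
  qed
  have e: "1 / eps\<^sup>2 = y" "1 / (26 * eps\<^sup>2) = y / 26" "8 / eps\<^sup>2 = 8 * y" using X by (simp_all add: y_def power_divide)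
  have "13 * outer_const d / eps\<^sup>2 = 13 * (1 / eps\<^sup>2) * outer_const d" by simp
  also have "\<dots> = 13 * y * (exp (- (y / 26)) * (real d + 8 * y) ^ d)"
    unfolding outer_const_def e ..
  also have "\<dots> \<le> 13 * y * (exp (- (y / 26)) * (9 * y) ^ d)"
    using dy y0 by (intro mult_left_mono power_mono) auto
  also have "\<dots> \<le> 1 / 4"
  proof -
    \<comment> \<open>The quantity to be bounded contains y^(d + 1). The exponential is made to beat
      one power more, and the spare y, being at least the threshold, cancels the constants.\<close>
    have "(y / 26) ^ (d + 2) \<le> real (d + 2) ^ (d + 2) * exp (y / 26)" using y0 by (intro power_le_exp) simp
    then have "26 ^ (d + 2) * (y / 26) ^ (d + 2) \<le> 26 ^ (d + 2) * (real (d + 2) ^ (d + 2) * exp (y / 26))"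
      by (rule mult_left_mono) simp
    then have "y ^ (d + 2) \<le> (26 * (real d + 2)) ^ (d + 2) * exp (y / 26)"
      unfolding mult.assoc[symmetric] power_mult_distrib[symmetric] by (simp add: add.commute)
    then have "13 * 9 ^ d * y ^ (d + 2) \<le> 13 * 9 ^ d * ((26 * (real d + 2)) ^ (d + 2) * exp (y / 26))" by simp
    also have "\<dots> = 52 * (9 ^ d * (26 * (real d + 2)) ^ (d + 2)) * (exp (y / 26) / 4)" by simp
    also have "\<dots> \<le> y * (exp (y / 26) / 4)" using y by (intro mult_right_mono) auto
    finally have "13 * y * (9 * y) ^ d * y \<le> exp (y / 26) / 4 * y"
      by (simp add: power_mult_distrib power_add power2_eq_square mult_ac)
    then have "13 * y * (9 * y) ^ d \<le> exp (y / 26) / 4" using y0 by (rule mult_right_le_imp_le)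
    then show ?thesis by (simp add: exp_minus field_simps)
  qed
  finally show ?thesis using 1 by linarith
qed

section \<open>Comparison with the claimed bound\<close>

lemma power_8_le_fact: "8 ^ k \<le> (fact (k + 7) :: real)"
proof (induction k)
  case (Suc k)
  have "8 ^ Suc k = 8 * (8 ^ k :: real)" by simp
  also have "\<dots> \<le> real (k + 8) * fact (k + 7)" using Suc by (intro mult_mono) auto
  also have "\<dots> = fact (Suc k + 7)" by (simp add: eval_nat_numeral)
  finally show ?case .
qed (simp add: fact_numeral)

text \<open>975 = 3 * 325 is the exponent in threshold^3. Since 2 pi < 8, powers of 8 suffice: Gamma
  (2 d^2) = (m + 7)! with m = 2 d^2 - 8, and m >= 2 d + 6 for d >= 4.\<close>

lemma gamma_exponent_ge:
  assumes "4 \<le> d"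
  shows "975 \<le> Gamma (2 * real d ^ 2) / (2 * pi) ^ (2 * d + 2)"
proof -
  define m where "m = 2 * d ^ 2 - 8"
  have d2: "4 * d \<le> d ^ 2" using assms by (simp add: power2_eq_square)
  then have m: "7 * d - 4 \<le> m" "2 * real d ^ 2 = 1 + real (m + 7)" using assms by (auto simp: m_def of_nat_diff)
  have "(975 :: real) \<le> 8 ^ 4" by simp
  moreover have "(2 * pi) ^ (2 * d + 2) \<le> 8 ^ (2 * d + 2)" using pi_less_4 by (intro power_mono) auto
  ultimately have "975 * (2 * pi) ^ (2 * d + 2) \<le> 8 ^ 4 * 8 ^ (2 * d + 2)" by (intro mult_mono) auto
  also have "\<dots> = (8 :: real) ^ (2 * d + 6)" by (simp add: power_add)
  also have "\<dots> \<le> 8 ^ m" using m(1) assms by (intro power_increasing) auto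
  also have "\<dots> \<le> fact (m + 7)" by (rule power_8_le_fact)
  also have "\<dots> = Gamma (2 * real d ^ 2)" unfolding m(2) Gamma_fact ..
  finally show ?thesis by (simp add: pos_le_divide_eq)
qed

text \<open>In the d-dependence, 3 d + 6 <= 6 d and 468^(3 d) <= (468^2)^(2 d) fit the power 2 d,
  with 468^2 <= 6 * 22.2^4 and 3 (d - 1) / 2 >= 4. The summand 1 leaves room for rounding the bound
  down to an integer.\<close>

lemma bound_ge_threshold:
  assumes d: "4 \<le> d"
  shows "4 * threshold d ^ 3 + 1 \<le> 279928 * (real d * (real d - 1))
      * (6 * real d ^ 3 * (22.2::real) powr (3 * (real d - 1) / 2)) ^ (2 * d)
      * exp (Gamma (2 * real d ^ 2) / (2 * pi) ^ (2 * d + 2))"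
proof -
  have "threshold d ^ 3 = exp 325 ^ 3 * (468 ^ d) ^ 3 * (real d ^ (d + 2)) ^ 3"
    by (simp add: threshold_def power_mult_distrib)
  also have "exp (325 :: real) ^ 3 = exp 975" by (simp add: exp_of_nat_mult[symmetric])
  also have "(468 ^ d) ^ 3 = (468 :: real) ^ (3 * d)" by (simp add: power_mult[symmetric] mult.commute)
  also have "(real d ^ (d + 2)) ^ 3 = real d ^ (3 * d + 6)"
    unfolding power_mult[symmetric] by (rule arg_cong[where f = "\<lambda>k. _ ^ k"]) simp
  finally have t: "threshold d ^ 3 = exp 975 * 468 ^ (3 * d) * real d ^ (3 * d + 6)" .
  have "exp 975 * 468 ^ (3 * d) * real d ^ (3 * d + 6) \<le> exp 975 * 468 ^ (4 * d) * real d ^ (6 * d)"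
    using d by (intro mult_mono power_increasing) auto
  also have "\<dots> = (468 ^ 2 * real d ^ 3) ^ (2 * d) * exp 975"
    by (simp add: power_mult_distrib power_mult[symmetric] del: power_numeral)
  also have "\<dots> \<le> (6 * real d ^ 3 * (22.2::real) powr (3 * (real d - 1) / 2)) ^ (2 * d) * exp (Gamma (2 * real d ^ 2) / (2 * pi) ^ (2 * d + 2))"
  proof (rule mult_mono[OF power_mono])
    have "(22.2::real) powr 4 \<le> 22.2 powr (3 * (real d - 1) / 2)" using d by (intro powr_mono) auto
    then have "(22.2::real) ^ 4 \<le> 22.2 powr (3 * (real d - 1) / 2)" by simp
    moreover have "(468 ^ 2 :: real) \<le> 6 * 22.2 ^ 4" by (simp add: eval_nat_numeral)
    ultimately have "468 ^ 2 \<le> 6 * (22.2::real) powr (3 * (real d - 1) / 2)" by linarith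
    then have "468 ^ 2 * real d ^ 3 \<le> 6 * (22.2::real) powr (3 * (real d - 1) / 2) * real d ^ 3" by (intro mult_right_mono) auto
    then show "468 ^ 2 * real d ^ 3 \<le> 6 * real d ^ 3 * (22.2::real) powr (3 * (real d - 1) / 2)" by (simp add: mult_ac)
    show "exp 975 \<le> exp (Gamma (2 * real d ^ 2) / (2 * pi) ^ (2 * d + 2))"
      using gamma_exponent_ge[OF d] by simp
  qed auto
  finally have le: "threshold d ^ 3 \<le> (6 * real d ^ 3 * (22.2::real) powr (3 * (real d - 1) / 2)) ^ (2 * d) * exp (Gamma (2 * real d ^ 2) / (2 * pi) ^ (2 * d + 2))"
    (is "_ \<le> ?P") unfolding t .
  have "1 \<le> threshold d ^ 3"
  proof -
    have "1 * 1 * 1 \<le> exp 325 * 468 ^ d * real d ^ (d + 2)"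
      using d by (intro mult_mono one_le_power) auto
    then show ?thesis unfolding threshold_def[symmetric] by simp
  qed
  then have "4 * threshold d ^ 3 + 1 \<le> 5 * ?P" using le by linarith
  also have "5 * ?P \<le> (279928 * (real d * (real d - 1))) * ?P"
  proof (intro mult_right_mono)
    have "1 * 1 \<le> real d * (real d - 1)" using d by (intro mult_mono) auto
    then show "5 \<le> 279928 * (real d * (real d - 1))" by linarith
  qed simp
  finally show ?thesis by (simp only: mult.assoc)
qed

theorem theorem1p1:
  fixes d :: nat
  assumes "d \<ge> 4"
  shows "real (N_PL d) \<le>
    279928 * (real d * (real d - 1))
      * (6 * real d ^ 3 * (22.2::real) powr (3 * (real d - 1) / 2)) ^ (2 * d)
      * exp (Gamma (2 * real d ^ 2) / (2 * pi) ^ (2 * d + 2))"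
    (is "_ \<le> ?B")
proof -
  have B: "4 * threshold d ^ 3 + 1 \<le> ?B" by (rule bound_ge_threshold[OF assms])
  have t: "2 \<le> threshold d"
  proof -
    have "1 * 1 * 2 \<le> exp 325 * 468 ^ d * real d ^ 1"
      using assms by (intro mult_mono one_le_power) auto
    also have "\<dots> \<le> threshold d"
      unfolding threshold_def using assms by (intro mult_left_mono power_increasing) auto
    finally show ?thesis by simp
  qed
  \<comment> \<open>\<open>N_PL d\<close> is a least element, so one admissible natural number
    bounds it; the floor of the bound is used, and it still exceeds 4 * threshold^3 thanks to the
    spare 1.\<close>
  have "hyperbolic (jensen_poly (\<lambda>k. real (PL k)) d n)" if "n \<ge> nat \<lfloor>?B\<rfloor>" for n
  proof -
    have "real_of_int \<lfloor>?B\<rfloor> \<le> real n" using that by linarith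
    then have n: "4 * threshold d ^ 3 \<le> real n" using B floor_correct[of ?B] by linarith
    \<comment> \<open>4 * 2^3 = 32 is the size required by \<open>saddle_exists\<close>.\<close>
    have "2 ^ 3 \<le> threshold d ^ 3" using t by (intro power_mono) auto
    then have "32 \<le> n" using n by simp
    then obtain q where "saddle n q" using saddle_exists by blast
    then interpret saddle n q .
    show ?thesis by (rule jensen_hyperbolic[OF _ saddle_error_small[OF assms n]]) (use assms in simp)
  qed
  then have "N_PL d \<le> nat \<lfloor>?B\<rfloor>" unfolding N_PL_def by (intro Least_le) blast
  then have "real (N_PL d) \<le> real (nat \<lfloor>?B\<rfloor>)" by simp
  also have "\<dots> \<le> ?B"
  proof -
    have "0 \<le> 4 * threshold d ^ 3" using t by simp
    then have "0 \<le> ?B" using B by linarith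
    then show ?thesis by (rule of_nat_floor)
  qed
  finally show ?thesis .
qed

end
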